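(* Let $m,n\in\mathbb N$ with $m\equiv n\pmod 2$, and let $\sigma\in\mathcal B_{nm}$ with $r=\operatorname{rank}(\sigma)$. Let $P^\sigma=\operatorname{Reg}(\mathcal B_{mn}^\sigma)$, and for $0\le q\le r$ with $q\equiv r\pmod 2$ let $D_q^\sigma=\{\alpha\in P^\sigma:\operatorname{rank}(\alpha)=q\}$ and $I_q=\{\alpha\in P^\sigma:\operatorname{rank}(\alpha)\leq q\}$. If $m\geq n$, then for any $0\leq q<r$ with $q\equiv r\pmod 2$, the ideal $I_q$ of $P^\sigma$ is generated by the set $E(D_q^\sigma)$ of idempotents contained in $D_q^\sigma$. Moreover, $$\operatorname{rank}(I_q)=\operatorname{idrank}(I_q)=\binom rq\frac{(r-q-1)!!\,(m+q-1)!!}{(r+q-1)!!}.$$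
   Context: $\mathbb N=\{0,1,2,\ldots\}$, $[n]=\{1,\ldots,n\}$ (with $[0]=\emptyset$), and $A'=\{a':a\in A\}$, $A''=\{a'':a\in A\}$ for $A\subseteq\mathbb N$. For $m,n\in\mathbb N$, $\mathcal B_{mn}$ is the set of all Brauer partitions, i.e. set partitions of $[m]\cup[n]'$ into blocks of size $2$. For $\alpha\in\mathcal B_{mn}$ and $\beta\in\mathcal B_{nk}$, the product $\alpha\beta\in\mathcal B_{mk}$ is formed as follows: view partitions as graphs whose connected components are the blocks; let $\alpha_\downarrow$ be the graph on $[m]\cup[n]''$ obtained from $\alpha$ by renaming each $x'$ to $x''$, let $\beta^\uparrow$ be the graph on $[n]''\cup[k]'$ obtained from $\beta$ by renaming each $x\in[n]$ to $x''$, and let $\Pi(\alpha,\beta)$ be the union of these graphs on $[m]\cup[n]''\cup[k]'$; two elements of $[m]\cup[k]'$ lie in the same block of $\alpha\beta$ iff they lie in the same connected component of $\Pi(\alpha,\beta)$. The rank of a partition $\alpha\in\mathcal B_{mn}$ is the number of blocks of $\alpha$ meeting both $[m]$ and $[n]'$. For $\sigma\in\mathcal B_{nm}$, the sandwich semigroup $\mathcal B_{mn}^\sigma$ is the set $\mathcal B_{mn}$ with the associative operation $\alpha\star_\sigma\beta=\alpha\sigma\beta$. $\operatorname{Reg}(T)$ denotes the set of (von Neumann) regular elements of a semigroup $T$; $P^\sigma$ is a subsemigroup of $\mathcal B_{mn}^\sigma$, and its ideals are precisely the sets $I_q$. "Idempotent" and "generated" refer to the operation $\star_\sigma$. For a semigroup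 $T$, $\operatorname{rank}(T)$ is the minimum size of a (semigroup) generating set for $T$; and, if $T$ is idempotent-generated, $\operatorname{idrank}(T)$ is the minimum size of a generating set for $T$ consisting of idempotents. For odd $k\ge1$, $k!!=k(k-2)\cdots3\cdot1$, and $(-1)!!=1$. *)

theory Defs
  imports Complex_Main "HOL-Library.Disjoint_Sets" "HOL-Number_Theory.Cong"
begin

inductive_set sgen :: "('a \<Rightarrow> 'a \<Rightarrow> 'a) \<Rightarrow> 'a set \<Rightarrow> 'a set"
  for f :: "'a \<Rightarrow> 'a \<Rightarrow> 'a" and A :: "'a set" where
  base: "a \<in> A \<Longrightarrow> a \<in> sgen f A"
| mult: "a \<in> sgen f A \<Longrightarrow> b \<in> sgen f A \<Longrightarrow> f a b \<in> sgen f A"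

definition regular_elements :: "('a \<Rightarrow> 'a \<Rightarrow> 'a) \<Rightarrow> 'a set \<Rightarrow> 'a set" where
  "regular_elements f T = {a \<in> T. \<exists>b\<in>T. f (f a b) a = a}"

definition idempotents :: "('a \<Rightarrow> 'a \<Rightarrow> 'a) \<Rightarrow> 'a set \<Rightarrow> 'a set" where
  "idempotents f T = {a \<in> T. f a a = a}"

text \<open>The minima below are over finite generating sets; they are meaningful when such
  generating sets exist, which is automatic for the first one when \<open>T\<close> is a finite semigroup,
  and for the second one when \<open>T\<close> is moreover idempotent-generated.\<close>

definition sg_rank :: "('a \<Rightarrow> 'a \<Rightarrow> 'a) \<Rightarrow> 'a set \<Rightarrow> nat" where
  "sg_rank f T = (LEAST k. \<exists>A \<subseteq> T. finite A \<and> card A = k \<and> sgen f A = T)"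

definition sg_idrank :: "('a \<Rightarrow> 'a \<Rightarrow> 'a) \<Rightarrow> 'a set \<Rightarrow> nat" where
  "sg_idrank f T = (LEAST k. \<exists>A \<subseteq> idempotents f T. finite A \<and> card A = k \<and> sgen f A = T)"

text \<open>\<open>Plain x\<close>, \<open>Prime x\<close>, \<open>DPrime x\<close> stand for the vertices $x$, $x'$, $x''$.\<close>

datatype vertex = Plain nat | Prime nat | DPrime nat

definition verts :: "nat \<Rightarrow> nat \<Rightarrow> vertex set" where
  "verts m n = Plain ` {1..m} \<union> Prime ` {1..n}"

definition brauer :: "nat \<Rightarrow> nat \<Rightarrow> vertex set set set" where
  "brauer m n = {\<alpha>. partition_on (verts m n) \<alpha> \<and> (\<forall>B\<in>\<alpha>. card B = 2)}"

fun down_vertex :: "vertex \<Rightarrow> vertex" where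
  "down_vertex (Plain x) = Plain x"
| "down_vertex (Prime x) = DPrime x"
| "down_vertex (DPrime x) = DPrime x"

fun up_vertex :: "vertex \<Rightarrow> vertex" where
  "up_vertex (Plain x) = DPrime x"
| "up_vertex (Prime x) = Prime x"
| "up_vertex (DPrime x) = DPrime x"

text \<open>A partition is viewed as the graph in which any two vertices of the same block are
  adjacent; graphs are represented by their (symmetric) edge relations.\<close>

definition part_graph :: "vertex set set \<Rightarrow> vertex rel" where
  "part_graph \<alpha> = (\<Union>B\<in>\<alpha>. B \<times> B)"

definition product_graph :: "vertex set set \<Rightarrow> vertex set set \<Rightarrow> vertex rel" where
  "product_graph \<alpha> \<beta> =
     part_graph ((`) down_vertex ` \<alpha>) \<union> part_graph ((`) up_vertex ` \<beta>)"

text \<open>The product of \<open>\<alpha> \<in> brauer m n\<close> and \<open>\<beta> \<in> brauer n k\<close>: the blocks are the traces on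
  \<open>verts m k\<close> of the connected components of the product graph.\<close>

definition brauer_mult ::
  "nat \<Rightarrow> nat \<Rightarrow> vertex set set \<Rightarrow> vertex set set \<Rightarrow> vertex set set" where
  "brauer_mult m k \<alpha> \<beta> =
     verts m k // {(x, y). x \<in> verts m k \<and> y \<in> verts m k \<and> (x, y) \<in> (product_graph \<alpha> \<beta>)\<^sup>*}"

definition brauer_rank :: "vertex set set \<Rightarrow> nat" where
  "brauer_rank \<alpha> = card {B \<in> \<alpha>. B \<inter> range Plain \<noteq> {} \<and> B \<inter> range Prime \<noteq> {}}"

text \<open>For \<open>\<alpha>, \<beta> \<in> brauer m n\<close> and \<open>\<sigma> \<in> brauer n m\<close>; note that \<open>\<alpha>\<sigma> \<in> brauer m m\<close>.\<close>

definition sandwich ::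
  "nat \<Rightarrow> nat \<Rightarrow> vertex set set \<Rightarrow> vertex set set \<Rightarrow> vertex set set \<Rightarrow> vertex set set" where
  "sandwich m n \<sigma> \<alpha> \<beta> = brauer_mult m n (brauer_mult m m \<alpha> \<sigma>) \<beta>"

definition P_reg :: "nat \<Rightarrow> nat \<Rightarrow> vertex set set \<Rightarrow> vertex set set set" where
  "P_reg m n \<sigma> = regular_elements (sandwich m n \<sigma>) (brauer m n)"

definition D_set :: "nat \<Rightarrow> nat \<Rightarrow> vertex set set \<Rightarrow> nat \<Rightarrow> vertex set set set" where
  "D_set m n \<sigma> q = {\<alpha> \<in> P_reg m n \<sigma>. brauer_rank \<alpha> = q}"

definition I_set :: "nat \<Rightarrow> nat \<Rightarrow> vertex set set \<Rightarrow> nat \<Rightarrow> vertex set set set" where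
  "I_set m n \<sigma> q = {\<alpha> \<in> P_reg m n \<sigma>. brauer_rank \<alpha> \<le> q}"

text \<open>The double factorial; the empty product gives $(-1)!! = 1$.\<close>

definition dfact :: "int \<Rightarrow> int" where
  "dfact k = \<Prod>{i \<in> {1..k}. even (k - i)}"

end

theory Submission
  imports Defs "HOL-Combinatorics.Transposition"
begin

text \<open>
  Brauer partitions form a category with involution \<open>dag\<close> (turning partitions upside down), in
  which a partition \<open>u\<close> of \<open>brauer m q\<close> without hooks on its lower side satisfies
  \<open>dag u * u = 1\<close>; such a \<open>u\<close> behaves like an isometry. Every partition of rank \<open>q\<close> is a
  product \<open>u v\<close> with \<open>u\<close> and \<open>dag v\<close> isometries, and similarly \<open>\<sigma> = s t\<close> through \<open>r\<close> points.
  The element \<open>u v\<close> is regular in the sandwich semigroup iff \<open>t u\<close> and \<open>dag (v s)\<close> are isometries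
  from \<open>q\<close> to \<open>r\<close>, and a product of \<open>u v\<close> and \<open>u' v'\<close> is governed by \<open>(v s) (t u')\<close>, that is,
  by the Brauer monoid on \<open>r\<close> points.

  For an isometry \<open>x\<close>, the numbers of lifts \<open>u\<close> (with \<open>t u = x\<close>) and \<open>v\<close> (with \<open>v s = dag x\<close>)
  are \<open>(m+q-1)!!/(r+q-1)!!\<close> and \<open>(n+q-1)!!/(r+q-1)!!\<close>: contract the hooks of \<open>t\<close> one at a time.
  As \<open>m \<ge> n\<close>, there is a surjection \<open>g\<close> from the former to the latter, and the elements
  \<open>u (g u)\<close> are idempotents. One chooses one \<open>x\<close> from each of the \<open>(r choose q) * (r-q-1)!!\<close> orbits
  of isometries under permutations of the \<open>q\<close> points. These idempotents generate because any two
  isometries \<open>x\<close>, \<open>y\<close> are joined by a walk \<open>x = z\<^sub>0, \<dots>, z\<^sub>l = y\<close> with \<open>dag z\<^sub>i * z\<^sub>i\<^sub>+\<^sub>1 = 1\<close>: a step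
  swaps a transversal point of \<open>x\<close> with a hook point, and such swaps generate all permutations of
  the \<open>r\<close> points when \<open>q < r\<close>. Conversely, a generating set contains, for every lift \<open>u\<close>, an element
  whose upper part is \<open>u\<close> up to a permutation.
\<close>

section \<open>Perfect matchings and traces of graphs\<close>

text \<open>One \<open>x\<close> per orbit is enough because
  \<open>u v = (u \<rho>) (dag \<rho> v)\<close> for every permutation \<open>\<rho>\<close> of the
  \<open>q\<close> points: the same element is seen over \<open>x\<close> and over
  \<open>x \<rho>\<close>. For a fixed \<open>x\<close>, each lift \<open>u\<close> has to occur as
  a left half of a generator and each \<open>v\<close> as a right half; both families are exhausted
  by as many pairs as the larger one has members. With \<open>n \<le> m\<close> this is the family
  of the \<open>u\<close>, so the lower bound can look at left halves alone. Pairing over the same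
  \<open>x\<close> is also what makes \<open>u v\<close> idempotent, since the middle factor is
  \<open>dag x * x = 1\<close>. Walks only reach elements of rank \<open>q\<close>; lower ranks are
  reached in steps of two, by opening a hook of \<open>u\<close> and one of \<open>v\<close> and
  putting \<open>dag (cap p) * cap p\<close> between the enlarged halves. Two obstacles arise. The
  enlarged halves must belong to regular elements again, so the hook of \<open>u\<close> has to be
  chosen with regard to \<open>t u\<close> (\<open>cut_exists\<close>). And the middle factor must
  be of the form \<open>dag z1 * z2\<close> with isometries into \<open>r\<close> points, which
  takes two points more than \<open>p + 2\<close> (\<open>cap_product\<close>); \<open>q < r\<close>
  provides them.\<close>

definition perfect_matching :: "'a set \<Rightarrow> 'a set set \<Rightarrow> bool" where
  "perfect_matching S M \<longleftrightarrow> partition_on S M \<and> (\<forall>B\<in>M. card B = 2)"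

definition block_graph :: "'a set set \<Rightarrow> 'a rel" where
  "block_graph M = (\<Union>B\<in>M. B \<times> B)"

text \<open>The construction behind \<open>brauer_mult\<close>, over any vertex type and any set
  \<open>W\<close> of visible vertices: associativity is proved on a layered vertex type, and gluing
  on vertex sets that change one pair at a time.\<close>

definition trace :: "'a set \<Rightarrow> 'a rel \<Rightarrow> 'a set set" where
  "trace W R = W // {(x, y). x \<in> W \<and> y \<in> W \<and> (x, y) \<in> R\<^sup>*}"

lemma perfect_matchingI:
  assumes "\<And>B. B \<in> M \<Longrightarrow> \<exists>x y. x \<noteq> y \<and> B = {x, y} \<and> x \<in> S \<and> y \<in> S"
    and "\<And>x. x \<in> S \<Longrightarrow> \<exists>y. {x, y} \<in> M"
    and "\<And>x y z. {x, y} \<in> M \<Longrightarrow> {x, z} \<in> M \<Longrightarrow> y = z"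
  shows "perfect_matching S M"
  unfolding perfect_matching_def
proof (intro conjI ballI partition_onI)
  show "\<Union> M = S"
  proof (intro equalityI subsetI)
    fix x assume "x \<in> \<Union> M"
    then obtain B where "B \<in> M" "x \<in> B" by blast
    then show "x \<in> S" using assms(1)[of B] by auto
  next
    fix x assume "x \<in> S"
    then obtain y where "{x, y} \<in> M" using assms(2) by blast
    then show "x \<in> \<Union> M" by auto
  qed
  fix p q assume p: "p \<in> M" and q: "q \<in> M" and ne: "p \<noteq> q"
  show "disjnt p q"
  proof (rule ccontr)
    assume "\<not> disjnt p q"
    then obtain x where x: "x \<in> p" "x \<in> q" by (auto simp: disjnt_def)
    obtain y where "p = {x, y}" using assms(1)[OF p] x by (metis insertE insert_commute singletonD)
    moreover obtain z where "q = {x, z}" using assms(1)[OF q] x by (metis insertE insert_commute singletonD)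
    ultimately show False using assms(3) p q ne by metis
  qed
next
  show "{} \<notin> M" using assms(1)[of "{}"] by auto
next
  fix B assume "B \<in> M" then show "card B = 2" using assms(1)[of B] by (auto simp: card_2_iff)
qed

lemma pm_block:
  assumes "perfect_matching S M" "B \<in> M" "x \<in> B"
  obtains y where "y \<noteq> x" "B = {x, y}" "x \<in> S" "y \<in> S"
proof -
  have "card B = 2" "B \<subseteq> S" using assms by (auto simp: perfect_matching_def partition_on_def)
  then obtain a b where "B = {a, b}" "a \<noteq> b" "a \<in> S" "b \<in> S" by (auto simp: card_2_iff)
  then show ?thesis using that assms(3) by (metis insertE insert_commute singletonD)
qed

lemma pm_block2:
  assumes "perfect_matching S M" "B \<in> M"
  obtains x y where "x \<noteq> y" "B = {x, y}" "x \<in> S" "y \<in> S"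
  using assms pm_block[OF assms] unfolding perfect_matching_def card_2_iff by (metis insertI1)

lemma pm_edge:
  assumes "perfect_matching S M" "{x, y} \<in> M"
  shows "x \<noteq> y" "x \<in> S" "y \<in> S"
proof -
  from assms show "x \<noteq> y" by (auto simp: perfect_matching_def)
  from assms show "x \<in> S" "y \<in> S" by (auto simp: perfect_matching_def partition_on_def)
qed

lemma pm_partner:
  assumes "perfect_matching S M" "x \<in> S"
  obtains y where "{x, y} \<in> M" "y \<noteq> x" "y \<in> S"
proof -
  obtain B where "B \<in> M" "x \<in> B" using assms by (auto simp: perfect_matching_def partition_on_def)
  then show ?thesis using that pm_block[OF assms(1)] by metis
qed

lemma pm_disj:
  assumes "perfect_matching S M" "B \<in> M" "C \<in> M" "x \<in> B" "x \<in> C"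
  shows "B = C"
  using assms unfolding perfect_matching_def partition_on_def pairwise_def disjnt_def by blast

lemma pm_unique:
  assumes "perfect_matching S M" "{x, y} \<in> M" "{x, z} \<in> M"
  shows "y = z"
  using pm_disj[OF assms(1-3), of x] by (metis doubleton_eq_iff insertI1)

lemma pm_unique':
  assumes "perfect_matching S M" "{x, y} \<in> M" "{z, x} \<in> M"
  shows "y = z"
  using assms pm_unique insert_commute by metis

lemma pm_Union: "perfect_matching S M \<Longrightarrow> \<Union> M = S"
  by (auto simp: perfect_matching_def partition_on_def)

text \<open>Every vertex already has its partner in \<open>M\<close>, so \<open>N\<close> has no
  room for a further edge. Thanks to this, products below are verified by checking one inclusion
  only.\<close>

lemma pm_subset_eq:
  assumes "perfect_matching S M" "perfect_matching S N" "M \<subseteq> N"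
  shows "M = N"
proof
  show "N \<subseteq> M"
  proof
    fix B assume B: "B \<in> N"
    then obtain x y where xy: "B = {x, y}" "x \<in> S" using pm_block2[OF assms(2)] by metis
    obtain z where z: "{x, z} \<in> M" using pm_partner[OF assms(1) xy(2)] by metis
    then have "{x,z} \<in> N" using assms(3) by auto
    then show "B \<in> M" using z xy B pm_unique[OF assms(2)] by metis
  qed
qed (fact assms)

lemma pm_Un:
  assumes "perfect_matching S M" "perfect_matching T N" "S \<inter> T = {}"
  shows "perfect_matching (S \<union> T) (M \<union> N)"
  using assms unfolding perfect_matching_def
  by (auto intro!: partition_onI dest: partition_onD1 partition_onD3)
    (metis Int_iff UnionI disjnt_iff empty_iff pairwiseD partition_onD1 partition_onD2)+

lemma pm_Diff:
  assumes "perfect_matching S M" "N \<subseteq> M"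
  shows "perfect_matching (S - \<Union> N) (M - N)"
proof (rule perfect_matchingI)
  fix B assume B: "B \<in> M - N"
  then obtain x y where xy: "x \<noteq> y" "B = {x, y}" "x \<in> S" "y \<in> S"
    using pm_block2[OF assms(1), of B] by auto
  have "z \<notin> \<Union> N" if "z \<in> B" for z
    using B that pm_disj[OF assms(1), of B _ z] assms(2) by auto
  then show "\<exists>x y. x \<noteq> y \<and> B = {x, y} \<and> x \<in> S - \<Union> N \<and> y \<in> S - \<Union> N"
    using xy by auto
next
  fix x assume x: "x \<in> S - \<Union> N"
  then obtain y where "{x, y} \<in> M" using pm_partner[OF assms(1), of x] by auto
  then show "\<exists>y. {x, y} \<in> M - N" using x by auto
next
  fix x y z assume "{x, y} \<in> M - N" "{x, z} \<in> M - N"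
  then show "y = z" using pm_unique[OF assms(1), of x y z] by simp
qed

lemma pm_image:
  assumes "perfect_matching S M" "inj_on f S"
  shows "perfect_matching (f ` S) ((`) f ` M)"
proof -
  have "{} \<notin> (`) f ` M" using assms(1) by (auto simp: perfect_matching_def partition_on_def)
  then have "partition_on (f ` S) ((`) f ` M)"
    using partition_on_inj_image[of S M f] assms by (simp add: perfect_matching_def)
  moreover have "card (f ` B) = 2" if "B \<in> M" for B
  proof -
    have "B \<subseteq> S" "card B = 2" using assms(1) that by (auto simp: perfect_matching_def partition_on_def)
    then show ?thesis using card_image[of f B] inj_on_subset[OF assms(2)] by simp
  qed
  ultimately show ?thesis by (auto simp: perfect_matching_def)
qed

lemma pm_pair: "a \<noteq> b \<Longrightarrow> perfect_matching {a, b} {{a, b}}"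
  by (simp add: perfect_matching_def partition_on_space)

lemma pm_empty[simp]: "perfect_matching {} M \<longleftrightarrow> M = {}"
  by (auto simp: perfect_matching_def partition_on_empty)

lemma pm_finite: "perfect_matching S M \<Longrightarrow> finite S \<Longrightarrow> finite M"
  by (auto simp: perfect_matching_def finite_elements)

lemma finite_pms: "finite S \<Longrightarrow> finite {M. perfect_matching S M}"
  using finitely_many_partition_on[of S] by (rule rev_finite_subset) (auto simp: perfect_matching_def)

lemma pm_card: "perfect_matching S M \<Longrightarrow> finite S \<Longrightarrow> card S = 2 * card M"
  unfolding perfect_matching_def partition_on_def
  using card_partition[of M 2] by (metis finite_UnionD pairwise_def disjnt_def)

section \<open>Graphs of partitions and their traces\<close>

lemma sym_block_graph: "sym (block_graph M)"
  by (auto simp: block_graph_def sym_def)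

lemma block_graph_insert: "block_graph (insert B M) = B \<times> B \<union> block_graph M"
  and block_graph_Un: "block_graph (M \<union> N) = block_graph M \<union> block_graph N"
  and block_graph_empty [simp]: "block_graph {} = {}"
  by (auto simp: block_graph_def)

lemma block_graphI: "B \<in> M \<Longrightarrow> x \<in> B \<Longrightarrow> y \<in> B \<Longrightarrow> (x, y) \<in> block_graph M"
  by (auto simp: block_graph_def)

lemma block_graph_subset: "block_graph M \<subseteq> \<Union> M \<times> \<Union> M"
  by (auto simp: block_graph_def)

text \<open>Each block has to be connected and to be cut out by a set \<open>C\<close> closed under
  \<open>R\<close>. The set \<open>C\<close> may exceed \<open>W\<close>: it is the block together
  with the invisible vertices of its component.\<close>

lemma trace_eqI:
  assumes W: "\<Union> M = W" and ne: "{} \<notin> M"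
    and conn: "\<And>B x y. B \<in> M \<Longrightarrow> x \<in> B \<Longrightarrow> y \<in> B \<Longrightarrow> (x, y) \<in> R\<^sup>*"
    and closed: "\<And>B. B \<in> M \<Longrightarrow> \<exists>C. R `` C \<subseteq> C \<and> C \<inter> W = B"
  shows "trace W R = M"
proof -
  let ?E = "{(x, y). x \<in> W \<and> y \<in> W \<and> (x, y) \<in> R\<^sup>*}"
  have *: "?E `` {x} = B" if B: "B \<in> M" "x \<in> B" for x B
  proof -
    obtain C where C: "R `` C \<subseteq> C" "C \<inter> W = B" using closed[OF B(1)] by blast
    then have "R\<^sup>* `` C = C" by (intro Image_closed_trancl)
    moreover have "x \<in> C" using B C by auto
    ultimately have "y \<in> C" if "(x, y) \<in> R\<^sup>*" for y using that by blast
    then have "?E `` {x} \<subseteq> B" using C by auto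
    moreover have "B \<subseteq> ?E `` {x}" using conn[OF B] B W by auto
    ultimately show ?thesis by auto
  qed
  show ?thesis
  proof (intro equalityI subsetI)
    fix X assume "X \<in> trace W R"
    then obtain x where x: "x \<in> W" "X = ?E `` {x}" by (auto simp: trace_def elim: quotientE)
    then obtain B where B: "B \<in> M" "x \<in> B" using W by auto
    show "X \<in> M" unfolding x(2) *[OF B] by (fact B)
  next
    fix B assume B: "B \<in> M"
    then obtain x where x: "x \<in> B" using ne by fastforce
    then have "x \<in> W" using B W by auto
    then have "?E `` {x} \<in> trace W R" unfolding trace_def by (rule quotientI)
    then show "B \<in> trace W R" unfolding *[OF B x] .
  qed
qed

lemma block_graph_trace:
  assumes "sym R"
  shows "block_graph (trace W R) = {(x, y). x \<in> W \<and> y \<in> W \<and> (x, y) \<in> R\<^sup>*}" (is "_ = ?E")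
proof -
  have s: "sym (R\<^sup>*)" using assms by (rule sym_rtrancl)
  have "equiv W ?E"
    by (rule equivI) (use s in \<open>auto simp: refl_on_def sym_def trans_def\<close>)
  then have "(\<Union>B\<in>W // ?E. B \<times> B) = ?E" (is "?L = _")
  proof (intro equalityI subsetI)
    fix p assume "p \<in> ?L"
    then obtain B x y where "B \<in> W // ?E" "x \<in> B" "y \<in> B" "p = (x, y)" by blast
    then show "p \<in> ?E" using quotient_eq_iff[OF \<open>equiv W ?E\<close>, of B B x y] by simp
  next
    fix p assume p: "p \<in> ?E"
    then have "fst p \<in> W" by auto
    then have "?E `` {fst p} \<in> W // ?E" by (rule quotientI)
    moreover have "p \<in> ?E `` {fst p} \<times> ?E `` {fst p}" using p by auto
    ultimately show "p \<in> ?L" by blast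
  qed
  then show ?thesis by (simp only: block_graph_def trace_def)
qed

text \<open>Eliminating the vertices outside \<open>W1\<close> from \<open>R1\<close> first does not change the connectivity
  seen from \<open>W\<close>, as these vertices are invisible to \<open>R2\<close> and \<open>W\<close>.\<close>

lemma trace_trace:
  assumes R1: "R1 \<subseteq> V1 \<times> V1" "sym R1" and R2: "R2 \<subseteq> V2 \<times> V2"
    and "V1 \<inter> V2 \<subseteq> W1" "W \<inter> V1 \<subseteq> W1"
  shows "trace W (block_graph (trace W1 R1) \<union> R2) = trace W (R1 \<union> R2)"
proof -
  define T where "T = {(x, y). x \<in> W1 \<and> y \<in> W1 \<and> (x, y) \<in> R1\<^sup>*}"
  have V: "x = y \<or> x \<in> V1 \<and> y \<in> V1" if "(x, y) \<in> R1\<^sup>*" for x y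
    using that by induction (use R1(1) in auto)
  have "(T \<union> R2)\<^sup>* \<subseteq> (R1 \<union> R2)\<^sup>*"
  proof (rule rtrancl_subset_rtrancl)
    have "R1\<^sup>* \<subseteq> (R1 \<union> R2)\<^sup>*" by (rule rtrancl_mono) auto
    then show "T \<union> R2 \<subseteq> (R1 \<union> R2)\<^sup>*" by (auto simp: T_def)
  qed
  moreover have "(x, y) \<in> (T \<union> R2)\<^sup>*" if "(x, y) \<in> (R1 \<union> R2)\<^sup>*" "x \<in> W" "y \<in> W" for x y
  proof -
    have T: "(w, z) \<in> (T \<union> R2)\<^sup>*" if "(w, z) \<in> R1\<^sup>*" "w \<in> W1 \<union> - V1" "z \<in> W1 \<union> - V1" for w z
      using V[OF that(1)] that by (auto simp: T_def)
    \<comment> \<open>The path is split at a point \<open>w\<close> that survives the elimination;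
      the pending part inside \<open>R1\<close> is replaced through \<open>T\<close> as soon as the
      path uses \<open>R2\<close> or ends.\<close>
    have "\<exists>w. (x, w) \<in> (T \<union> R2)\<^sup>* \<and> (w, y) \<in> R1\<^sup>* \<and> w \<in> W1 \<union> - V1" using that(1)
    proof induction
      case base
      then show ?case using assms(5) that(2) by auto
    next
      case (step y z)
      then obtain w where w: "(x, w) \<in> (T \<union> R2)\<^sup>*" "(w, y) \<in> R1\<^sup>*" "w \<in> W1 \<union> - V1" by blast
      show ?case
      proof (cases "(y, z) \<in> R1")
        case True
        with w(2) have "(w, z) \<in> R1\<^sup>*" by (rule rtrancl.rtrancl_into_rtrancl)
        then show ?thesis using w(1,3) by blast
      next
        case False
        then have yz: "(y, z) \<in> R2" using step by auto
        then have *: "y \<in> W1 \<union> - V1" "z \<in> W1 \<union> - V1" using R2 assms(4) by auto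
        have "(x, y) \<in> (T \<union> R2)\<^sup>*" using T[OF w(2,3) *(1)] w(1) by (rule rtrancl_trans[rotated])
        moreover have "(y, z) \<in> T \<union> R2" using yz by simp
        ultimately have "(x, z) \<in> (T \<union> R2)\<^sup>*" by (rule rtrancl.rtrancl_into_rtrancl)
        then show ?thesis using *(2) by (intro exI[of _ z]) auto
      qed
    qed
    then obtain w where w: "(x, w) \<in> (T \<union> R2)\<^sup>*" "(w, y) \<in> R1\<^sup>*" "w \<in> W1 \<union> - V1" by blast
    have "y \<in> W1 \<union> - V1" using that(3) assms(5) by auto
    from T[OF w(2,3) this] w(1) show ?thesis by (rule rtrancl_trans[rotated])
  qed
  ultimately have "{(x, y). x \<in> W \<and> y \<in> W \<and> (x, y) \<in> (T \<union> R2)\<^sup>*} =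
    {(x, y). x \<in> W \<and> y \<in> W \<and> (x, y) \<in> (R1 \<union> R2)\<^sup>*}" by blast
  then show ?thesis
    unfolding block_graph_trace[OF R1(2)] T_def[symmetric] by (simp add: trace_def)
qed

lemma rtrancl_map_prod:
  assumes "inj f"
  shows "(f x, f y) \<in> (map_prod f f ` R)\<^sup>* \<longleftrightarrow> (x, y) \<in> R\<^sup>*"
proof
  assume "(x, y) \<in> R\<^sup>*"
  then show "(f x, f y) \<in> (map_prod f f ` R)\<^sup>*"
    by induction (auto intro: rtrancl.rtrancl_into_rtrancl)
next
  have "\<exists>y. z = f y \<and> (x, y) \<in> R\<^sup>*" if "(f x, z) \<in> (map_prod f f ` R)\<^sup>*" for z
    using that
  proof induction
    case (step y z)
    then show ?case using assms by (auto simp: inj_eq intro: rtrancl.rtrancl_into_rtrancl)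
  qed auto
  then show "(f x, f y) \<in> (map_prod f f ` R)\<^sup>* \<Longrightarrow> (x, y) \<in> R\<^sup>*"
    using assms by (auto dest: injD)
qed

lemma trace_image:
  assumes "inj f"
  shows "trace (f ` W) (map_prod f f ` R) = (`) f ` trace W R"
proof -
  have *: "{(x, y). x \<in> f ` W \<and> y \<in> f ` W \<and> (x, y) \<in> (map_prod f f ` R)\<^sup>*} `` {f x} =
    f ` ({(x, y). x \<in> W \<and> y \<in> W \<and> (x, y) \<in> R\<^sup>*} `` {x})" for x
    using assms by (auto simp: rtrancl_map_prod inj_image_mem_iff)
  show ?thesis
    unfolding trace_def quotient_def by (auto simp only: * UN_simps image_UN image_insert image_empty)
qed

lemma block_graph_image: "block_graph ((`) f ` M) = map_prod f f ` block_graph M"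
  by (auto simp: block_graph_def)

section \<open>Gluing perfect matchings\<close>

text \<open>Gluing along the common vertices, which disappear; composition of Brauer partitions is the
  special case in which these are the middle vertices.\<close>

definition msum :: "'a set set \<Rightarrow> 'a set set \<Rightarrow> 'a set set" where
  "msum M N = trace (sym_diff (\<Union> M) (\<Union> N)) (block_graph M \<union> block_graph N)"

section \<open>Gluing a single pair\<close>

lemma rtrancl_2: "(a, b) \<in> R \<Longrightarrow> (b, c) \<in> R \<Longrightarrow> (a, c) \<in> R\<^sup>*"
  by (blast intro: rtrancl_trans)

lemma rtrancl_3: "(a, b) \<in> R \<Longrightarrow> (b, c) \<in> R \<Longrightarrow> (c, d) \<in> R \<Longrightarrow> (a, d) \<in> R\<^sup>*"
  by (rule rtrancl_into_rtrancl[OF rtrancl_2])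

lemma rtrancl_4:
  "(a, b) \<in> R \<Longrightarrow> (b, c) \<in> R \<Longrightarrow> (c, d) \<in> R \<Longrightarrow> (d, e) \<in> R \<Longrightarrow> (a, e) \<in> R\<^sup>*"
  by (rule rtrancl_into_rtrancl[OF rtrancl_3])

lemma block_graph_Image_block:
  assumes "perfect_matching S M" "B \<in> M"
  shows "block_graph M `` B \<subseteq> B"
proof
  fix y assume "y \<in> block_graph M `` B"
  then obtain x C where "x \<in> B" "C \<in> M" "x \<in> C" "y \<in> C" by (auto simp: block_graph_def)
  then show "y \<in> B" using pm_disj[OF assms, of C x] by simp
qed

lemma block_graph_Image_disjoint: "\<Union> M \<inter> X = {} \<Longrightarrow> block_graph M `` X = {}"
  by (auto simp: block_graph_def)

lemma block_graph_pair_Image: "block_graph {{a, b}} `` X \<subseteq> {a, b}"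
  by (auto simp: block_graph_def)

lemma pm_nonempty: "perfect_matching S M \<Longrightarrow> {} \<notin> M"
  by (auto simp: perfect_matching_def partition_on_def)

lemma msum_disjoint:
  assumes "perfect_matching S M" "perfect_matching T N" "S \<inter> T = {}"
  shows "msum M N = M \<union> N"
proof -
  have pm: "perfect_matching (S \<union> T) (M \<union> N)" using assms by (rule pm_Un)
  have "sym_diff (\<Union> M) (\<Union> N) = S \<union> T" using assms by (auto simp: pm_Union)
  moreover have "trace (S \<union> T) (block_graph (M \<union> N)) = M \<union> N"
  proof (rule trace_eqI)
    show "\<Union> (M \<union> N) = S \<union> T" using pm by (rule pm_Union)
    show "{} \<notin> M \<union> N" using pm_nonempty[OF pm] by auto
    fix B assume B: "B \<in> M \<union> N"
    show "(x, y) \<in> (block_graph (M \<union> N))\<^sup>*" if "x \<in> B" "y \<in> B" for x y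
      using block_graphI[OF B that] by blast
    have "B \<subseteq> S \<union> T" using B pm_Union[OF pm] by blast
    then show "\<exists>C. block_graph (M \<union> N) `` C \<subseteq> C \<and> C \<inter> (S \<union> T) = B"
      using block_graph_Image_block[OF pm B] by (intro exI[of _ B]) auto
  qed
  ultimately show ?thesis by (simp only: msum_def block_graph_Un)
qed

text \<open>A pair glued onto an equal block closes a loop, and loops leave no trace on the visible
  vertices.\<close>

lemma msum_cancel:
  assumes pm: "perfect_matching S M" and B: "B \<in> M"
  shows "msum {B} M = M - {B}"
  unfolding msum_def
proof (rule trace_eqI)
  have pm': "perfect_matching (S - B) (M - {B})" using pm_Diff[OF pm, of "{B}"] B by simp
  have W: "sym_diff (\<Union> {B}) (\<Union> M) = S - B" using pm_Union[OF pm] B by auto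
  then show "\<Union> (M - {B}) = sym_diff (\<Union> {B}) (\<Union> M)" using pm_Union[OF pm'] by simp
  show "{} \<notin> M - {B}" using pm_nonempty[OF pm] by auto
  fix C assume C: "C \<in> M - {B}"
  show "(x, y) \<in> (block_graph {B} \<union> block_graph M)\<^sup>*" if "x \<in> C" "y \<in> C" for x y
    using that C by (auto intro!: r_into_rtrancl simp: block_graph_def)
  have "B \<inter> C = {}" using pm_disj[OF pm B, of C] C by auto
  then have "block_graph {B} `` C = {}" by (intro block_graph_Image_disjoint) auto
  moreover have "block_graph M `` C \<subseteq> C" using C by (intro block_graph_Image_block[OF pm]) auto
  ultimately have "(block_graph {B} \<union> block_graph M) `` C \<subseteq> C" by (simp add: Un_Image)
  moreover have "C \<inter> (S - B) = C" using C pm_Union[OF pm'] by auto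
  ultimately show "\<exists>C'. (block_graph {B} \<union> block_graph M) `` C' \<subseteq> C' \<and> C' \<inter> (sym_diff (\<Union> {B}) (\<Union> M)) = C"
    unfolding W by blast
qed

text \<open>The pair prolongs the edge at \<open>a\<close> to the new end \<open>b\<close>, so that
  \<open>a\<close> is in effect renamed to \<open>b\<close>.\<close>

lemma msum_swap:
  assumes pm: "perfect_matching S M" and ac: "{a, c} \<in> M" and b: "b \<notin> S"
  shows "msum {{a, b}} M = insert {b, c} (M - {{a, c}})"
    and "perfect_matching (insert b (S - {a})) (insert {b, c} (M - {{a, c}}))"
proof -
  let ?M = "insert {b, c} (M - {{a, c}})"
  have ne: "a \<noteq> c" "a \<in> S" "c \<in> S" using pm_edge[OF pm ac] by auto
  then have bc: "b \<noteq> c" "b \<noteq> a" using b by auto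
  have "perfect_matching (S - {a, c}) (M - {{a, c}})" using pm_Diff[OF pm, of "{{a,c}}"] ac by simp
  from pm_Un[OF this pm_pair[OF bc(1)]]
  have pm': "perfect_matching ((S - {a, c}) \<union> {b, c}) ?M" using b by auto
  have S: "(S - {a, c}) \<union> {b, c} = insert b (S - {a})" using ne by auto
  show "perfect_matching (insert b (S - {a})) ?M" using pm' S by simp
  have W: "sym_diff (\<Union> {{a, b}}) (\<Union> M) = insert b (S - {a})"
    using pm_Union[OF pm] b ne bc by auto
  let ?R = "block_graph {{a, b}} \<union> block_graph M"
  show "msum {{a, b}} M = ?M" unfolding msum_def W
  proof (rule trace_eqI)
    show "\<Union> ?M = insert b (S - {a})" using pm_Union[OF pm'] S by simp
    show "{} \<notin> ?M" using pm_nonempty[OF pm] by auto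
    fix B assume B: "B \<in> ?M"
    have e: "(b, a) \<in> ?R" "(a, b) \<in> ?R" "(a, c) \<in> ?R" "(c, a) \<in> ?R"
      using block_graphI[OF ac] block_graphI[of "{a, b}" "{{a, b}}"] by simp_all
    then have bc': "(b, c) \<in> ?R\<^sup>*" "(c, b) \<in> ?R\<^sup>*" using rtrancl_2[of _ a ?R] by auto
    show "(x, y) \<in> ?R\<^sup>*" if "x \<in> B" "y \<in> B" for x y
    proof (cases "B = {b, c}")
      case True
      then show ?thesis using that bc' by auto
    next
      case False
      then have "B \<in> M" using B by simp
      then have "(x, y) \<in> ?R" using block_graphI[OF _ that] by simp
      then show ?thesis by (rule r_into_rtrancl)
    qed
    show "\<exists>C. ?R `` C \<subseteq> C \<and> C \<inter> insert b (S - {a}) = B"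
    proof (cases "B = {b, c}")
      case True
      have "block_graph M `` {b} = {}" using pm_Union[OF pm] b by (intro block_graph_Image_disjoint) auto
      moreover have "{a, b, c} = {b} \<union> {a, c}" by auto
      ultimately have "block_graph M `` {a, b, c} = block_graph M `` {a, c}" by (simp only: Image_Un) simp
      then have "?R `` {a, b, c} \<subseteq> {a, b, c}"
        using block_graph_Image_block[OF pm ac] block_graph_pair_Image[of a b "{a, b, c}"]
        unfolding Un_Image by auto
      moreover have "{a, b, c} \<inter> insert b (S - {a}) = {b, c}" using ne bc by auto
      ultimately show ?thesis using True by metis
    next
      case False
      then have BM: "B \<in> M" "B \<noteq> {a, c}" using B by auto
      have "a \<notin> B" using pm_disj[OF pm BM(1) ac, of a] BM by auto
      moreover have "b \<notin> B" using pm_Union[OF pm] BM b by auto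
      ultimately have "block_graph {{a, b}} `` B = {}" by (intro block_graph_Image_disjoint) auto
      then have "?R `` B \<subseteq> B"
        using block_graph_Image_block[OF pm BM(1)] unfolding Un_Image by simp
      moreover have "B \<inter> insert b (S - {a}) = B" using BM \<open>a \<notin> B\<close> pm_Union[OF pm] by auto
      ultimately show ?thesis by metis
    qed
  qed
qed

text \<open>The pair closes the gap in the path \<open>c\<close>, \<open>a\<close>,
  \<open>b\<close>, \<open>d\<close>. The condition \<open>c \<noteq> b\<close> separates this case
  from \<open>msum_cancel\<close>.\<close>

lemma msum_join:
  assumes pm: "perfect_matching S M" and ac: "{a, c} \<in> M" and bd: "{b, d} \<in> M" and ab: "a \<noteq> b" "c \<noteq> b"
  shows "msum {{a, b}} M = insert {c, d} (M - {{a, c}, {b, d}})"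
    and "perfect_matching (S - {a, b}) (insert {c, d} (M - {{a, c}, {b, d}}))"
proof -
  let ?M = "insert {c, d} (M - {{a, c}, {b, d}})"
  have ne: "a \<noteq> c" "a \<in> S" "c \<in> S" "b \<noteq> d" "b \<in> S" "d \<in> S"
    using pm_edge[OF pm ac] pm_edge[OF pm bd] by auto
  have dj: "{a, c} \<noteq> {b, d}" using ab by (auto simp: doubleton_eq_iff)
  then have dd: "{a, c} \<inter> {b, d} = {}" using pm_disj[OF pm ac bd] by blast
  then have cd: "c \<noteq> d" by auto
  have "perfect_matching (S - {a, b, c, d}) (M - {{a, c}, {b, d}})"
    using pm_Diff[OF pm, of "{{a,c}, {b, d}}"] ac bd by (simp add: insert_commute)
  from pm_Un[OF this pm_pair[OF cd]]
  have pm': "perfect_matching ((S - {a, b, c, d}) \<union> {c, d}) ?M" by auto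
  have S: "(S - {a, b, c, d}) \<union> {c, d} = S - {a, b}" using ne dd by auto
  show "perfect_matching (S - {a, b}) ?M" using pm' S by simp
  have W: "sym_diff (\<Union> {{a, b}}) (\<Union> M) = S - {a, b}"
    using pm_Union[OF pm] ne by auto
  let ?R = "block_graph {{a, b}} \<union> block_graph M"
  show "msum {{a, b}} M = ?M" unfolding msum_def W
  proof (rule trace_eqI)
    show "\<Union> ?M = S - {a, b}" using pm_Union[OF pm'] S by simp
    show "{} \<notin> ?M" using pm_nonempty[OF pm] by auto
    fix B assume B: "B \<in> ?M"
    have e: "(c, a) \<in> ?R" "(a, b) \<in> ?R" "(b, d) \<in> ?R" "(d, b) \<in> ?R" "(b, a) \<in> ?R" "(a, c) \<in> ?R"
      using block_graphI[OF ac] block_graphI[OF bd] block_graphI[of "{a, b}" "{{a, b}}"] by simp_all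
    then have bc': "(c, d) \<in> ?R\<^sup>*" "(d, c) \<in> ?R\<^sup>*"
      using rtrancl_3[of c a ?R b d] rtrancl_3[of d b ?R a c] by auto
    show "(x, y) \<in> ?R\<^sup>*" if "x \<in> B" "y \<in> B" for x y
    proof (cases "B = {c, d}")
      case True
      then show ?thesis using that bc' by auto
    next
      case False
      then have "B \<in> M" using B by simp
      then have "(x, y) \<in> ?R" using block_graphI[OF _ that] by simp
      then show ?thesis by (rule r_into_rtrancl)
    qed
    show "\<exists>C. ?R `` C \<subseteq> C \<and> C \<inter> (S - {a, b}) = B"
    proof (cases "B = {c, d}")
      case True
      have "{a, b, c, d} = {a, c} \<union> {b, d}" by auto
      then have "block_graph M `` {a, b, c, d} = block_graph M `` {a, c} \<union> block_graph M `` {b, d}"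
        by (simp only: Image_Un)
      then have "?R `` {a, b, c, d} \<subseteq> {a, b, c, d}"
        using block_graph_Image_block[OF pm ac] block_graph_Image_block[OF pm bd]
          block_graph_pair_Image[of a b "{a, b, c, d}"]
        unfolding Un_Image by auto
      moreover have "{a, b, c, d} \<inter> (S - {a, b}) = {c, d}" using ne dd by auto
      ultimately show ?thesis using True by metis
    next
      case False
      then have BM: "B \<in> M" "B \<noteq> {a, c}" "B \<noteq> {b, d}" using B by auto
      have "a \<notin> B" using pm_disj[OF pm BM(1) ac, of a] BM by auto
      moreover have "b \<notin> B" using pm_disj[OF pm BM(1) bd, of b] BM by auto
      ultimately have "block_graph {{a, b}} `` B = {}" by (intro block_graph_Image_disjoint) auto
      then have "?R `` B \<subseteq> B"
        using block_graph_Image_block[OF pm BM(1)] unfolding Un_Image by simp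
      moreover have "B \<inter> (S - {a, b}) = B" using BM \<open>a \<notin> B\<close> \<open>b \<notin> B\<close> pm_Union[OF pm] by auto
      ultimately show ?thesis by metis
    qed
  qed
qed

lemma perfect_matching_msum_pair:
  assumes pm: "perfect_matching S M" and ab: "a \<noteq> b"
  shows "perfect_matching (sym_diff {a, b} S) (msum {{a, b}} M)"
proof -
  have sw: "perfect_matching (insert b (S - {a})) (msum {{a, b}} M)" if a: "a \<in> S" and b: "b \<notin> S" for a b
  proof -
    obtain c where "{a, c} \<in> M" using pm_partner[OF pm a] by metis
    from msum_swap[OF pm this b] show ?thesis by simp
  qed
  consider "a \<notin> S" "b \<notin> S" | "a \<in> S" "b \<notin> S" | "a \<notin> S" "b \<in> S" | "a \<in> S" "b \<in> S" by blast
  then show ?thesis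
  proof cases
    case 1
    then have "sym_diff {a, b} S = {a, b} \<union> S" "{a, b} \<inter> S = {}" by auto
    then show ?thesis using pm_Un[OF pm_pair[OF ab] pm] msum_disjoint[OF pm_pair[OF ab] pm] by auto
  next
    case 2
    then have "sym_diff {a, b} S = insert b (S - {a})" by auto
    then show ?thesis using sw[OF 2] by simp
  next
    case 3
    then have "sym_diff {a, b} S = insert a (S - {b})" by auto
    then show ?thesis using sw[OF 3(2,1)] by (simp add: insert_commute)
  next
    case 4
    then have S: "sym_diff {a, b} S = S - {a, b}" by auto
    obtain c where c: "{a, c} \<in> M" using pm_partner[OF pm 4(1)] by metis
    obtain d where d: "{b, d} \<in> M" using pm_partner[OF pm 4(2)] by metis
    show ?thesis
    proof (cases "c = b")
      case True
      then show ?thesis using c S msum_cancel[OF pm, of "{a, b}"] pm_Diff[OF pm, of "{{a, b}}"] by simp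
    next
      case False
      then show ?thesis using msum_join[OF pm c d ab] S by simp
    qed
  qed
qed

text \<open>The base of all inductions over the left argument: its pairs can be glued on one after
  another. As \<open>N\<close> does not touch \<open>a\<close> and \<open>b\<close>, the points
  eliminated by the first gluing are invisible to it and \<open>trace_trace\<close> applies.\<close>

lemma msum_assoc_insert:
  assumes pm: "perfect_matching S M" and ab: "a \<noteq> b" and N: "perfect_matching T N" and "a \<notin> T" "b \<notin> T"
  shows "msum N (msum {{a, b}} M) = msum (insert {a, b} N) M"
proof -
  have U: "\<Union> (msum {{a, b}} M) = sym_diff {a, b} S"
    using perfect_matching_msum_pair[OF pm ab] by (rule pm_Union)
  let ?W = "sym_diff {a, b} S"
  have W: "sym_diff (\<Union> N) (\<Union> (msum {{a, b}} M)) = sym_diff (\<Union> (insert {a, b} N)) (\<Union> M)"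
    using pm_Union[OF N] pm_Union[OF pm] assms(4,5) unfolding U by auto
  have m: "msum {{a, b}} M = trace ?W (block_graph {{a, b}} \<union> block_graph M)"
    using pm_Union[OF pm] unfolding msum_def by simp
  have "trace (sym_diff (\<Union> (insert {a, b} N)) (\<Union> M))
    (block_graph (trace ?W (block_graph {{a, b}} \<union> block_graph M)) \<union> block_graph N) =
    trace (sym_diff (\<Union> (insert {a, b} N)) (\<Union> M)) (block_graph {{a, b}} \<union> block_graph M \<union> block_graph N)"
  proof (rule trace_trace)
    show "block_graph {{a, b}} \<union> block_graph M \<subseteq> ({a, b} \<union> S) \<times> ({a, b} \<union> S)"
      using pm_Union[OF pm] by (auto simp: block_graph_def)
    show "sym (block_graph {{a, b}} \<union> block_graph M)" by (intro sym_Un sym_block_graph)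
    show "block_graph N \<subseteq> T \<times> T" using block_graph_subset[of N] pm_Union[OF N] by simp
    show "({a, b} \<union> S) \<inter> T \<subseteq> ?W" using assms(4,5) by auto
    show "sym_diff (\<Union> (insert {a, b} N)) (\<Union> M) \<inter> ({a, b} \<union> S) \<subseteq> ?W"
      using pm_Union[OF pm] by auto
  qed
  moreover have "block_graph {{a, b}} \<union> block_graph M \<union> block_graph N =
      block_graph (insert {a, b} N) \<union> block_graph M"
    unfolding block_graph_insert[of "{a, b}" N] block_graph_insert[of "{a, b}" "{}"] block_graph_empty by blast
  ultimately show ?thesis
    unfolding msum_def[of N] msum_def[of "insert {a, b} N"] W unfolding m
    by (simp only: Un_commute[of "block_graph N"])
qed

lemma perfect_matching_msum:
  assumes "perfect_matching S M" "perfect_matching T N" "finite T"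
  shows "perfect_matching (sym_diff T S) (msum N M)"
proof -
  have "finite N" using assms(2,3) by (rule pm_finite)
  then show ?thesis using assms(1,2)
  proof (induction N arbitrary: S M T rule: finite_induct)
    case empty
    then have "T = {}" using pm_Union by fastforce
    then show ?case using empty msum_disjoint[of "{}" "{}" S M] by auto
  next
    case (insert B N)
    then obtain a b where ab: "a \<noteq> b" "B = {a, b}" "a \<in> T" "b \<in> T" by (metis insertI1 pm_block2)
    have N: "perfect_matching (T - B) N"
      using pm_Diff[OF insert.prems(2), of "{B}"] insert.hyps by simp
    have "perfect_matching (sym_diff (T - B) (sym_diff B S)) (msum N (msum {B} M))"
      using insert.IH[OF perfect_matching_msum_pair[OF insert.prems(1) ab(1)] N] ab by simp
    moreover have "sym_diff (T - B) (sym_diff B S) = sym_diff T S" using ab by auto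
    moreover have "msum N (msum {B} M) = msum (insert B N) M"
      unfolding ab(2) by (rule msum_assoc_insert[OF insert.prems(1) ab(1) N]) (use ab in auto)
    ultimately show ?case by simp
  qed
qed


section \<open>Fibres of gluing\<close>

lemma msum_swap_inverse:
  assumes pm: "perfect_matching S u" and ab: "a \<in> S" "b \<notin> S"
  shows "msum {{b, a}} (msum {{a, b}} u) = u"
proof -
  obtain c where c: "{a, c} \<in> u" "c \<noteq> a" "c \<in> S" using pm_partner[OF pm ab(1)] by metis
  note sw = msum_swap[OF pm c(1) ab(2)]
  have bc: "{b, c} \<notin> u" using pm_edge[OF pm] ab by metis
  have "a \<notin> insert b (S - {a})" using ab by auto
  then have "msum {{b, a}} (insert {b, c} (u - {{a, c}})) =
      insert {a, c} (insert {b, c} (u - {{a, c}}) - {{b, c}})"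
    by (intro msum_swap(1)[OF sw(2)]) auto
  then show ?thesis
    unfolding sw(1) using bc c(1) by auto
qed

lemma card_msum_swap_fiber:
  assumes ab: "a \<in> S" "b \<notin> S" and u': "perfect_matching (insert b (S - {a})) u'"
  shows "card {u. perfect_matching S u \<and> msum {{a, b}} u = u'} = 1"
proof -
  have ba: "b \<in> insert b (S - {a})" "a \<notin> insert b (S - {a})" using ab by auto
  obtain c where c: "{b, c} \<in> u'" using pm_partner[OF u' ba(1)] by metis
  have "insert a (insert b (S - {a}) - {b}) = S" using ab by auto
  then have "perfect_matching S (msum {{b, a}} u')"
    using msum_swap[OF u' c ba(2)] by simp
  moreover have "msum {{a, b}} (msum {{b, a}} u') = u'"
    by (rule msum_swap_inverse[OF u' ba])
  ultimately have "{u. perfect_matching S u \<and> msum {{a, b}} u = u'} = {msum {{b, a}} u'}"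
    using msum_swap_inverse[OF _ ab] by auto
  then show ?thesis by simp
qed

text \<open>An element of the fibre is determined by the partner of \<open>a\<close>, which can be any point of
  \<open>S\<close> other than \<open>a\<close>.\<close>

lemma card_msum_join_fiber:
  assumes fin: "finite S" and ab: "a \<in> S" "b \<in> S" "a \<noteq> b" and u': "perfect_matching (S - {a, b}) u'"
  shows "card {u. perfect_matching S u \<and> msum {{a, b}} u = u'} = card S - 1"
proof -
  let ?F = "{u. perfect_matching S u \<and> msum {{a, b}} u = u'}"
  have nu': "{z, y} \<notin> u'" "{y, z} \<notin> u'" if "z = a \<or> z = b" for y z
    using pm_edge(2,3)[OF u', of z y] pm_edge(2,3)[OF u', of y z] that by auto
  have ex: "\<exists>u. u \<in> ?F \<and> {a, x} \<in> u" if x: "x \<in> S - {a}" for x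
  proof (cases "x = b")
    case True
    let ?u = "insert {a, b} u'"
    have "{a, b} \<union> (S - {a, b}) = S" using ab by auto
    then have pm: "perfect_matching S ?u" using pm_Un[OF pm_pair[OF ab(3)] u'] by simp
    have "msum {{a, b}} ?u = u'" using msum_cancel[OF pm, of "{a, b}"] nu' by auto
    then show ?thesis using pm True by blast
  next
    case False
    then have x': "x \<in> S - {a, b}" using x by auto
    obtain d where d: "{x, d} \<in> u'" "d \<noteq> x" "d \<in> S - {a, b}" using pm_partner[OF u' x'] by metis
    let ?v = "u' - {{x, d}}"
    \<comment> \<open>This reverses \<open>msum_join\<close>: the edge at \<open>x\<close>,
      \<open>d\<close> is cut and its ends are led to \<open>a\<close> and \<open>b\<close>.\<close>
    let ?u = "insert {a, x} (insert {b, d} ?v)"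
    have v: "perfect_matching (S - {a, b} - {x, d}) ?v" using pm_Diff[OF u', of "{{x, d}}"] d by simp
    have bd: "perfect_matching ({b, d} \<union> (S - {a, b} - {x, d})) ({{b, d}} \<union> ?v)"
      using d by (intro pm_Un pm_pair v) auto
    have "perfect_matching ({a, x} \<union> ({b, d} \<union> (S - {a, b} - {x, d}))) ({{a, x}} \<union> ({{b, d}} \<union> ?v))"
      by (rule pm_Un[OF pm_pair bd]) (use d x' ab in auto)
    moreover have "{a, x} \<union> ({b, d} \<union> (S - {a, b} - {x, d})) = S" using d x' ab by auto
    ultimately have pm: "perfect_matching S ?u" by (simp only: insert_is_Un[symmetric])
    have "msum {{a, b}} ?u = insert {x, d} (?u - {{a, x}, {b, d}})"
      by (rule msum_join(1)[OF pm _ _ ab(3) False]) auto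
    also have "\<dots> = u'" using nu' d by auto
    finally show ?thesis using pm by blast
  qed
  have form: "\<exists>d. {x, d} \<in> u' \<and> u = insert {a, x} (insert {b, d} (u' - {{x, d}}))"
    if u: "u \<in> ?F" and ax: "{a, x} \<in> u" and xb: "x \<noteq> b" for u x
  proof -
    have pm: "perfect_matching S u" using u by simp
    obtain d where d: "{b, d} \<in> u" using pm_partner[OF pm ab(2)] by metis
    have e: "u' = insert {x, d} (u - {{a, x}, {b, d}})"
      using msum_join(1)[OF pm ax d ab(3) xb] u by simp
    have "{x, d} \<notin> u"
    proof
      assume xd: "{x, d} \<in> u"
      then have "d = a" using pm_unique'[OF pm xd ax] by simp
      then have "x = b" using d ax pm_unique'[OF pm ax] by blast
      then show False using xb by simp
    qed
    then have "u = insert {a, x} (insert {b, d} (u' - {{x, d}}))"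
      unfolding e using ax d by auto
    moreover have "{x, d} \<in> u'" unfolding e by simp
    ultimately show ?thesis by blast
  qed
  have uniq: "u = v" if u: "u \<in> ?F" "{a, x} \<in> u" and v: "v \<in> ?F" "{a, x} \<in> v" for u v x
  proof (cases "x = b")
    case True
    have "u' = w - {{a, b}}" if "w \<in> ?F" "{a, x} \<in> w" for w
      using msum_cancel[of S w "{a, b}"] that True by simp
    then show ?thesis using u v True by blast
  next
    case False
    obtain d where d: "{x, d} \<in> u'" "u = insert {a, x} (insert {b, d} (u' - {{x, d}}))"
      using form[OF u False] by blast
    obtain e where e: "{x, e} \<in> u'" "v = insert {a, x} (insert {b, e} (u' - {{x, e}}))"
      using form[OF v False] by blast
    show ?thesis using pm_unique[OF u' d(1) e(1)] d(2) e(2) by simp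
  qed
  define f where "f u = (THE x. {a, x} \<in> u)" for u
  have f: "f u = x" if "u \<in> ?F" "{a, x} \<in> u" for u x
    unfolding f_def using that by (intro the_equality) (auto dest: pm_unique)
  have f': "{a, f u} \<in> u \<and> f u \<in> S - {a}" if u: "u \<in> ?F" for u
  proof -
    have "perfect_matching S u" using u by simp
    then obtain x where "{a, x} \<in> u" "x \<noteq> a" "x \<in> S" using ab(1) by (rule pm_partner)
    then show ?thesis using f[OF u] by simp
  qed
  have "bij_betw f ?F (S - {a})"
    unfolding bij_betw_def
  proof
    show "inj_on f ?F"
    proof (rule inj_onI)
      fix u v assume *: "u \<in> ?F" "v \<in> ?F" "f u = f v"
      then show "u = v" using uniq[OF *(1) _ *(2), of "f u"] f' by metis
    qed
    show "f ` ?F = S - {a}"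
    proof (intro equalityI subsetI)
      fix x assume "x \<in> f ` ?F" then show "x \<in> S - {a}" using f' by blast
    next
      fix x assume "x \<in> S - {a}"
      then obtain u where u: "u \<in> ?F" "{a, x} \<in> u" using ex by blast
      then show "x \<in> f ` ?F" using f[OF u] by blast
    qed
  qed
  then show ?thesis using bij_betw_same_card fin ab(1) by fastforce
qed

text \<open>A pair with one point in \<open>S\<close> acts as a renaming and is invertible; a pair
  inside \<open>S\<close> contributes the factor \<open>card S - 1\<close> and removes two points. A
  pair disjoint from \<open>S\<close> would be a block of every result, so that the fibre over a
  \<open>w\<close> without it would be empty; hence the condition on
  \<open>B \<inter> S\<close>.\<close>

lemma card_msum_fiber:
  assumes "finite N" "perfect_matching T N" "finite S" "\<And>B. B \<in> N \<Longrightarrow> B \<inter> S \<noteq> {}"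
    "perfect_matching (sym_diff T S) w"
  shows "card {u. perfect_matching S u \<and> msum N u = w} = (\<Prod>j<card {B \<in> N. B \<subseteq> S}. card S - 2 * j - 1)"
  using assms
proof (induction N arbitrary: S T rule: finite_induct)
  case empty
  then have "T = {}" using pm_Union by fastforce
  then have "perfect_matching S w" using empty by simp
  moreover have "msum {} u = u" if "perfect_matching S u" for u
    using msum_disjoint[of "{}" "{}" S u] that by simp
  ultimately have "{u. perfect_matching S u \<and> msum {} u = w} = {w}" by auto
  then show ?case by simp
next
  case (insert B N)
  then obtain a b where ab: "a \<noteq> b" "B = {a, b}" "a \<in> T" "b \<in> T" by (metis insertI1 pm_block2)
  have N: "perfect_matching (T - B) N"
    using pm_Diff[OF insert.prems(1), of "{B}"] insert.hyps by simp
  then have disj: "C \<inter> B = {}" if "C \<in> N" for C using pm_Union that by fastforce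
  let ?S = "sym_diff B S"
  have fin: "finite ?S" using insert.prems(2) ab by simp
  have ne: "C \<inter> ?S \<noteq> {}" if "C \<in> N" for C
    using disj[OF that] insert.prems(3)[of C] that by auto
  have "sym_diff (T - B) ?S = sym_diff T S" using ab by auto
  then have w: "perfect_matching (sym_diff (T - B) ?S) w" using insert.prems(4) by simp
  define c where "c = (if B \<subseteq> S then card S - 1 else 1)"
  have c: "card {u. perfect_matching S u \<and> msum {B} u = u'} = c" if u': "perfect_matching ?S u'" for u'
  proof -
    have "a \<in> S \<or> b \<in> S" using insert.prems(3)[of B] ab by auto
    then consider "a \<in> S" "b \<notin> S" | "a \<notin> S" "b \<in> S" | "a \<in> S" "b \<in> S" by blast
    then show ?thesis
    proof cases
      case 1
      then have "?S = insert b (S - {a})" using ab by auto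
      then show ?thesis using card_msum_swap_fiber[OF 1, of u'] u' 1 ab by (simp add: c_def)
    next
      case 2
      then have "?S = insert a (S - {b})" using ab by auto
      then show ?thesis using card_msum_swap_fiber[OF 2(2,1), of u'] u' 2 ab
        by (simp add: c_def insert_commute)
    next
      case 3
      then have "?S = S - {a, b}" using ab by auto
      then show ?thesis using card_msum_join_fiber[OF insert.prems(2) 3 ab(1), of u'] u' 3 ab
        by (simp add: c_def)
    qed
  qed
  let ?F = "{u'. perfect_matching ?S u' \<and> msum N u' = w}"
  have assoc: "msum N (msum {B} u) = msum (insert B N) u" if "perfect_matching S u" for u
    unfolding ab(2) by (rule msum_assoc_insert[OF that ab(1) N]) (use ab in auto)
  have pmB: "perfect_matching ?S (msum {B} u)" if "perfect_matching S u" for u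
    using perfect_matching_msum_pair[OF that ab(1)] ab(2) by simp
  have "{u. perfect_matching S u \<and> msum (insert B N) u = w} =
      (\<Union>u'\<in>?F. {u. perfect_matching S u \<and> msum {B} u = u'})"
    using assoc pmB by auto
  also have "card \<dots> = (\<Sum>u'\<in>?F. card {u. perfect_matching S u \<and> msum {B} u = u'})"
  proof (rule card_UN_disjoint)
    show "finite ?F" using finite_pms[OF fin] by (rule rev_finite_subset) auto
    show "\<forall>u'\<in>?F. finite {u. perfect_matching S u \<and> msum {B} u = u'}"
      using finite_pms[OF insert.prems(2)] by (auto intro: rev_finite_subset)
  qed auto
  also have "\<dots> = card ?F * c" using c by simp
  also have "\<dots> = (\<Prod>j<card {C \<in> N. C \<subseteq> ?S}. card ?S - 2 * j - 1) * c"
    using insert.IH[OF N fin ne w] by simp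
  also have "{C \<in> N. C \<subseteq> ?S} = {C \<in> N. C \<subseteq> S}" using disj by auto
  also have "(\<Prod>j<card {C \<in> N. C \<subseteq> S}. card ?S - 2 * j - 1) * c =
    (\<Prod>j<card {C \<in> insert B N. C \<subseteq> S}. card S - 2 * j - 1)"
  proof (cases "B \<subseteq> S")
    case True
    then have "?S = S - {a, b}" using ab by auto
    then have cS: "card ?S = card S - 2" using True ab by (simp add: card_Diff_subset)
    have "{C \<in> insert B N. C \<subseteq> S} = insert B {C \<in> N. C \<subseteq> S}" using True by auto
    then have "card {C \<in> insert B N. C \<subseteq> S} = Suc (card {C \<in> N. C \<subseteq> S})"
      using insert.hyps by simp
    \<comment> \<open>The pair glued first accounts for the factor with \<open>j = 0\<close>; the
      induction hypothesis starts with two points fewer and supplies the factors shifted by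
      one.\<close>
    then show ?thesis using True by (simp add: cS c_def prod.lessThan_Suc_shift del: prod.lessThan_Suc)
  next
    case False
    then obtain x y where "B = {x, y}" "x \<in> S" "y \<notin> S" using insert.prems(3)[of B] ab by auto
    then have "?S = insert y (S - {x})" by auto
    then have "card ?S = card S"
      using insert.prems(2) \<open>x \<in> S\<close> \<open>y \<notin> S\<close> card_Suc_Diff1[of S x] by simp
    moreover have "{C \<in> insert B N. C \<subseteq> S} = {C \<in> N. C \<subseteq> S}" using False by auto
    ultimately show ?thesis using False by (simp add: c_def)
  qed
  finally show ?case .
qed

section \<open>The Brauer category\<close>

lemma brauer_iff: "\<alpha> \<in> brauer m n \<longleftrightarrow> perfect_matching (verts m n) \<alpha>"
  by (simp add: brauer_def perfect_matching_def)

lemma finite_verts [simp]: "finite (verts m n)"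
  by (simp add: verts_def)

lemma verts_simps [simp]:
  "Plain i \<in> verts m n \<longleftrightarrow> i \<in> {1..m}" "Prime i \<in> verts m n \<longleftrightarrow> i \<in> {1..n}" "DPrime i \<notin> verts m n"
  by (auto simp: verts_def)

lemma card_verts: "card (verts m n) = m + n"
  unfolding verts_def
  by (subst card_Un_disjoint) (auto simp: card_image inj_on_def)

lemma finite_brauer: "finite (brauer m n)"
proof -
  have "brauer m n = {M. perfect_matching (verts m n) M}" by (auto simp: brauer_iff)
  then show ?thesis using finite_pms[of "verts m n"] by simp
qed

lemma product_graph_eq:
  "product_graph \<alpha> \<beta> = block_graph ((`) down_vertex ` \<alpha>) \<union> block_graph ((`) up_vertex ` \<beta>)"
  by (simp add: product_graph_def part_graph_def block_graph_def)

lemma sym_product_graph: "sym (product_graph \<alpha> \<beta>)"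
  unfolding product_graph_eq by (intro sym_Un sym_block_graph)

lemma brauer_mult_eq: "brauer_mult m k \<alpha> \<beta> = trace (verts m k) (product_graph \<alpha> \<beta>)"
  by (simp add: brauer_mult_def trace_def)

lemma down_image: "down_vertex ` verts m n = Plain ` {1..m} \<union> DPrime ` {1..n}"
  and up_image: "up_vertex ` verts m n = DPrime ` {1..m} \<union> Prime ` {1..n}"
  by (auto simp: verts_def image_Un image_image)

lemma pm_down: "\<alpha> \<in> brauer m n \<Longrightarrow> perfect_matching (Plain ` {1..m} \<union> DPrime ` {1..n}) ((`) down_vertex ` \<alpha>)"
  unfolding down_image[symmetric] brauer_iff
  by (erule pm_image) (auto simp: inj_on_def verts_def)

lemma inj_on_up: "inj_on up_vertex (verts m n)"
  by (auto simp: inj_on_def verts_def)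

lemma pm_up: "\<alpha> \<in> brauer m n \<Longrightarrow> perfect_matching (DPrime ` {1..m} \<union> Prime ` {1..n}) ((`) up_vertex ` \<alpha>)"
  unfolding up_image[symmetric] brauer_iff by (erule pm_image) (rule inj_on_up)

lemma sym_diff_verts:
  "sym_diff (Plain ` {1..m} \<union> DPrime ` {1..n}) (DPrime ` {1..n} \<union> Prime ` {1..k}) = verts m k"
  by (auto simp: verts_def)

lemma brauer_mult_msum:
  assumes "\<alpha> \<in> brauer m n" "\<beta> \<in> brauer n k"
  shows "brauer_mult m k \<alpha> \<beta> = msum ((`) down_vertex ` \<alpha>) ((`) up_vertex ` \<beta>)"
  unfolding brauer_mult_eq msum_def pm_Union[OF pm_down[OF assms(1)]] pm_Union[OF pm_up[OF assms(2)]]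
    product_graph_eq sym_diff_verts ..

lemma brauer_mult_closed:
  assumes "\<alpha> \<in> brauer m n" "\<beta> \<in> brauer n k"
  shows "brauer_mult m k \<alpha> \<beta> \<in> brauer m k"
proof -
  have "perfect_matching (sym_diff (Plain ` {1..m} \<union> DPrime ` {1..n}) (DPrime ` {1..n} \<union> Prime ` {1..k}))
    (msum ((`) down_vertex ` \<alpha>) ((`) up_vertex ` \<beta>))"
    by (rule perfect_matching_msum[OF pm_up[OF assms(2)] pm_down[OF assms(1)]]) simp
  then show ?thesis unfolding sym_diff_verts by (simp add: brauer_iff brauer_mult_msum[OF assms])
qed

section \<open>The involution\<close>

fun flip_vertex :: "vertex \<Rightarrow> vertex" where
  "flip_vertex (Plain i) = Prime i"
| "flip_vertex (Prime i) = Plain i"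
| "flip_vertex (DPrime i) = DPrime i"

definition dag :: "vertex set set \<Rightarrow> vertex set set" where
  "dag \<alpha> = (`) flip_vertex ` \<alpha>"

lemma flip_flip [simp]: "flip_vertex (flip_vertex x) = x"
  by (cases x) auto

lemma inj_flip: "inj flip_vertex"
  by (metis flip_flip injI)

lemma dag_dag [simp]: "dag (dag \<alpha>) = \<alpha>"
  by (simp add: dag_def image_image)

lemma flip_verts: "flip_vertex ` verts m n = verts n m"
  by (auto simp: verts_def image_Un image_image)

lemma dag_brauer: "dag \<alpha> \<in> brauer n m" if "\<alpha> \<in> brauer m n"
  using pm_image[of "verts m n" \<alpha> flip_vertex] that inj_on_subset[OF inj_flip]
  by (simp add: brauer_iff dag_def flip_verts)

lemma dag_brauer_iff: "dag \<alpha> \<in> brauer n m \<longleftrightarrow> \<alpha> \<in> brauer m n"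
  using dag_brauer[of \<alpha> m n] dag_brauer[of "dag \<alpha>" n m] by auto

lemma dag_edge: "{x, y} \<in> dag \<alpha> \<longleftrightarrow> {flip_vertex x, flip_vertex y} \<in> \<alpha>"
proof
  assume "{x, y} \<in> dag \<alpha>"
  then obtain B where "B \<in> \<alpha>" "{x, y} = flip_vertex ` B" by (auto simp: dag_def)
  then have "flip_vertex ` {x, y} = B" by (simp only: image_image flip_flip image_ident)
  then show "{flip_vertex x, flip_vertex y} \<in> \<alpha>" using \<open>B \<in> \<alpha>\<close> by simp
next
  assume "{flip_vertex x, flip_vertex y} \<in> \<alpha>"
  then have "flip_vertex ` {flip_vertex x, flip_vertex y} \<in> dag \<alpha>" unfolding dag_def by (rule imageI)
  then show "{x, y} \<in> dag \<alpha>" by simp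
qed

lemma dag_brauer_mult: "dag (brauer_mult m k \<alpha> \<beta>) = brauer_mult k m (dag \<beta>) (dag \<alpha>)"
proof -
  have f: "flip_vertex (down_vertex x) = up_vertex (flip_vertex x)"
    "flip_vertex (up_vertex x) = down_vertex (flip_vertex x)" for x by (cases x; simp)+
  have "map_prod flip_vertex flip_vertex ` product_graph \<alpha> \<beta> = product_graph (dag \<beta>) (dag \<alpha>)"
    unfolding product_graph_eq image_Un block_graph_image[symmetric] dag_def image_image f
    by (rule Un_commute)
  then show ?thesis
    unfolding brauer_mult_eq dag_def[of "trace _ _"] trace_image[OF inj_flip, symmetric] flip_verts by simp
qed

text \<open>Puts the rows of a partition at prescribed heights. A product of three factors has two
  middle rows, for which the single constructor \<open>DPrime\<close> is not enough. Brauer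
  partitions contain no \<open>DPrime\<close> vertex, so for them the third height is a dummy and
  may be changed by \<open>layer_cong\<close>.\<close>

fun layer :: "nat \<Rightarrow> nat \<Rightarrow> nat \<Rightarrow> vertex \<Rightarrow> nat \<times> nat" where
  "layer i j k (Plain x) = (i, x)"
| "layer i j k (Prime x) = (j, x)"
| "layer i j k (DPrime x) = (k, x)"

lemma inj_layer: "distinct [i, j, k] \<Longrightarrow> inj (layer i j k)"
proof (rule injI)
  fix x y assume "distinct [i, j, k]" "layer i j k x = layer i j k y"
  then show "x = y" by (cases x; cases y) auto
qed

lemma layer_cong:
  assumes "\<alpha> \<in> brauer m n"
  shows "(`) (layer i j k) ` \<alpha> = (`) (layer i j l) ` \<alpha>"
proof (intro image_cong refl)
  fix B x assume "B \<in> \<alpha>" "x \<in> B"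
  then have "x \<in> verts m n" using assms by (auto simp: brauer_def partition_on_def)
  then show "layer i j k x = layer i j l x" by (cases x) auto
qed

lemma layer_brauer_mult:
  assumes "distinct [i, j, k]" "\<alpha> \<in> brauer m n" "\<beta> \<in> brauer n p"
  shows "(`) (layer i k l) ` brauer_mult m p \<alpha> \<beta> =
    trace (layer i k l ` verts m p) (block_graph ((`) (layer i j l) ` \<alpha>) \<union> block_graph ((`) (layer j k l) ` \<beta>))"
proof -
  have d: "layer i k j (down_vertex x) = layer i j j x" for x by (cases x) auto
  have u: "layer i k j (up_vertex x) = layer j k j x" for x by (cases x) auto
  have v: "layer i k j ` verts m p = layer i k l ` verts m p"
    by (intro image_cong refl) (auto simp: verts_def)
  \<comment> \<open>With the dummy height set to \<open>j\<close>, the middle row of the product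
    graph lands at height \<open>j\<close>, where the lower row of \<open>\<alpha>\<close> and the
    upper row of \<open>\<beta>\<close> meet.\<close>
  have "(`) (layer i k l) ` brauer_mult m p \<alpha> \<beta> = (`) (layer i k j) ` brauer_mult m p \<alpha> \<beta>"
    by (rule layer_cong[OF brauer_mult_closed[OF assms(2,3)]])
  also have "\<dots> = trace (layer i k j ` verts m p)
      (map_prod (layer i k j) (layer i k j) ` product_graph \<alpha> \<beta>)"
    unfolding brauer_mult_eq by (rule trace_image[symmetric, OF inj_layer]) (use assms(1) in auto)
  also have "map_prod (layer i k j) (layer i k j) ` product_graph \<alpha> \<beta> =
      block_graph ((`) (layer i j j) ` \<alpha>) \<union> block_graph ((`) (layer j k j) ` \<beta>)"
    unfolding product_graph_eq image_Un block_graph_image[symmetric] image_image d u ..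
  also have "\<dots> = block_graph ((`) (layer i j l) ` \<alpha>) \<union> block_graph ((`) (layer j k l) ` \<beta>)"
    using layer_cong[OF assms(2), of i j j l] layer_cong[OF assms(3), of j k j l] by simp
  finally show ?thesis unfolding v .
qed

lemma block_graph_layer:
  assumes "\<alpha> \<in> brauer m n"
  shows "block_graph ((`) (layer i j l) ` \<alpha>) \<subseteq> layer i j l ` verts m n \<times> layer i j l ` verts m n"
proof -
  have "\<Union> ((`) (layer i j l) ` \<alpha>) = layer i j l ` verts m n"
    using assms pm_Union[of "verts m n" \<alpha>] by (auto simp: brauer_iff)
  then show ?thesis using block_graph_subset[of "(`) (layer i j l) ` \<alpha>"] by simp
qed

text \<open>Both sides are the trace, on the rows at heights 0 and 3, of the union of three graphs:
  \<open>trace_trace\<close> eliminates the inner rows at heights 1 and 2 in either order. The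
  height 9 is the dummy.\<close>

lemma brauer_mult_assoc:
  assumes a: "\<alpha> \<in> brauer m n" and b: "\<beta> \<in> brauer n k" and c: "\<gamma> \<in> brauer k l"
  shows "brauer_mult m l (brauer_mult m k \<alpha> \<beta>) \<gamma> = brauer_mult m l \<alpha> (brauer_mult n l \<beta> \<gamma>)"
proof -
  let ?L = "\<lambda>i j. (`) (layer i j 9)"
  let ?A = "block_graph (?L 0 1 ` \<alpha>)" and ?B = "block_graph (?L 1 2 ` \<beta>)" and ?C = "block_graph (?L 2 3 ` \<gamma>)"
  let ?W = "layer 0 3 9 ` verts m l"
  note sub = block_graph_layer[OF a, of 0 1 9] block_graph_layer[OF b, of 1 2 9] block_graph_layer[OF c, of 2 3 9]
  have "?L 0 3 ` brauer_mult m l (brauer_mult m k \<alpha> \<beta>) \<gamma> =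
      trace ?W (block_graph (trace (layer 0 2 9 ` verts m k) (?A \<union> ?B)) \<union> ?C)"
    using layer_brauer_mult[of 0 2 3, OF _ brauer_mult_closed[OF a b] c, of 9]
      layer_brauer_mult[of 0 1 2, OF _ a b, of 9] by simp
  also have "\<dots> = trace ?W (?A \<union> ?B \<union> ?C)"
  proof (rule trace_trace)
    let ?V = "layer 0 1 9 ` verts m n \<union> layer 1 2 9 ` verts n k"
    show "?A \<union> ?B \<subseteq> ?V \<times> ?V" using sub by blast
    show "sym (?A \<union> ?B)" by (intro sym_Un sym_block_graph)
    show "?C \<subseteq> layer 2 3 9 ` verts k l \<times> layer 2 3 9 ` verts k l" by (rule sub)
  qed (auto simp: verts_def image_Un image_image)
  also have "\<dots> = trace ?W (?B \<union> ?C \<union> ?A)" by (simp add: Un_ac)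
  also have "\<dots> = trace ?W (block_graph (trace (layer 1 3 9 ` verts n l) (?B \<union> ?C)) \<union> ?A)"
  proof (rule trace_trace[symmetric])
    let ?V = "layer 1 2 9 ` verts n k \<union> layer 2 3 9 ` verts k l"
    show "?B \<union> ?C \<subseteq> ?V \<times> ?V" using sub by blast
    show "sym (?B \<union> ?C)" by (intro sym_Un sym_block_graph)
    show "?A \<subseteq> layer 0 1 9 ` verts m n \<times> layer 0 1 9 ` verts m n" by (rule sub)
  qed (auto simp: verts_def image_Un image_image)
  also have "\<dots> = trace ?W (?A \<union> block_graph (trace (layer 1 3 9 ` verts n l) (?B \<union> ?C)))"
    by (simp add: Un_commute)
  also have "\<dots> = ?L 0 3 ` brauer_mult m l \<alpha> (brauer_mult n l \<beta> \<gamma>)"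
    using layer_brauer_mult[of 0 1 3, OF _ a brauer_mult_closed[OF b c], of 9]
      layer_brauer_mult[of 1 2 3, OF _ b c, of 9] by simp
  finally have eq: "?L 0 3 ` brauer_mult m l (brauer_mult m k \<alpha> \<beta>) \<gamma> =
      ?L 0 3 ` brauer_mult m l \<alpha> (brauer_mult n l \<beta> \<gamma>)" .
  have "inj (layer 0 3 9)" by (rule inj_layer) simp
  then have "inj (?L 0 3)" by (simp add: inj_image_eq_iff inj_on_def)
  then show ?thesis using eq by (simp add: inj_image_eq_iff)
qed

section \<open>Computing products by exhibiting paths\<close>

lemma brauer_mult_edgeI:
  assumes "\<alpha> \<in> brauer m n" "\<beta> \<in> brauer n k" "x \<in> verts m k" "y \<in> verts m k" "x \<noteq> y"
    "(x, y) \<in> (product_graph \<alpha> \<beta>)\<^sup>*"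
  shows "{x, y} \<in> brauer_mult m k \<alpha> \<beta>"
proof -
  have "(x, y) \<in> block_graph (brauer_mult m k \<alpha> \<beta>)"
    unfolding brauer_mult_eq block_graph_trace[OF sym_product_graph] using assms by simp
  then obtain B where B: "B \<in> brauer_mult m k \<alpha> \<beta>" "x \<in> B" "y \<in> B" by (auto simp: block_graph_def)
  have pm: "perfect_matching (verts m k) (brauer_mult m k \<alpha> \<beta>)"
    using brauer_mult_closed[OF assms(1,2)] by (simp add: brauer_iff)
  obtain z where "B = {x, z}" using pm_block[OF pm B(1,2)] by metis
  then show ?thesis using B assms(5) by auto
qed

lemma product_graph_down: "{x, y} \<in> \<alpha> \<Longrightarrow> (down_vertex x, down_vertex y) \<in> product_graph \<alpha> \<beta>"
  and product_graph_up: "{x, y} \<in> \<beta> \<Longrightarrow> (up_vertex x, up_vertex y) \<in> product_graph \<alpha> \<beta>"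
  unfolding product_graph_eq
  using block_graphI[of "down_vertex ` {x, y}" "(`) down_vertex ` \<alpha>" "down_vertex x" "down_vertex y"]
    block_graphI[of "up_vertex ` {x, y}" "(`) up_vertex ` \<beta>" "up_vertex x" "up_vertex y"]
  by (simp_all del: image_insert)

text \<open>By \<open>pm_subset_eq\<close> it is enough to find a path for every edge of the
  expected result; the components of the product graph need not be determined.\<close>

lemma brauer_mult_eqI:
  assumes a: "\<alpha> \<in> brauer m n" and b: "\<beta> \<in> brauer n k" and c: "\<gamma> \<in> brauer m k"
    and "\<And>x y. {x, y} \<in> \<gamma> \<Longrightarrow> x \<in> verts m k \<Longrightarrow> y \<in> verts m k \<Longrightarrow> x \<noteq> y \<Longrightarrow> (x, y) \<in> (product_graph \<alpha> \<beta>)\<^sup>*"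
  shows "brauer_mult m k \<alpha> \<beta> = \<gamma>"
proof (rule pm_subset_eq[symmetric])
  show "perfect_matching (verts m k) \<gamma>" using c by (simp add: brauer_iff)
  show "perfect_matching (verts m k) (brauer_mult m k \<alpha> \<beta>)"
    using brauer_mult_closed[OF a b] by (simp add: brauer_iff)
  show "\<gamma> \<subseteq> brauer_mult m k \<alpha> \<beta>"
  proof
    fix B assume B: "B \<in> \<gamma>"
    obtain x y where "x \<noteq> y" "B = {x, y}" "x \<in> verts m k" "y \<in> verts m k"
      using pm_block2[of "verts m k" \<gamma> B] B c by (auto simp: brauer_iff)
    then show "B \<in> brauer_mult m k \<alpha> \<beta>" using brauer_mult_edgeI[OF a b] assms(4) B by simp
  qed
qed

definition idb :: "nat \<Rightarrow> vertex set set" where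
  "idb n = (\<lambda>i. {Plain i, Prime i}) ` {1..n}"

lemma idb_edge [simp]:
  "{Plain i, Prime j} \<in> idb n \<longleftrightarrow> i = j \<and> i \<in> {1..n}" "{Prime j, Plain i} \<in> idb n \<longleftrightarrow> i = j \<and> i \<in> {1..n}"
  "{Plain i, Plain j} \<notin> idb n" "{Prime i, Prime j} \<notin> idb n"
  by (simp_all add: idb_def doubleton_eq_iff image_iff) blast+

lemma idb_brauer: "idb n \<in> brauer n n"
  unfolding brauer_iff
proof (rule perfect_matchingI)
  fix x assume x: "x \<in> verts n n"
  show "\<exists>y. {x, y} \<in> idb n"
  proof (cases x)
    case (Plain i)
    then show ?thesis using x by (intro exI[of _ "Prime i"]) simp
  next
    case (Prime i)
    then show ?thesis using x by (intro exI[of _ "Plain i"]) simp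
  qed (use x in simp)
next
  fix B assume "B \<in> idb n"
  then obtain i where "i \<in> {1..n}" "B = {Plain i, Prime i}" by (auto simp: idb_def)
  then show "\<exists>x y. x \<noteq> y \<and> B = {x, y} \<and> x \<in> verts n n \<and> y \<in> verts n n"
    by (intro exI[of _ "Plain i"] exI[of _ "Prime i"]) simp
next
  fix x y z assume "{x, y} \<in> idb n" "{x, z} \<in> idb n"
  then obtain i j where "{x, y} = {Plain i, Prime i}" "{x, z} = {Plain j, Prime j}"
    by (auto simp: idb_def)
  then show "y = z" by (auto simp: doubleton_eq_iff)
qed

lemma dag_idb: "dag (idb n) = idb n"
  by (auto simp: dag_def idb_def image_image insert_commute)

lemma idb_left:
  assumes a: "\<alpha> \<in> brauer m n"
  shows "brauer_mult m n (idb m) \<alpha> = \<alpha>"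
proof (rule brauer_mult_eqI[OF idb_brauer a a])
  fix x y assume xy: "{x, y} \<in> \<alpha>" and v: "x \<in> verts m n" "y \<in> verts m n"
  let ?G = "product_graph (idb m) \<alpha>"
  have up: "(x, up_vertex x) \<in> ?G\<^sup>*" if "x \<in> verts m n" for x
  proof (cases x)
    case (Plain i)
    then have "{Plain i, Prime i} \<in> idb m" using that by simp
    from product_graph_down[OF this, of \<alpha>] show ?thesis using Plain by auto
  qed (use that in auto)
  have s: "sym (?G\<^sup>*)" by (intro sym_rtrancl sym_product_graph)
  have "(x, up_vertex y) \<in> ?G\<^sup>*"
    by (rule rtrancl_into_rtrancl[OF up[OF v(1)] product_graph_up[OF xy]])
  also have "(up_vertex y, y) \<in> ?G\<^sup>*" by (rule symD[OF s up[OF v(2)]])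
  finally show "(x, y) \<in> ?G\<^sup>*" .
qed

lemma idb_right:
  assumes "\<alpha> \<in> brauer m n"
  shows "brauer_mult m n \<alpha> (idb n) = \<alpha>"
  using idb_left[OF dag_brauer[OF assms]] dag_brauer_mult[of m n \<alpha> "idb n"] dag_idb
  by (metis dag_dag)

section \<open>Full Brauer partitions\<close>

lemma pm_pairs:
  assumes "inj_on f I" "inj_on g I" "f ` I \<inter> g ` I = {}"
  shows "perfect_matching (f ` I \<union> g ` I) ((\<lambda>i. {f i, g i}) ` I)"
proof (rule perfect_matchingI)
  fix B assume "B \<in> (\<lambda>i. {f i, g i}) ` I"
  then obtain i where i: "i \<in> I" "B = {f i, g i}" by blast
  then have "f i \<noteq> g i" using assms(3) by blast
  then show "\<exists>x y. x \<noteq> y \<and> B = {x, y} \<and> x \<in> f ` I \<union> g ` I \<and> y \<in> f ` I \<union> g ` I"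
    using i by (intro exI[of _ "f i"] exI[of _ "g i"]) simp
next
  fix x assume "x \<in> f ` I \<union> g ` I"
  then obtain i where i: "i \<in> I" "x = f i \<or> x = g i" by blast
  then have "{x, if x = f i then g i else f i} = {f i, g i}" by auto
  then show "\<exists>y. {x, y} \<in> (\<lambda>i. {f i, g i}) ` I" using i(1) by blast
next
  fix x y z assume "{x, y} \<in> (\<lambda>i. {f i, g i}) ` I" "{x, z} \<in> (\<lambda>i. {f i, g i}) ` I"
  then obtain i j where i: "i \<in> I" "{x, y} = {f i, g i}" and j: "j \<in> I" "{x, z} = {f j, g j}" by blast
  have "x = f i \<and> y = g i \<or> x = g i \<and> y = f i" "x = f j \<and> z = g j \<or> x = g j \<and> z = f j"
    using i(2) j(2) by (simp_all add: doubleton_eq_iff)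
  moreover have "f i \<noteq> g j" "g i \<noteq> f j" using i(1) j(1) assms(3) by blast+
  ultimately show "y = z" using inj_onD[OF assms(1) _ i(1) j(1)] inj_onD[OF assms(2) _ i(1) j(1)] by auto
qed

lemma pm_subset:
  assumes "perfect_matching S M" "N \<subseteq> M"
  shows "perfect_matching (\<Union> N) N"
proof -
  have "M - (M - N) = N" using assms(2) by auto
  moreover have "perfect_matching (S - \<Union> (M - N)) (M - (M - N))"
    using assms(1) by (rule pm_Diff) auto
  ultimately show ?thesis using pm_Union by metis
qed

lemma brauer_mult_eqI':
  assumes a: "\<alpha> \<in> brauer m n" and b: "\<beta> \<in> brauer n k" and c: "\<gamma> \<in> brauer m k"
    and 1: "\<And>i j. {Plain i, Plain j} \<in> \<gamma> \<Longrightarrow> (Plain i, Plain j) \<in> (product_graph \<alpha> \<beta>)\<^sup>*"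
    and 2: "\<And>i j. {Plain i, Prime j} \<in> \<gamma> \<Longrightarrow> (Plain i, Prime j) \<in> (product_graph \<alpha> \<beta>)\<^sup>*"
    and 3: "\<And>i j. {Prime i, Prime j} \<in> \<gamma> \<Longrightarrow> (Prime i, Prime j) \<in> (product_graph \<alpha> \<beta>)\<^sup>*"
  shows "brauer_mult m k \<alpha> \<beta> = \<gamma>"
proof (rule brauer_mult_eqI[OF a b c])
  fix x y assume xy: "{x, y} \<in> \<gamma>" and v: "x \<in> verts m k" "y \<in> verts m k"
  have s: "sym ((product_graph \<alpha> \<beta>)\<^sup>*)" by (intro sym_rtrancl sym_product_graph)
  show "(x, y) \<in> (product_graph \<alpha> \<beta>)\<^sup>*"
  proof (cases x)
    case x: (Plain i)
    show ?thesis by (cases y) (use x xy v 1 2 in auto)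
  next
    case x: (Prime i)
    show ?thesis
    proof (cases y)
      case (Plain j)
      then have "(y, x) \<in> (product_graph \<alpha> \<beta>)\<^sup>*" using 2[of j i] xy x by (simp add: insert_commute)
      then show ?thesis by (rule symD[OF s])
    qed (use x xy v 3 in auto)
  qed (use v in auto)
qed

lemma product_graph_down_simps:
  "{Plain a, Plain b} \<in> \<alpha> \<Longrightarrow> (Plain a, Plain b) \<in> product_graph \<alpha> \<beta>"
  "{Plain a, Prime b} \<in> \<alpha> \<Longrightarrow> (Plain a, DPrime b) \<in> product_graph \<alpha> \<beta>"
  "{Plain a, Prime b} \<in> \<alpha> \<Longrightarrow> (DPrime b, Plain a) \<in> product_graph \<alpha> \<beta>"
  "{Prime a, Prime b} \<in> \<alpha> \<Longrightarrow> (DPrime a, DPrime b) \<in> product_graph \<alpha> \<beta>"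
  using product_graph_down[of "Plain a" "Plain b" \<alpha> \<beta>] product_graph_down[of "Plain a" "Prime b" \<alpha> \<beta>]
    product_graph_down[of "Prime b" "Plain a" \<alpha> \<beta>] product_graph_down[of "Prime a" "Prime b" \<alpha> \<beta>]
  by (simp_all add: insert_commute)

lemma product_graph_up_simps:
  "{Plain a, Plain b} \<in> \<beta> \<Longrightarrow> (DPrime a, DPrime b) \<in> product_graph \<alpha> \<beta>"
  "{Plain a, Prime b} \<in> \<beta> \<Longrightarrow> (DPrime a, Prime b) \<in> product_graph \<alpha> \<beta>"
  "{Plain a, Prime b} \<in> \<beta> \<Longrightarrow> (Prime b, DPrime a) \<in> product_graph \<alpha> \<beta>"
  "{Prime a, Prime b} \<in> \<beta> \<Longrightarrow> (Prime a, Prime b) \<in> product_graph \<alpha> \<beta>"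
  using product_graph_up[of "Plain a" "Plain b" \<beta> \<alpha>] product_graph_up[of "Plain a" "Prime b" \<beta> \<alpha>]
    product_graph_up[of "Prime b" "Plain a" \<beta> \<alpha>] product_graph_up[of "Prime a" "Prime b" \<beta> \<alpha>]
  by (simp_all add: insert_commute)

lemmas pg_edges = product_graph_down_simps product_graph_up_simps

lemma brauer_edge:
  assumes "\<alpha> \<in> brauer m n" "{x, y} \<in> \<alpha>"
  shows "x \<in> verts m n" "y \<in> verts m n" "x \<noteq> y"
  using pm_edge[of "verts m n" \<alpha> x y] assms by (auto simp: brauer_iff)

lemma brauer_unique:
  assumes "\<alpha> \<in> brauer m n" "{x, y} \<in> \<alpha>" "{x, z} \<in> \<alpha>"
  shows "y = z"
  using pm_unique[of "verts m n" \<alpha> x y] assms by (auto simp: brauer_iff)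

lemma brauer_Plain_cases:
  assumes "\<alpha> \<in> brauer m n" "i \<in> {1..m}"
  obtains j where "j \<in> {1..m}" "{Plain i, Plain j} \<in> \<alpha>" | j where "j \<in> {1..n}" "{Plain i, Prime j} \<in> \<alpha>"
proof -
  obtain y where y: "{Plain i, y} \<in> \<alpha>" "y \<in> verts m n"
    using pm_partner[of "verts m n" \<alpha> "Plain i"] assms by (auto simp: brauer_iff)
  then show ?thesis using that by (cases y) auto
qed

lemma brauer_Prime_cases:
  assumes "\<alpha> \<in> brauer m n" "i \<in> {1..n}"
  obtains j where "j \<in> {1..m}" "{Plain j, Prime i} \<in> \<alpha>" | j where "j \<in> {1..n}" "{Prime i, Prime j} \<in> \<alpha>"
proof -
  obtain y where y: "{Prime i, y} \<in> \<alpha>" "y \<in> verts m n"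
    using pm_partner[of "verts m n" \<alpha> "Prime i"] assms by (auto simp: brauer_iff)
  then show ?thesis using that by (cases y) (auto simp: insert_commute)
qed

text \<open>The combinatorial form of the isometries; \<open>isom_iff\<close> identifies the two
  notions.\<close>

definition full :: "vertex set set \<Rightarrow> bool" where
  "full \<alpha> \<longleftrightarrow> (\<forall>i j. {Prime i, Prime j} \<notin> \<alpha>)"

lemma fullE:
  assumes "full \<alpha>" "\<alpha> \<in> brauer m n" "i \<in> {1..n}"
  obtains a where "a \<in> {1..m}" "{Plain a, Prime i} \<in> \<alpha>"
  using brauer_Prime_cases[OF assms(2,3)] assms(1) by (auto simp: full_def)

lemma full_dagE:
  assumes "full (dag \<alpha>)" "\<alpha> \<in> brauer m n" "i \<in> {1..m}"
  obtains a where "a \<in> {1..n}" "{Plain i, Prime a} \<in> \<alpha>"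
  using fullE[OF assms(1) dag_brauer[OF assms(2)] assms(3)] by (auto simp: dag_edge insert_commute)

lemma full_idb: "full (idb n)"
  by (simp add: full_def)

text \<open>Each lower point \<open>i\<close> hangs on an upper point \<open>a\<close>, and its
  mirror image hangs on the same \<open>a\<close>.\<close>

lemma full_dag_mult:
  assumes x: "x \<in> brauer r q" and f: "full x"
  shows "brauer_mult q q (dag x) x = idb q"
proof (rule brauer_mult_eqI'[OF dag_brauer[OF x] x idb_brauer])
  fix i j assume "{Plain i, Prime j} \<in> idb q"
  then have ij: "j = i" "i \<in> {1..q}" by auto
  obtain a where a: "{Plain a, Prime i} \<in> x" using fullE[OF f x ij(2)] by metis
  then have "{Plain i, Prime a} \<in> dag x" by (simp add: dag_edge insert_commute)
  then show "(Plain i, Prime j) \<in> (product_graph (dag x) x)\<^sup>*"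
    using a ij by (auto intro: rtrancl_2 pg_edges)
qed auto

text \<open>A lower hook of the right factor survives in every product.\<close>

lemma full_mult_right:
  assumes a: "\<alpha> \<in> brauer m n" and b: "\<beta> \<in> brauer n k" and f: "full (brauer_mult m k \<alpha> \<beta>)"
  shows "full \<beta>"
  unfolding full_def
proof (intro allI notI)
  fix i j assume e: "{Prime i, Prime j} \<in> \<beta>"
  note v = brauer_edge[OF b e]
  have "{Prime i, Prime j} \<in> brauer_mult m k \<alpha> \<beta>"
    by (rule brauer_mult_edgeI[OF a b]) (use v e in \<open>auto intro: pg_edges\<close>)
  then show False using f by (auto simp: full_def)
qed

lemma full_inj:
  assumes x: "x \<in> brauer r q" and f: "full x"
  obtains h where "inj_on h {1..q}" "h ` {1..q} \<subseteq> {1..r}" "\<And>i. i \<in> {1..q} \<Longrightarrow> {Plain (h i), Prime i} \<in> x"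
proof -
  have "\<forall>i\<in>{1..q}. \<exists>a. a \<in> {1..r} \<and> {Plain a, Prime i} \<in> x"
  proof
    fix i assume "i \<in> {1..q}"
    then obtain a where "a \<in> {1..r}" "{Plain a, Prime i} \<in> x" using fullE[OF f x] by metis
    then show "\<exists>a. a \<in> {1..r} \<and> {Plain a, Prime i} \<in> x" by blast
  qed
  then obtain h where h: "\<And>i. i \<in> {1..q} \<Longrightarrow> h i \<in> {1..r} \<and> {Plain (h i), Prime i} \<in> x" by metis
  have "inj_on h {1..q}"
  proof (rule inj_onI)
    fix i j assume "i \<in> {1..q}" "j \<in> {1..q}" "h i = h j"
    then show "i = j" using h[of i] h[of j] brauer_unique[OF x, of "Plain (h i)" "Prime i" "Prime j"] by auto
  qed
  then show ?thesis using that h by blast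
qed

lemma full_le:
  assumes "x \<in> brauer r q" "full x"
  shows "q \<le> r"
proof -
  obtain h where "inj_on h {1..q}" "h ` {1..q} \<subseteq> {1..r}" using full_inj[OF assms] by metis
  from card_inj_on_le[OF this] show ?thesis by simp
qed

text \<open>The \<open>q\<close> lower points are joined to \<open>q\<close> distinct upper points,
  which leaves none for an upper hook: such a partition is a permutation.\<close>

lemma full_square_dag:
  assumes x: "x \<in> brauer q q" and f: "full x"
  shows "full (dag x)"
proof -
  obtain h where h: "inj_on h {1..q}" "h ` {1..q} \<subseteq> {1..q}" "\<And>i. i \<in> {1..q} \<Longrightarrow> {Plain (h i), Prime i} \<in> x"
    using full_inj[OF x f] by metis
  have "h ` {1..q} = {1..q}" using h by (intro endo_inj_surj) auto
  show ?thesis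
    unfolding full_def
  proof (intro allI notI)
    fix i j assume "{Prime i, Prime j} \<in> dag x"
    then have e: "{Plain i, Plain j} \<in> x" by (simp add: dag_edge)
    then have "i \<in> h ` {1..q}" using brauer_edge[OF x e] \<open>h ` {1..q} = {1..q}\<close> by simp
    then obtain k where "{Plain i, Prime k} \<in> x" using h(3) by blast
    then show False using brauer_unique[OF x e] by blast
  qed
qed

section \<open>Upper hooks, and factorization through the transversals\<close>

definition hooks :: "vertex set set \<Rightarrow> vertex set set" where
  "hooks \<alpha> = {B \<in> \<alpha>. B \<subseteq> range Plain}"

lemma hooks_edge [simp]: "{x, y} \<in> hooks \<alpha> \<longleftrightarrow> {x, y} \<in> \<alpha> \<and> x \<in> range Plain \<and> y \<in> range Plain"
  by (auto simp: hooks_def)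

lemma hooks_subset: "hooks \<alpha> \<subseteq> \<alpha>"
  by (auto simp: hooks_def)

text \<open>The upper half of \<open>\<alpha>\<close>: the upper hooks stay, and the transversals
  are led to a new lower row, in the order in which \<open>a\<close> lists their upper ends.\<close>

lemma attach_brauer:
  assumes \<alpha>: "\<alpha> \<in> brauer m n" and inj: "inj_on a {1..k}"
    and a: "a ` {1..k} = {x. \<exists>y. {Plain x, Prime y} \<in> \<alpha>}"
  shows "hooks \<alpha> \<union> (\<lambda>i. {Plain (a i), Prime i}) ` {1..k} \<in> brauer m k" (is "?u \<in> _")
    and "full (hooks \<alpha> \<union> (\<lambda>i. {Plain (a i), Prime i}) ` {1..k})"
proof -
  have pm: "perfect_matching (verts m n) \<alpha>" using \<alpha> by (simp add: brauer_iff)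
  let ?f = "\<lambda>i. Plain (a i)"
  have injf: "inj_on ?f {1..k}" using inj_onD[OF inj] by (intro inj_onI) blast
  have injP: "inj_on Prime {1..k}" by (rule inj_onI) simp
  have "perfect_matching (?f ` {1..k} \<union> Prime ` {1..k}) ((\<lambda>i. {?f i, Prime i}) ` {1..k})"
    by (rule pm_pairs[OF injf injP]) blast
  moreover have H: "perfect_matching (\<Union> (hooks \<alpha>)) (hooks \<alpha>)" using pm hooks_subset by (rule pm_subset)
  moreover have disj: "\<Union> (hooks \<alpha>) \<inter> (?f ` {1..k} \<union> Prime ` {1..k}) = {}"
  proof -
    have False if B: "B \<in> hooks \<alpha>" "x \<in> B" and x: "x = ?f i" "i \<in> {1..k}" for B x i
    proof -
      obtain y where "{x, Prime y} \<in> \<alpha>" using x a by blast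
      then have "B = {x, Prime y}" using pm_disj[OF pm, of B "{x, Prime y}" x] B by (auto simp: hooks_def)
      then show False using B by (auto simp: hooks_def)
    qed
    moreover have False if "B \<in> hooks \<alpha>" "Prime i \<in> B" for B i using that by (auto simp: hooks_def)
    ultimately show ?thesis by blast
  qed
  ultimately have u: "perfect_matching (\<Union> (hooks \<alpha>) \<union> (?f ` {1..k} \<union> Prime ` {1..k})) ?u"
    by (intro pm_Un)
  have "\<Union> (hooks \<alpha>) \<union> ?f ` {1..k} = Plain ` {1..m}"
  proof (intro equalityI subsetI)
    fix x assume x: "x \<in> \<Union> (hooks \<alpha>) \<union> ?f ` {1..k}"
    have "x \<in> verts m n \<inter> range Plain"
    proof (cases "x \<in> \<Union> (hooks \<alpha>)")
      case True
      then show ?thesis using pm_Union[OF pm] by (auto simp: hooks_def)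
    next
      case False
      then obtain i where i: "i \<in> {1..k}" "x = Plain (a i)" using x by auto
      then obtain y where "{x, Prime y} \<in> \<alpha>" using a by blast
      then show ?thesis using brauer_edge[OF \<alpha>] i by blast
    qed
    then show "x \<in> Plain ` {1..m}" by (auto simp: verts_def)
  next
    fix x assume "x \<in> Plain ` {1..m}"
    then obtain i where i: "i \<in> {1..m}" "x = Plain i" by auto
    show "x \<in> \<Union> (hooks \<alpha>) \<union> ?f ` {1..k}"
    proof (rule brauer_Plain_cases[OF \<alpha> i(1)])
      fix j assume "{Plain i, Plain j} \<in> \<alpha>"
      then have "{Plain i, Plain j} \<in> hooks \<alpha>" by simp
      then show ?thesis using i by blast
    next
      fix j assume "{Plain i, Prime j} \<in> \<alpha>"
      then have "i \<in> a ` {1..k}" using a by blast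
      then show ?thesis using i by blast
    qed
  qed
  then have "\<Union> (hooks \<alpha>) \<union> (?f ` {1..k} \<union> Prime ` {1..k}) = verts m k" by (auto simp: verts_def)
  then show "?u \<in> brauer m k" using u by (simp add: brauer_iff)
  show "full ?u" by (auto simp: full_def doubleton_eq_iff)
qed

text \<open>All transversals are cut in the middle. The two lists \<open>a\<close> and
  \<open>b\<close> of their ends come from one enumeration \<open>h\<close>, so the halves fit
  together again. The lower half is the upper half of \<open>dag \<alpha>\<close>, turned
  back.\<close>

lemma brauer_factorization:
  assumes \<alpha>: "\<alpha> \<in> brauer m n"
  obtains u v where "u \<in> brauer m (brauer_rank \<alpha>)" "full u" "v \<in> brauer (brauer_rank \<alpha>) n" "full (dag v)"
    "brauer_mult m n u v = \<alpha>"
proof -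
  have pm: "perfect_matching (verts m n) \<alpha>" using \<alpha> by (simp add: brauer_iff)
  define T where "T = {B \<in> \<alpha>. B \<inter> range Plain \<noteq> {} \<and> B \<inter> range Prime \<noteq> {}}"
  define k where "k = card T"
  have "finite T" using pm_finite[OF pm] by (simp add: T_def)
  then obtain h where h: "bij_betw h {1..k} T" using ex_bij_betw_nat_finite_1 k_def by blast
  have T: "\<exists>x y. B = {Plain x, Prime y}" if "B \<in> T" for B
  proof -
    obtain x y where xy: "Plain x \<in> B" "Prime y \<in> B" "B \<in> \<alpha>" using \<open>B \<in> T\<close> by (auto simp: T_def)
    obtain z where "B = {Plain x, z}" using pm_block[OF pm xy(3,1)] by metis
    then show ?thesis using xy by auto
  qed
  have "\<forall>i\<in>{1..k}. \<exists>x y. h i = {Plain x, Prime y}" using T h by (auto simp: bij_betw_def)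
  then obtain a b where ab: "\<And>i. i \<in> {1..k} \<Longrightarrow> h i = {Plain (a i), Prime (b i)}" by metis
  have h\<alpha>: "h i \<in> \<alpha>" if "i \<in> {1..k}" for i using h that by (auto simp: bij_betw_def T_def)
  have surj: "\<exists>i\<in>{1..k}. x = a i \<and> y = b i" if "{Plain x, Prime y} \<in> \<alpha>" for x y
  proof -
    have "{Plain x, Prime y} \<in> T" using that by (auto simp: T_def)
    then obtain i where i: "i \<in> {1..k}" "h i = {Plain x, Prime y}" using h by (auto simp: bij_betw_def)
    then show ?thesis using ab[OF i(1)] by (auto simp: doubleton_eq_iff)
  qed
  have inj: "i = j" if "i \<in> {1..k}" "j \<in> {1..k}" "h i = h j" for i j
    using inj_onD[OF bij_betw_imp_inj_on[OF h]] that by blast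
  have inja: "inj_on a {1..k}"
  proof (rule inj_onI)
    fix i j assume i: "i \<in> {1..k}" and j: "j \<in> {1..k}" and e: "a i = a j"
    have "h i = h j"
      by (rule pm_disj[OF pm h\<alpha>[OF i] h\<alpha>[OF j], of "Plain (a i)"]) (use ab[OF i] ab[OF j] e in auto)
    then show "i = j" using inj i j by blast
  qed
  have injb: "inj_on b {1..k}"
  proof (rule inj_onI)
    fix i j assume i: "i \<in> {1..k}" and j: "j \<in> {1..k}" and e: "b i = b j"
    have "h i = h j"
      by (rule pm_disj[OF pm h\<alpha>[OF i] h\<alpha>[OF j], of "Prime (b i)"]) (use ab[OF i] ab[OF j] e in auto)
    then show "i = j" using inj i j by blast
  qed
  have e: "{Plain (a i), Prime (b i)} \<in> \<alpha>" if "i \<in> {1..k}" for i using h\<alpha>[OF that] ab[OF that] by simp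
  have A: "a ` {1..k} = {x. \<exists>y. {Plain x, Prime y} \<in> \<alpha>}" using e surj by blast
  have B: "b ` {1..k} = {x. \<exists>y. {Plain x, Prime y} \<in> dag \<alpha>}"
  proof (intro equalityI subsetI)
    fix y assume "y \<in> b ` {1..k}"
    then obtain i where i: "i \<in> {1..k}" "y = b i" by blast
    then have "{Plain y, Prime (a i)} \<in> dag \<alpha>" using e[OF i(1)] by (simp add: dag_edge insert_commute)
    then show "y \<in> {x. \<exists>y. {Plain x, Prime y} \<in> dag \<alpha>}" by blast
  next
    fix y assume "y \<in> {x. \<exists>y. {Plain x, Prime y} \<in> dag \<alpha>}"
    then obtain x where "{Plain y, Prime x} \<in> dag \<alpha>" by blast
    then have "{Plain x, Prime y} \<in> \<alpha>" by (simp add: dag_edge insert_commute)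
    then show "y \<in> b ` {1..k}" using surj by blast
  qed
  let ?u = "hooks \<alpha> \<union> (\<lambda>i. {Plain (a i), Prime i}) ` {1..k}"
  let ?v = "hooks (dag \<alpha>) \<union> (\<lambda>i. {Plain (b i), Prime i}) ` {1..k}"
  note u = attach_brauer[OF \<alpha> inja A]
  note v = attach_brauer[OF dag_brauer[OF \<alpha>] injb B]
  have "brauer_mult m n ?u (dag ?v) = \<alpha>"
  proof (rule brauer_mult_eqI'[OF u(1) dag_brauer[OF v(1)] \<alpha>])
    fix i j assume "{Plain i, Plain j} \<in> \<alpha>"
    then have "{Plain i, Plain j} \<in> ?u" by simp
    then show "(Plain i, Plain j) \<in> (product_graph ?u (dag ?v))\<^sup>*" by (intro r_into_rtrancl pg_edges)
  next
    fix i j assume "{Prime i, Prime j} \<in> \<alpha>"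
    then have "{Prime i, Prime j} \<in> dag ?v" by (simp add: dag_edge)
    then show "(Prime i, Prime j) \<in> (product_graph ?u (dag ?v))\<^sup>*" by (intro r_into_rtrancl pg_edges)
  next
    fix i j assume "{Plain i, Prime j} \<in> \<alpha>"
    then obtain l where l: "l \<in> {1..k}" "i = a l" "j = b l" using surj by blast
    then have "{Plain i, Prime l} \<in> ?u" by blast
    moreover have "{Plain j, Prime l} \<in> ?v" using l by blast
    then have "{Plain l, Prime j} \<in> dag ?v" unfolding dag_edge by (simp add: insert_commute)
    ultimately show "(Plain i, Prime j) \<in> (product_graph ?u (dag ?v))\<^sup>*"
      by (blast intro: rtrancl_2 pg_edges)
  qed
  moreover have "brauer_rank \<alpha> = k" by (simp add: brauer_rank_def k_def T_def)
  ultimately show ?thesis using that u dag_brauer[OF v(1)] v(2) by simp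
qed

text \<open>Equal hooks leave the same transversal points, so \<open>x\<close> and \<open>y\<close>
  differ only in the numbering of these, and \<open>dag x * y\<close> is the renumbering. With
  \<open>hooks_mult\<close> this makes the hooks a complete invariant of a full partition up to
  permutations of its lower points.\<close>

lemma hooks_eq_mult:
  assumes x: "x \<in> brauer r q" "full x" and y: "y \<in> brauer r q" "full y" and h: "hooks x = hooks y"
  shows "brauer_mult r q x (brauer_mult q q (dag x) y) = y"
proof -
  let ?\<rho> = "brauer_mult q q (dag x) y"
  note \<rho> = brauer_mult_closed[OF dag_brauer[OF x(1)] y(1)]
  have hk: "{Plain a, Plain b} \<in> x \<longleftrightarrow> {Plain a, Plain b} \<in> y" for a b
    using h hooks_edge[of "Plain a" "Plain b"] by blast
  show ?thesis
  proof (rule brauer_mult_eqI'[OF x(1) \<rho> y(1)])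
    fix i j assume "{Plain i, Plain j} \<in> y"
    then have "{Plain i, Plain j} \<in> x" using hk by blast
    then show "(Plain i, Plain j) \<in> (product_graph x ?\<rho>)\<^sup>*" by (intro r_into_rtrancl pg_edges)
  next
    fix i j assume "{Prime i, Prime j} \<in> y"
    then show "(Prime i, Prime j) \<in> (product_graph x ?\<rho>)\<^sup>*" using y by (simp add: full_def)
  next
    fix a i assume e: "{Plain a, Prime i} \<in> y"
    then have a: "a \<in> {1..r}" and i: "i \<in> {1..q}" using brauer_edge[OF y(1) e] by auto
    have "{Plain a, Plain b} \<notin> x" for b using hk brauer_unique[OF y(1) e] by blast
    then obtain j where j: "j \<in> {1..q}" "{Plain a, Prime j} \<in> x" using brauer_Plain_cases[OF x(1) a] by metis
    have "{Plain j, Prime a} \<in> dag x" using j by (simp add: dag_edge insert_commute)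
    then have "{Plain j, Prime i} \<in> ?\<rho>"
      by (intro brauer_mult_edgeI[OF dag_brauer[OF x(1)] y(1)] rtrancl_2[of _ "DPrime a"] pg_edges)
        (use i j e in auto)
    then show "(Plain a, Prime i) \<in> (product_graph x ?\<rho>)\<^sup>*"
      using j(2) by (blast intro: rtrancl_2 pg_edges)
  qed
qed

lemma hooks_mult:
  assumes a: "\<alpha> \<in> brauer m n" and b: "\<beta> \<in> brauer n k"
  shows "hooks \<alpha> \<subseteq> hooks (brauer_mult m k \<alpha> \<beta>)"
proof
  fix B assume B: "B \<in> hooks \<alpha>"
  then have "B \<in> \<alpha>" by (simp add: hooks_def)
  obtain x y where xy: "B = {x, y}" using pm_block2 a \<open>B \<in> \<alpha>\<close> by (metis brauer_iff)
  then obtain i j where ij: "x = Plain i" "y = Plain j" using B by (auto simp: hooks_def)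
  then have e: "{Plain i, Plain j} \<in> \<alpha>" using \<open>B \<in> \<alpha>\<close> xy by simp
  have "{Plain i, Plain j} \<in> brauer_mult m k \<alpha> \<beta>"
    by (rule brauer_mult_edgeI[OF a b]) (use brauer_edge[OF a e] e in \<open>auto intro: pg_edges\<close>)
  then show "B \<in> hooks (brauer_mult m k \<alpha> \<beta>)" using xy ij by simp
qed

section \<open>Caps and cuts\<close>

text \<open>Right multiplication by \<open>dag (cap p)\<close> joins the last two of
  \<open>p + 2\<close> lower points.\<close>

definition cap :: "nat \<Rightarrow> vertex set set" where
  "cap p = insert {Prime (p + 1), Prime (p + 2)} (idb p)"

lemma verts_add2: "verts (p + 2) q = {Plain (p + 1), Plain (p + 2)} \<union> verts p q"
  "verts p (q + 2) = {Prime (q + 1), Prime (q + 2)} \<union> verts p q"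
proof -
  have "{1..p + 2} = insert (p + 1) (insert (p + 2) {1..p})" for p :: nat by auto
  then show "verts (p + 2) q = {Plain (p + 1), Plain (p + 2)} \<union> verts p q"
    "verts p (q + 2) = {Prime (q + 1), Prime (q + 2)} \<union> verts p q"
    by (auto simp: verts_def)
qed

lemma brauer_insert_Prime:
  assumes "\<alpha> \<in> brauer p q"
  shows "insert {Prime (q + 1), Prime (q + 2)} \<alpha> \<in> brauer p (q + 2)"
proof -
  have "perfect_matching ({Prime (q + 1), Prime (q + 2)} \<union> verts p q) ({{Prime (q + 1), Prime (q + 2)}} \<union> \<alpha>)"
    by (rule pm_Un[OF pm_pair]) (use assms in \<open>auto simp: brauer_iff\<close>)
  then show ?thesis unfolding brauer_iff verts_add2 by simp
qed

lemma brauer_insert_Plain: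
  assumes "\<alpha> \<in> brauer p q"
  shows "insert {Plain (p + 1), Plain (p + 2)} \<alpha> \<in> brauer (p + 2) q"
proof -
  have "perfect_matching ({Plain (p + 1), Plain (p + 2)} \<union> verts p q) ({{Plain (p + 1), Plain (p + 2)}} \<union> \<alpha>)"
    by (rule pm_Un[OF pm_pair]) (use assms in \<open>auto simp: brauer_iff\<close>)
  then show ?thesis unfolding brauer_iff verts_add2 by simp
qed

lemma cap_brauer: "cap p \<in> brauer p (p + 2)"
  unfolding cap_def by (rule brauer_insert_Prime[OF idb_brauer])

lemma dag_cap: "dag (cap p) = insert {Plain (p + 1), Plain (p + 2)} (idb p)"
  using dag_idb[of p] by (simp add: cap_def dag_def)

lemma full_dag_cap: "full (dag (cap p))"
  by (simp add: full_def dag_cap doubleton_eq_iff)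

text \<open>A preimage of \<open>u\<close> under right multiplication by \<open>dag (cap p)\<close>:
  the hook at \<open>a\<close> and \<open>b\<close> is opened and its ends run to two new lower
  points.\<close>

definition cut :: "vertex set set \<Rightarrow> nat \<Rightarrow> nat \<Rightarrow> nat \<Rightarrow> vertex set set" where
  "cut u a b p = insert {Plain a, Prime (p + 1)} (insert {Plain b, Prime (p + 2)} (u - {{Plain a, Plain b}}))"

lemma cut_brauer:
  assumes u: "u \<in> brauer m p" and ab: "{Plain a, Plain b} \<in> u"
  shows "cut u a b p \<in> brauer m (p + 2)"
proof -
  have pm: "perfect_matching (verts m p) u" using u by (simp add: brauer_iff)
  note v = brauer_edge[OF u ab]
  let ?S = "verts m p - {Plain a, Plain b}"
  have 1: "perfect_matching ?S (u - {{Plain a, Plain b}})" using pm_Diff[OF pm, of "{{Plain a, Plain b}}"] ab by simp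
  have 2: "perfect_matching ({Plain b, Prime (p + 2)} \<union> ?S) ({{Plain b, Prime (p + 2)}} \<union> (u - {{Plain a, Plain b}}))"
    by (rule pm_Un[OF pm_pair 1]) auto
  have "perfect_matching ({Plain a, Prime (p + 1)} \<union> ({Plain b, Prime (p + 2)} \<union> ?S))
      ({{Plain a, Prime (p + 1)}} \<union> ({{Plain b, Prime (p + 2)}} \<union> (u - {{Plain a, Plain b}})))"
    by (rule pm_Un[OF pm_pair 2]) (use v in auto)
  moreover have "{Plain a, Prime (p + 1)} \<union> ({Plain b, Prime (p + 2)} \<union> ?S) = verts m (p + 2)"
    using v unfolding verts_add2 by auto
  ultimately show ?thesis by (simp only: cut_def brauer_iff insert_is_Un[symmetric])
qed

lemma cut_edges:
  "{Plain a, Prime (p + 1)} \<in> cut u a b p" "{Plain b, Prime (p + 2)} \<in> cut u a b p"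
  "B \<in> u \<Longrightarrow> B \<noteq> {Plain a, Plain b} \<Longrightarrow> B \<in> cut u a b p"
  by (simp_all add: cut_def)

lemma cut_mult_dag_cap:
  assumes u: "u \<in> brauer m p" and ab: "{Plain a, Plain b} \<in> u"
  shows "brauer_mult m p (cut u a b p) (dag (cap p)) = u"
proof (rule brauer_mult_eqI'[OF cut_brauer[OF u ab] dag_brauer[OF cap_brauer] u])
  let ?G = "product_graph (cut u a b p) (dag (cap p))"
  have s: "sym (?G\<^sup>*)" by (intro sym_rtrancl sym_product_graph)
  have "(Plain a, DPrime (p + 1)) \<in> ?G" "(DPrime (p + 1), DPrime (p + 2)) \<in> ?G" "(DPrime (p + 2), Plain b) \<in> ?G"
    using cut_edges[where u = u] by (auto intro!: pg_edges simp: dag_cap)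
  then have abG: "(Plain a, Plain b) \<in> ?G\<^sup>*" by (rule rtrancl_3)
  have c: "{Plain i, Prime i} \<in> dag (cap p)" if "i \<in> {1..p}" for i using that by (simp add: dag_cap)
  show "(Plain i, Plain j) \<in> ?G\<^sup>*" if e: "{Plain i, Plain j} \<in> u" for i j
  proof (cases "{Plain i, Plain j} = {Plain a, Plain b}")
    case True
    then have "i = a \<and> j = b \<or> i = b \<and> j = a" by (auto simp: doubleton_eq_iff)
    then show ?thesis using abG symD[OF s abG] by auto
  next
    case False
    then show ?thesis using pg_edges(1)[OF cut_edges(3)[OF e]] by blast
  qed
  show "(Plain i, Prime j) \<in> ?G\<^sup>*" if e: "{Plain i, Prime j} \<in> u" for i j
  proof -
    have "{Plain i, Prime j} \<in> cut u a b p" using e by (intro cut_edges) (auto simp: doubleton_eq_iff)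
    moreover have "j \<in> {1..p}" using brauer_edge[OF u e] by simp
    ultimately show ?thesis using c by (blast intro: rtrancl_2 pg_edges)
  qed
  show "(Prime i, Prime j) \<in> ?G\<^sup>*" if e: "{Prime i, Prime j} \<in> u" for i j
  proof -
    have "{Prime i, Prime j} \<in> cut u a b p" using e by (intro cut_edges) (auto simp: doubleton_eq_iff)
    moreover have "j \<in> {1..p}" "i \<in> {1..p}" using brauer_edge[OF u e] by simp_all
    ultimately show ?thesis using c by (blast intro: rtrancl_3 pg_edges)
  qed
qed

lemma full_has_hook:
  assumes x: "x \<in> brauer r p" and "full x" "p < r"
  obtains a b where "{Plain a, Plain b} \<in> x"
proof (rule ccontr)
  assume "\<not> thesis"
  then have "full (dag x)" using that by (auto simp: full_def dag_edge)
  then show False using full_le[OF dag_brauer[OF x]] assms(3) by simp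
qed

text \<open>The hook to open is found from above: \<open>a0\<close> is a hook point of
  \<open>t u\<close>, which exists as \<open>p < r\<close>, and \<open>a\<close> is the middle point
  joined to it by \<open>t\<close>. After the cut, \<open>a0\<close> is joined to
  \<open>p + 1\<close>. A lower hook of \<open>t u1\<close> would therefore avoid
  \<open>p + 1\<close>, and closing it up with \<open>dag (cap p)\<close> would give
  \<open>t u\<close> either a lower hook or an edge from \<open>a0\<close> to the lower row, both of
  which are excluded.\<close>

lemma cut_exists:
  assumes t: "t \<in> brauer r m" "full (dag t)" and u: "u \<in> brauer m p"
    and f: "full (brauer_mult r p t u)" and pr: "p < r"
  obtains u1 where "u1 \<in> brauer m (p + 2)" "brauer_mult m p u1 (dag (cap p)) = u"
    "full (brauer_mult r (p + 2) t u1)"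
proof -
  let ?x = "brauer_mult r p t u"
  note x = brauer_mult_closed[OF t(1) u]
  obtain a0 b0 where ab0: "{Plain a0, Plain b0} \<in> ?x" using full_has_hook[OF x f pr] by metis
  have a0: "a0 \<in> {1..r}" using brauer_edge[OF x ab0] by simp
  obtain a where a: "a \<in> {1..m}" "{Plain a0, Prime a} \<in> t" using full_dagE[OF t(2,1) a0] by metis
  obtain b where ab: "{Plain a, Plain b} \<in> u"
  proof (rule brauer_Plain_cases[OF u a(1)])
    fix j assume j: "j \<in> {1..p}" "{Plain a, Prime j} \<in> u"
    have "{Plain a0, Prime j} \<in> ?x"
      by (intro brauer_mult_edgeI[OF t(1) u] rtrancl_2[of _ "DPrime a"] pg_edges) (use a j a0 in auto)
    then show thesis using brauer_unique[OF x ab0] by blast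
  qed (use that in blast)
  define u1 where "u1 = cut u a b p"
  have u1: "u1 \<in> brauer m (p + 2)" unfolding u1_def by (rule cut_brauer[OF u ab])
  have eq: "brauer_mult m p u1 (dag (cap p)) = u" unfolding u1_def by (rule cut_mult_dag_cap[OF u ab])
  let ?w = "brauer_mult r (p + 2) t u1"
  note w = brauer_mult_closed[OF t(1) u1]
  have wx: "brauer_mult r p ?w (dag (cap p)) = ?x"
    using brauer_mult_assoc[OF t(1) u1 dag_brauer[OF cap_brauer]] eq by simp
  have ap: "{Plain a, Prime (p + 1)} \<in> u1" unfolding u1_def by (rule cut_edges)
  have a0p: "{Plain a0, Prime (p + 1)} \<in> ?w"
    by (intro brauer_mult_edgeI[OF t(1) u1] rtrancl_2[of _ "DPrime a"] pg_edges) (use a ap a0 in auto)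
  let ?G = "product_graph ?w (dag (cap p))"
  have xI: "{y, z} \<in> ?x" if "(y, z) \<in> ?G\<^sup>*" "y \<in> verts r p" "z \<in> verts r p" "y \<noteq> z" for y z
    using brauer_mult_edgeI[OF w dag_brauer[OF cap_brauer] that(2-4,1)] wx by simp
  have c: "{Plain i, Prime i} \<in> dag (cap p)" if "i \<in> {1..p}" for i using that by (simp add: dag_cap)
  have no: False if e: "{Prime i, Prime j} \<in> ?w" and i: "i \<in> {1..p}" for i j
  proof -
    have "{Prime (p + 1), Plain a0} \<in> ?w" using a0p by (simp add: insert_commute)
    then have "j \<noteq> p + 1" using brauer_unique[OF w, of "Prime (p + 1)" "Plain a0" "Prime i"] e
      by (auto simp: insert_commute)
    moreover have "j \<in> {1..p + 2}" using brauer_edge[OF w e] by simp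
    ultimately consider "j \<in> {1..p}" | "j = p + 2" by force
    then show False
    proof cases
      case 1
      have "(Prime i, Prime j) \<in> ?G\<^sup>*"
        by (rule rtrancl_3[OF pg_edges(7)[OF c[OF i]] pg_edges(4)[OF e] pg_edges(6)[OF c[OF 1]]])
      then have "{Prime i, Prime j} \<in> ?x" using i 1 brauer_edge(3)[OF w e] by (intro xI) auto
      then show False using f by (simp add: full_def)
    next
      case 2
      have *: "{Prime i, Prime (p + 2)} \<in> ?w" "{Plain (p + 2), Plain (p + 1)} \<in> dag (cap p)"
        using e 2 by (simp_all add: insert_commute dag_cap)
      have "(Prime i, Plain a0) \<in> ?G\<^sup>*"
        by (rule rtrancl_4[OF pg_edges(7)[OF c[OF i]] pg_edges(4)[OF *(1)] pg_edges(5)[OF *(2)] pg_edges(3)[OF a0p]])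
      then have "{Prime i, Plain a0} \<in> ?x" using i a0 by (intro xI) auto
      then show False using brauer_unique[OF x ab0, of "Prime i"] by (auto simp: insert_commute)
    qed
  qed
  have "full ?w"
    unfolding full_def
  proof (intro allI notI)
    fix i j assume e: "{Prime i, Prime j} \<in> ?w"
    have e': "{Prime j, Prime i} \<in> ?w" using e by (simp add: insert_commute)
    have "i \<notin> {1..p}" "j \<notin> {1..p}" using no e e' by blast+
    moreover have "i \<in> {1..p + 2}" "j \<in> {1..p + 2}" "i \<noteq> j" using brauer_edge[OF w e] by auto
    ultimately have "i = p + 1 \<or> j = p + 1" by force
    moreover have "{Prime (p + 1), Plain a0} \<in> ?w" using a0p by (simp add: insert_commute)
    ultimately show False using brauer_unique[OF w, of "Prime (p + 1)" "Plain a0"] e e' by blast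
  qed
  then show ?thesis using that u1 eq by blast
qed

text \<open>With \<open>dag (cap p) * cap p\<close> as middle factor, elements of rank \<open>p + 2\<close> multiply to
  elements of rank \<open>p\<close>.\<close>

lemma cap_product:
  obtains z1 z2 where "z1 \<in> brauer (p + 4) (p + 2)" "full z1" "z2 \<in> brauer (p + 4) (p + 2)" "full z2"
    "brauer_mult (p + 2) (p + 2) (dag z1) z2 = brauer_mult (p + 2) (p + 2) (dag (cap p)) (cap p)"
proof -
  let ?h = "insert {Plain (p + 1), Plain (p + 2)} (idb p)"
  define E where "E = insert {Prime (p + 1), Prime (p + 2)} ?h"
  have h: "?h \<in> brauer (p + 2) p" by (rule brauer_insert_Plain[OF idb_brauer])
  have E: "E \<in> brauer (p + 2) (p + 2)" unfolding E_def by (rule brauer_insert_Prime[OF h])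
  define k where "k = insert {Plain (p + 3), Plain (p + 4)} ?h"
  have four: "p + 2 + 1 = p + 3" "p + 2 + 2 = p + 4" by simp_all
  have k: "k \<in> brauer (p + 4) p" using brauer_insert_Plain[OF h] unfolding k_def four .
  \<comment> \<open>The hook at \<open>p + 1\<close>, \<open>p + 2\<close> is kept and becomes the
    upper hook of the product. The other hook is opened towards the lower points
    \<open>p + 1\<close>, \<open>p + 2\<close>; the hook of \<open>dag z1\<close> at
    \<open>p + 3\<close>, \<open>p + 4\<close> reconnects its ends and yields the lower
    hook.\<close>
  define z2 where "z2 = cut k (p + 3) (p + 4) p"
  have z2: "z2 \<in> brauer (p + 4) (p + 2)" unfolding z2_def by (rule cut_brauer[OF k]) (simp add: k_def)
  have fz2: "full z2" by (simp add: full_def z2_def cut_def k_def doubleton_eq_iff)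
  define z1 where "z1 = dag (cap (p + 2))"
  have z1: "z1 \<in> brauer (p + 4) (p + 2)" using dag_brauer[OF cap_brauer, of "p + 2"] unfolding four z1_def .
  have z1e: "dag z1 = insert {Prime (p + 3), Prime (p + 4)} (idb (p + 2))" 
    unfolding z1_def dag_dag cap_def four ..
  have fz1: "full z1" unfolding z1_def by (rule full_dag_cap)
  have z2I: "B \<in> z2" if B: "B \<in> ?h" for B
    unfolding z2_def
  proof (rule cut_edges(3))
    show "B \<in> k" using B unfolding k_def by (rule insertI2)
    show "B \<noteq> {Plain (p + 3), Plain (p + 4)}"
      using B by (elim insertE) (auto simp: idb_def doubleton_eq_iff)
  qed
  have z2e: "{Plain (p + 3), Prime (p + 1)} \<in> z2" "{Plain (p + 4), Prime (p + 2)} \<in> z2"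
    by (simp_all add: z2_def cut_def)
  have "brauer_mult (p + 2) (p + 2) (dag z1) z2 = E"
  proof (rule brauer_mult_eqI[OF dag_brauer[OF z1] z2 E])
    let ?G = "product_graph (dag z1) z2"
    have s: "sym (?G\<^sup>*)" by (intro sym_rtrancl sym_product_graph)
    have 1: "(Plain (p + 1), Plain (p + 2)) \<in> ?G\<^sup>*"
      by (rule rtrancl_3[of _ "DPrime (p + 1)" _ "DPrime (p + 2)"])
        (auto intro!: pg_edges z2I simp: z1e)
    have *: "{Prime (p + 3), Prime (p + 4)} \<in> dag z1" by (simp add: z1e)
    have 2: "(Prime (p + 1), Prime (p + 2)) \<in> ?G\<^sup>*"
      by (rule rtrancl_3[OF pg_edges(7)[OF z2e(1)] pg_edges(4)[OF *] pg_edges(6)[OF z2e(2)]])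
    have 3: "(Plain i, Prime i) \<in> ?G\<^sup>*" if "i \<in> {1..p}" for i
      by (rule rtrancl_2[of _ "DPrime i"]) (use that in \<open>auto intro!: pg_edges z2I simp: z1e\<close>)
    fix x y assume "{x, y} \<in> E"
    then consider "{x, y} = {Plain (p + 1), Plain (p + 2)}" | "{x, y} = {Prime (p + 1), Prime (p + 2)}"
      | i where "i \<in> {1..p}" "{x, y} = {Plain i, Prime i}" by (auto simp: E_def idb_def)
    then show "(x, y) \<in> ?G\<^sup>*"
      by cases (use 1 2 3 symD[OF s 1] symD[OF s 2] symD[OF s 3] in \<open>auto simp: doubleton_eq_iff\<close>)
  qed
  moreover have "brauer_mult (p + 2) (p + 2) (dag (cap p)) (cap p) = E"
  proof (rule brauer_mult_eqI[OF dag_brauer[OF cap_brauer] cap_brauer E])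
    let ?G = "product_graph (dag (cap p)) (cap p)"
    have s: "sym (?G\<^sup>*)" by (intro sym_rtrancl sym_product_graph)
    have 1: "(Plain (p + 1), Plain (p + 2)) \<in> ?G\<^sup>*"
      by (intro r_into_rtrancl pg_edges) (simp add: dag_cap)
    have 2: "(Prime (p + 1), Prime (p + 2)) \<in> ?G\<^sup>*"
      by (intro r_into_rtrancl pg_edges) (simp add: cap_def)
    have 3: "(Plain i, Prime i) \<in> ?G\<^sup>*" if "i \<in> {1..p}" for i
    proof (rule rtrancl_2[OF pg_edges(2) pg_edges(6)])
      show "{Plain i, Prime i} \<in> dag (cap p)" using that by (simp add: dag_cap)
      show "{Plain i, Prime i} \<in> cap p" using that by (simp add: cap_def)
    qed
    fix x y assume "{x, y} \<in> E"
    then consider "{x, y} = {Plain (p + 1), Plain (p + 2)}" | "{x, y} = {Prime (p + 1), Prime (p + 2)}"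
      | i where "i \<in> {1..p}" "{x, y} = {Plain i, Prime i}" by (auto simp: E_def idb_def)
    then show "(x, y) \<in> ?G\<^sup>*"
      by cases (use 1 2 3 symD[OF s 1] symD[OF s 2] symD[OF s 3] in \<open>auto simp: doubleton_eq_iff\<close>)
  qed
  ultimately show ?thesis using that z1 fz1 z2 fz2 by simp
qed

section \<open>Walks between full partitions\<close>

definition walk_step :: "nat \<Rightarrow> nat \<Rightarrow> vertex set set rel" where
  "walk_step r q = {(x, y). x \<in> brauer r q \<and> full x \<and> y \<in> brauer r q \<and> full y \<and>
    brauer_mult q q (dag x) y = idb q}"

section \<open>Transposing upper points\<close>

fun relabel_vertex :: "(nat \<Rightarrow> nat) \<Rightarrow> vertex \<Rightarrow> vertex" where
  "relabel_vertex f (Plain i) = Plain (f i)"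
| "relabel_vertex f (Prime i) = Prime i"
| "relabel_vertex f (DPrime i) = DPrime i"

definition relabel :: "nat \<Rightarrow> nat \<Rightarrow> vertex set set \<Rightarrow> vertex set set" where
  "relabel a b x = (`) (relabel_vertex (transpose a b)) ` x"

lemma relabel_vertex_involution [simp]:
  "relabel_vertex (transpose a b) (relabel_vertex (transpose a b) v) = v"
  by (cases v) auto

lemma relabel_brauer:
  assumes x: "x \<in> brauer r q" and ab: "a \<in> {1..r}" "b \<in> {1..r}"
  shows "relabel a b x \<in> brauer r q"
proof -
  let ?f = "relabel_vertex (transpose a b)"
  have sub: "?f ` verts r q \<subseteq> verts r q"
  proof
    fix v assume "v \<in> ?f ` verts r q"
    then obtain w where w: "w \<in> verts r q" "v = ?f w" by blast
    then show "v \<in> verts r q" using ab by (cases w) (auto simp: transpose_def)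
  qed
  have "verts r q \<subseteq> ?f ` verts r q"
  proof
    fix v assume "v \<in> verts r q"
    then have "?f v \<in> verts r q" using sub by blast
    then have "?f (?f v) \<in> ?f ` verts r q" by (rule imageI)
    then show "v \<in> ?f ` verts r q" by simp
  qed
  then have "?f ` verts r q = verts r q" using sub by simp
  moreover have "inj ?f" by (metis injI relabel_vertex_involution)
  then have "inj_on ?f (verts r q)" by (rule inj_on_subset) simp
  ultimately show ?thesis using pm_image[of "verts r q" x ?f] x by (simp add: brauer_iff relabel_def)
qed

lemma relabel_edge:
  "{v, w} \<in> relabel a b x \<longleftrightarrow> {relabel_vertex (transpose a b) v, relabel_vertex (transpose a b) w} \<in> x"
  (is "_ \<longleftrightarrow> {?f v, ?f w} \<in> x")
proof
  assume "{v, w} \<in> relabel a b x"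
  then obtain B where B: "B \<in> x" "{v, w} = ?f ` B" by (auto simp: relabel_def)
  have "{?f v, ?f w} = ?f ` {v, w}" by simp
  also have "\<dots> = B" unfolding B(2) image_image by simp
  finally show "{?f v, ?f w} \<in> x" using B(1) by simp
next
  assume "{?f v, ?f w} \<in> x"
  then have "?f ` {?f v, ?f w} \<in> relabel a b x" unfolding relabel_def by (rule imageI)
  then show "{v, w} \<in> relabel a b x" by simp
qed

lemma full_relabel: "full (relabel a b x) \<longleftrightarrow> full x"
  by (simp add: full_def relabel_edge)

definition token :: "vertex set set \<Rightarrow> nat \<Rightarrow> bool" where
  "token x a \<longleftrightarrow> (\<exists>i. {Plain a, Prime i} \<in> x)"

lemma token_relabel: "token (relabel a b x) c \<longleftrightarrow> token x (transpose a b c)"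
  by (simp add: token_def relabel_edge)

text \<open>Only the lower point \<open>i\<close> attached to \<open>c\<close> is affected. With
  \<open>b\<close> the partner of \<open>a\<close>, the path for it is \<open>i\<close>,
  \<open>c\<close>, \<open>b\<close>, \<open>a\<close>, \<open>i\<close>: the relabelled hook leads
  from \<open>c\<close> to \<open>b\<close>, the mirrored old hook from \<open>b\<close> to
  \<open>a\<close>, and \<open>a\<close> now carries \<open>i\<close>.\<close>

lemma walk_step_token_hook:
  assumes x: "x \<in> brauer r q" "full x" and c: "token x c" and a: "\<not> token x a" "a \<in> {1..r}"
  shows "(x, relabel a c x) \<in> walk_step r q"
proof -
  let ?y = "relabel a c x"
  have ci: "c \<in> {1..r}" using c brauer_edge[OF x(1)] by (fastforce simp: token_def)
  have y: "?y \<in> brauer r q" "full ?y" using relabel_brauer[OF x(1) a(2) ci] x(2) full_relabel by auto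
  have ac: "a \<noteq> c" using a c by auto
  obtain b where b: "b \<in> {1..r}" "{Plain a, Plain b} \<in> x"
    using brauer_Plain_cases[OF x(1) a(2)] a(1) by (metis token_def)
  have ba: "b \<noteq> a" using brauer_edge(3)[OF x(1) b(2)] by auto
  have "{Plain b, Plain a} \<in> x" using b(2) by (simp add: insert_commute)
  then have bc: "b \<noteq> c" using c brauer_unique[OF x(1), of "Plain b" "Plain a"]
    by (auto simp: token_def)
  let ?G = "product_graph (dag x) ?y"
  have "brauer_mult q q (dag x) ?y = idb q"
  proof (rule brauer_mult_eqI'[OF dag_brauer[OF x(1)] y(1) idb_brauer])
    fix i j assume "{Plain i, Prime j} \<in> idb q"
    then have ij: "j = i" "i \<in> {1..q}" by auto
    obtain d where d: "{Plain d, Prime i} \<in> x" using fullE[OF x(2,1) ij(2)] by metis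
    then have da: "d \<noteq> a" using a(1) by (auto simp: token_def)
    have d': "{Plain i, Prime d} \<in> dag x" using d by (simp add: dag_edge insert_commute)
    show "(Plain i, Prime j) \<in> ?G\<^sup>*"
    proof (cases "d = c")
      case False
      then have "{Plain d, Prime i} \<in> ?y" using d da by (simp add: relabel_edge)
      then show ?thesis unfolding ij(1) by (rule rtrancl_2[OF pg_edges(2)[OF d'] pg_edges(6)])
    next
      case True
      have d'': "{Plain i, Prime c} \<in> dag x" using d' True by simp
      have 1: "{Plain c, Plain b} \<in> ?y" using b(2) ba bc by (simp add: relabel_edge)
      have 2: "{Prime b, Prime a} \<in> dag x" using b(2) by (simp add: dag_edge insert_commute)
      have 3: "{Plain a, Prime i} \<in> ?y" using d True by (simp add: relabel_edge)
      show ?thesis unfolding ij(1)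
        by (rule rtrancl_4[OF pg_edges(2)[OF d''] pg_edges(5)[OF 1] pg_edges(4)[OF 2] pg_edges(6)[OF 3]])
    qed
  qed auto
  then show ?thesis using x y by (simp add: walk_step_def)
qed

lemma walk_transpose_different:
  assumes x: "x \<in> brauer r q" "full x" and ab: "a \<in> {1..r}" "b \<in> {1..r}" "token x a \<noteq> token x b"
  shows "(x, relabel a b x) \<in> walk_step r q"
proof (cases "token x b")
  case True
  then show ?thesis using walk_step_token_hook[OF x True _ ab(1)] ab(3) by simp
next
  case False
  then have "(x, relabel b a x) \<in> walk_step r q" using walk_step_token_hook[OF x _ False ab(2)] ab(3) by simp
  then show ?thesis by (simp add: relabel_def transpose_commute)
qed

text \<open>For \<open>e\<close> of the other kind than \<open>a\<close> and \<open>b\<close>, each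
  of the three transpositions, at the moment when it is applied, exchanges a transversal point with
  a hook point.\<close>

lemma relabel_conjugate:
  assumes "a \<noteq> b" "a \<noteq> e" "b \<noteq> e"
  shows "relabel e b (relabel a b (relabel a e x)) = relabel a b x"
proof -
  have "relabel_vertex (transpose e b) (relabel_vertex (transpose a b) (relabel_vertex (transpose a e) v)) =
      relabel_vertex (transpose a b) v" for v
    using assms by (cases v) (auto simp: transpose_def)
  then show ?thesis by (simp add: relabel_def image_image)
qed

text \<open>Points of the same kind are exchanged with the help of a point of the other kind.\<close>

lemma walk_transpose:
  assumes q: "0 < q" "q < r" and x: "x \<in> brauer r q" "full x" and ab: "a \<in> {1..r}" "b \<in> {1..r}" "a \<noteq> b"
  shows "(x, relabel a b x) \<in> (walk_step r q)\<^sup>*"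
proof (cases "token x a = token x b")
  case False
  then show ?thesis using walk_transpose_different[OF x ab(1,2)] by blast
next
  case True
  have "\<exists>e\<in>{1..r}. token x e \<noteq> token x a"
  proof (cases "token x a")
    case True
    obtain c d where cd: "{Plain c, Plain d} \<in> x" using full_has_hook[OF x q(2)] by metis
    then have "\<not> token x c" using brauer_unique[OF x(1) cd] by (auto simp: token_def)
    then show ?thesis using True brauer_edge(1)[OF x(1) cd] by auto
  next
    case False
    obtain c where "c \<in> {1..r}" "{Plain c, Prime 1} \<in> x" using fullE[OF x(2,1), of 1] q by auto
    then show ?thesis using False by (auto simp: token_def)
  qed
  then obtain e where e: "e \<in> {1..r}" "token x e \<noteq> token x a" by blast
  then have ne: "a \<noteq> e" "b \<noteq> e" using True by auto
  let ?x1 = "relabel a e x" and ?x2 = "relabel a b (relabel a e x)"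
  have x1: "?x1 \<in> brauer r q" "full ?x1" using relabel_brauer[OF x(1) ab(1) e(1)] x(2) full_relabel by auto
  have x2: "?x2 \<in> brauer r q" "full ?x2" using relabel_brauer[OF x1(1) ab(1,2)] x1(2) full_relabel by auto
  have "(x, ?x1) \<in> walk_step r q" by (rule walk_transpose_different[OF x ab(1) e(1)]) (use e in simp)
  moreover have "(?x1, ?x2) \<in> walk_step r q"
    by (rule walk_transpose_different[OF x1 ab(1,2)]) (use e True ne ab in \<open>simp add: token_relabel\<close>)
  moreover have "(?x2, relabel e b ?x2) \<in> walk_step r q"
    by (rule walk_transpose_different[OF x2 e(1) ab(2)]) (use e True ne ab in \<open>simp add: token_relabel\<close>)
  ultimately have "(x, relabel e b ?x2) \<in> (walk_step r q)\<^sup>*" by (rule rtrancl_3)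
  then show ?thesis unfolding relabel_conjugate[OF ab(3) ne] .
qed

text \<open>Transposing \<open>u\<close> and \<open>c\<close> moves the edge of \<open>x\<close> at
  the common neighbour \<open>w\<close> onto the edge of \<open>y\<close> there. If the transversals
  agree, the disagreement is sought among the hooks, so \<open>w\<close> can lie in either
  row.\<close>

lemma disagreement:
  assumes x: "x \<in> brauer r q" "full x" and y: "y \<in> brauer r q" "full y" and ne: "x \<noteq> y"
  obtains w u c where "{w, Plain u} \<in> y" "{w, Plain c} \<in> x" "u \<noteq> c"
proof (cases "\<exists>i u c. {Plain u, Prime i} \<in> y \<and> {Plain c, Prime i} \<in> x \<and> u \<noteq> c")
  case True
  then show ?thesis using that by (metis insert_commute)
next
  case agree: False
  have tok: "{Plain u, Prime i} \<in> x \<longleftrightarrow> {Plain u, Prime i} \<in> y" for u i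
  proof
    assume e: "{Plain u, Prime i} \<in> x"
    have i: "i \<in> {1..q}" using brauer_edge[OF x(1) e] by simp
    obtain c where c: "{Plain c, Prime i} \<in> y" using fullE[OF y(2,1) i] by metis
    then have "c = u" using agree e by blast
    then show "{Plain u, Prime i} \<in> y" using c by simp
  next
    assume e: "{Plain u, Prime i} \<in> y"
    have i: "i \<in> {1..q}" using brauer_edge[OF y(1) e] by simp
    obtain c where c: "{Plain c, Prime i} \<in> x" using fullE[OF x(2,1) i] by metis
    then have "u = c" using agree e by blast
    then show "{Plain u, Prime i} \<in> x" using c by simp
  qed
  have "\<not> y \<subseteq> x" using pm_subset_eq[of "verts r q" y x] x(1) y(1) ne by (auto simp: brauer_iff)
  then obtain B where B: "B \<in> y" "B \<notin> x" by blast
  obtain v w where vw: "B = {v, w}" "v \<in> verts r q" "w \<in> verts r q"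
    using pm_block2 B(1) y(1) by (metis brauer_iff)
  have "\<exists>i. v = Plain i"
  proof (cases v)
    case (Prime i)
    have "{Prime i, w} \<in> y" using B vw Prime by simp
    then obtain a where "w = Plain a" using y(2) vw(3) by (cases w) (auto simp: full_def)
    then show ?thesis using tok B vw Prime by (metis insert_commute)
  qed (use vw in auto)
  then obtain u where u: "v = Plain u" by blast
  have "\<exists>i. w = Plain i"
  proof (cases w)
    case (Prime i)
    then show ?thesis using tok B vw u by metis
  qed (use vw in auto)
  then obtain w' where w: "w = Plain w'" by blast
  have e: "{Plain w', Plain u} \<in> y" using B vw u w by (simp add: insert_commute)
  have w': "w' \<in> {1..r}" using vw w by simp
  show ?thesis
  proof (rule brauer_Plain_cases[OF x(1) w'])
    fix c assume c: "{Plain w', Plain c} \<in> x"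
    then have "u \<noteq> c" using B vw u w by (metis insert_commute)
    then show thesis using that e c by blast
  next
    fix i assume "{Plain w', Prime i} \<in> x"
    then have "{Plain w', Prime i} \<in> y" using tok by simp
    then show thesis using brauer_unique[OF y(1) e] by blast
  qed
qed

text \<open>Induction on the number of edges of \<open>y\<close> that are missing from
  \<open>x\<close>; a transposition obtained from \<open>disagreement\<close> inserts one of them
  and keeps the common ones.\<close>

lemma walk_connected:
  assumes q: "q < r" and x: "x \<in> brauer r q" "full x" and y: "y \<in> brauer r q" "full y"
  shows "(x, y) \<in> (walk_step r q)\<^sup>*"
proof (cases "q = 0")
  case True
  \<comment> \<open>Without lower points \<open>dag x * y\<close> is the empty partition, so any two
    vertices of the walk graph are adjacent.\<close>
  have "brauer_mult q q (dag x) y = idb q"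
    by (rule brauer_mult_eqI'[OF dag_brauer[OF x(1)] y(1) idb_brauer]) (use True in auto)
  then show ?thesis using x y by (auto simp: walk_step_def)
next
  case False
  then have q0: "0 < q" by simp
  show ?thesis using x
  proof (induction "card (y - x)" arbitrary: x rule: less_induct)
    case less
    note x = less.prems
    show ?case
    proof (cases "x = y")
      case ne: False
      obtain w u c where e: "{w, Plain u} \<in> y" "{w, Plain c} \<in> x" "u \<noteq> c"
        by (rule disagreement[OF x y ne])
      have uc: "u \<in> {1..r}" "c \<in> {1..r}" using brauer_edge(2)[OF y(1) e(1)] brauer_edge(2)[OF x(1) e(2)] by simp_all
      let ?x = "relabel u c x"
      have x': "?x \<in> brauer r q" "full ?x" using relabel_brauer[OF x(1) uc] x(2) full_relabel by auto
      have pmx: "perfect_matching (verts r q) x" and pmy: "perfect_matching (verts r q) y"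
        using x y by (simp_all add: brauer_iff)
      have w: "relabel_vertex (transpose u c) w = w"
        using brauer_edge(3)[OF x(1) e(2)] brauer_edge(3)[OF y(1) e(1)] by (cases w) (auto simp: transpose_def)
      have new: "{w, Plain u} \<in> ?x" "{w, Plain u} \<notin> x"
      proof -
        show "{w, Plain u} \<in> ?x" unfolding relabel_edge w using e(2) by simp
        show "{w, Plain u} \<notin> x" using brauer_unique[OF x(1) e(2), of "Plain u"] e(3) by blast
      qed
      \<comment> \<open>A common block contains neither \<open>u\<close> nor \<open>c\<close>: the
        block of \<open>y\<close> at \<open>u\<close> and the block of \<open>x\<close> at
        \<open>c\<close> both contain \<open>w\<close>, and they differ.\<close>
      have keep: "B \<in> ?x" if B: "B \<in> x" "B \<in> y" for B
      proof -
        have "Plain u \<notin> B" using pm_disj[OF pmy B(2) e(1), of "Plain u"] B(1) new(2) by blast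
        moreover have "Plain c \<notin> B"
        proof
          assume "Plain c \<in> B"
          then have "B = {w, Plain c}" using pm_disj[OF pmx B(1) e(2), of "Plain c"] by simp
          then have "Plain u = Plain c" using brauer_unique[OF y(1) e(1), of "Plain c"] B(2) by simp
          then show False using e(3) by simp
        qed
        ultimately have "relabel_vertex (transpose u c) v = v" if "v \<in> B" for v
          using that by (cases v) (auto simp: transpose_def)
        then have "relabel_vertex (transpose u c) ` B = B" by simp
        then show ?thesis using B(1) unfolding relabel_def by (metis imageI)
      qed
      have "y - ?x \<subset> y - x" using keep new e(1) by blast
      moreover have "finite (y - x)" using pm_finite[OF pmy] by simp
      ultimately have "card (y - ?x) < card (y - x)" by (rule psubset_card_mono[rotated])
      from less.hyps[OF this x'] have "(?x, y) \<in> (walk_step r q)\<^sup>*" .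
      then show ?thesis using walk_transpose[OF q0 q x uc e(3)] by (rule rtrancl_trans[rotated])
    qed simp
  qed
qed

section \<open>Counting\<close>

lemma dfact_rec:
  assumes "1 \<le> k"
  shows "dfact k = k * dfact (k - 2)"
proof -
  have eq: "{i \<in> {1..k}. even (k - i)} = insert k {i \<in> {1..k - 2}. even (k - 2 - i)}"
  proof (intro equalityI subsetI)
    fix i assume i: "i \<in> {i \<in> {1..k}. even (k - i)}"
    then have "i \<noteq> k - 1" by auto
    then show "i \<in> insert k {i \<in> {1..k - 2}. even (k - 2 - i)}" using i by auto
  qed (use assms in auto)
  have fin: "finite {i \<in> {1..k - 2}. even (k - 2 - i)}" by (rule finite_subset[of _ "{1..k - 2}"]) auto
  have "k \<notin> {i \<in> {1..k - 2}. even (k - 2 - i)}" by simp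
  from prod.insert[OF fin this, of "\<lambda>i. i"] show ?thesis by (simp only: dfact_def eq)
qed

lemma dfact_pos: "0 < dfact k"
  unfolding dfact_def by (rule prod_pos) auto

lemma dfact_minus_one: "dfact (- 1) = 1"
  by (simp add: dfact_def)

text \<open>The quotient of \<open>(n-1)!!\<close> by \<open>(n-2k-1)!!\<close>, stated without
  division. The bound on \<open>k\<close> keeps the subtraction in \<open>nat\<close> from being
  truncated; its extreme case \<open>n = 2k\<close> ends at \<open>(-1)!!\<close>.\<close>

lemma prod_eq_dfact:
  assumes "2 * k \<le> n"
  shows "int (\<Prod>j<k. n - 2 * j - 1) * dfact (int n - 2 * int k - 1) = dfact (int n - 1)"
  using assms
proof (induction k)
  case (Suc k)
  have n: "2 * int k + 2 \<le> int n" using Suc.prems by simp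
  have "dfact (int n - 2 * int k - 1) = (int n - 2 * int k - 1) * dfact (int n - 2 * int k - 1 - 2)"
    using n by (intro dfact_rec) linarith
  moreover have "int n - 2 * int k - 1 - 2 = int n - 2 * int (Suc k) - 1" by simp
  moreover have e: "int (n - 2 * k - 1) = int n - 2 * int k - 1" using Suc.prems by (simp add: of_nat_diff)
  moreover have "int (\<Prod>j<k. n - 2 * j - 1) * dfact (int n - 2 * int k - 1) = dfact (int n - 1)"
    using Suc by simp
  ultimately show ?case by (simp only: prod.lessThan_Suc of_nat_mult mult.assoc)
qed simp

section \<open>Counting lifts\<close>

fun down_up_vertex :: "vertex \<Rightarrow> vertex" where
  "down_up_vertex (DPrime i) = Plain i"
| "down_up_vertex v = v"

lemma image_image_eq:
  assumes "\<And>B v. B \<in> A \<Longrightarrow> v \<in> B \<Longrightarrow> g (f v) = v"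
  shows "(`) g ` (`) f ` A = A"
proof -
  have "g ` f ` B = B" if "B \<in> A" for B
    unfolding image_image using assms[OF that] by simp
  then show ?thesis by (simp add: image_image)
qed

text \<open>In gluing with \<open>t\<close>, its transversals only rename points, while each of its
  \<open>k\<close> lower hooks is a pair inside the middle row and contributes a factor. As
  \<open>t\<close> has no upper hook, every block of it meets the middle row, which is what
  \<open>card_msum_fiber\<close> demands.\<close>

lemma card_fiber:
  assumes t: "t \<in> brauer r m" "full (dag t)" and x: "x \<in> brauer r q"
  shows "\<exists>k. m = r + 2 * k \<and> card {u \<in> brauer m q. brauer_mult r q t u = x} = (\<Prod>j<k. m + q - 2 * j - 1)"
proof -
  let ?N = "(`) down_vertex ` t"
  let ?T = "Plain ` {1..r} \<union> DPrime ` {1..m}"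
  let ?S = "DPrime ` {1..m} \<union> Prime ` {1..q}"
  let ?F = "{u \<in> brauer m q. brauer_mult r q t u = x}"
  let ?F' = "{u. perfect_matching ?S u \<and> msum ?N u = x}"
  let ?up = "(`) ((`) up_vertex)" and ?dn = "(`) ((`) down_up_vertex)"
  have N: "perfect_matching ?T ?N" by (rule pm_down[OF t(1)])
  have finN: "finite ?N" using pm_finite[OF N] by simp
  have cS: "card ?S = m + q"
    by (subst card_Un_disjoint) (auto simp: card_image inj_on_def)
  have cT: "card ?T = r + m"
    by (subst card_Un_disjoint) (auto simp: card_image inj_on_def)
  have meets: "B \<inter> ?S \<noteq> {}" if B: "B \<in> ?N" for B
  proof -
    obtain C where C: "C \<in> t" "B = down_vertex ` C" using B by blast
    obtain v w where vw: "v \<noteq> w" "C = {v, w}" "v \<in> verts r m" "w \<in> verts r m"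
      using pm_block2 C(1) t(1) by (metis brauer_iff)
    have "\<not> (\<exists>i j. v = Plain i \<and> w = Plain j)" using t(2) C(1) vw(2) by (auto simp: full_def dag_edge)
    then obtain i where "Prime i \<in> C" "i \<in> {1..m}" using vw by (cases v; cases w) auto
    then have "DPrime i \<in> B \<inter> ?S" using C by force
    then show ?thesis by blast
  qed
  have w: "perfect_matching (sym_diff ?T ?S) x" using x unfolding sym_diff_verts by (simp add: brauer_iff)
  define k where "k = card {B \<in> ?N. B \<subseteq> ?S}"
  have count: "card ?F' = (\<Prod>j<k. m + q - 2 * j - 1)"
    using card_msum_fiber[OF finN N _ meets w] unfolding k_def cS by simp
  have inv1: "?dn (?up u) = u" if "u \<in> brauer m q" for u
  proof (rule image_image_eq)
    fix B v assume "B \<in> u" "v \<in> B"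
    then have "v \<in> verts m q" using that pm_Union[of "verts m q" u] by (auto simp: brauer_iff)
    then show "down_up_vertex (up_vertex v) = v" by (cases v) auto
  qed
  have "?up ` ?F = ?F'"
  proof (intro equalityI subsetI)
    fix u' assume "u' \<in> ?up ` ?F"
    then show "u' \<in> ?F'" using pm_up brauer_mult_msum[OF t(1)] by auto
  next
    fix u' assume u': "u' \<in> ?F'"
    have inj: "inj_on down_up_vertex ?S" by (auto simp: inj_on_def)
    have "down_up_vertex ` ?S = verts m q" by (auto simp: verts_def image_Un image_image)
    then have B: "?dn u' \<in> brauer m q" using pm_image[OF _ inj, of u'] u' by (simp add: brauer_iff)
    have inv2: "?up (?dn u') = u'"
    proof (rule image_image_eq)
      fix B v assume "B \<in> u'" "v \<in> B"
      then have "v \<in> ?S" using u' pm_Union[of ?S u'] by auto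
      then show "up_vertex (down_up_vertex v) = v" by auto
    qed
    then have "?dn u' \<in> ?F" using B u' brauer_mult_msum[OF t(1) B] by simp
    then show "u' \<in> ?up ` ?F" using inv2 by (metis imageI)
  qed
  moreover have "inj_on ?up ?F"
    by (rule inj_on_inverseI[where g = ?dn]) (use inv1 in simp)
  ultimately have "card ?F' = card ?F" using card_image[of ?up ?F] by (simp only:)
  then have cF: "card ?F = (\<Prod>j<k. m + q - 2 * j - 1)" using count by (simp only:)
  obtain h where h: "\<And>i. i \<in> {1..r} \<Longrightarrow> {Plain (h i), Prime i} \<in> dag t"
    using full_inj[OF dag_brauer[OF t(1)] t(2)] by metis
  then have h: "{Plain i, Prime (h i)} \<in> t" if "i \<in> {1..r}" for i
    using that by (simp add: dag_edge insert_commute)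
  let ?b = "\<lambda>i. {Plain i, DPrime (h i)}"
  have bN: "?b i \<in> ?N" if "i \<in> {1..r}" for i using imageI[OF h[OF that], of "(`) down_vertex"] by simp
  \<comment> \<open>The blocks that leave \<open>?S\<close> are the \<open>r\<close> transversals of
    \<open>t\<close>; counting points then gives \<open>m = r + 2 * k\<close>.\<close>
  have "{B \<in> ?N. \<not> B \<subseteq> ?S} = ?b ` {1..r}"
  proof (intro equalityI subsetI)
    fix B assume B: "B \<in> {B \<in> ?N. \<not> B \<subseteq> ?S}"
    then have "B \<subseteq> ?T" using pm_Union[OF N] by blast
    moreover obtain v where v: "v \<in> B" "v \<notin> ?S" using B by (metis (mono_tags) mem_Collect_eq subsetI)
    ultimately have "v \<in> Plain ` {1..r}" by (metis UnE UnI1 subsetD)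
    then obtain i where i: "i \<in> {1..r}" "Plain i \<in> B" using v(1) by (metis imageE)
    have "B = ?b i" by (rule pm_disj[OF N _ bN[OF i(1)] i(2)]) (use B in auto)
    then show "B \<in> ?b ` {1..r}" using i by blast
  next
    fix B assume "B \<in> ?b ` {1..r}"
    then obtain i where "i \<in> {1..r}" "B = ?b i" by blast
    then show "B \<in> {B \<in> ?N. \<not> B \<subseteq> ?S}" using bN by auto
  qed
  moreover have "inj_on ?b {1..r}" by (rule inj_onI) (auto simp: doubleton_eq_iff)
  ultimately have "card {B \<in> ?N. \<not> B \<subseteq> ?S} = r" by (simp add: card_image)
  moreover have "card ?N = card {B \<in> ?N. B \<subseteq> ?S} + card {B \<in> ?N. \<not> B \<subseteq> ?S}"
    by (subst card_Un_disjoint[symmetric]) (use finN in \<open>auto intro: arg_cong[where f = card]\<close>)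
  moreover have "r + m = 2 * card ?N" using pm_card[OF N] cT by simp
  ultimately have "m = r + 2 * k" by (simp add: k_def)
  then show ?thesis using cF by blast
qed

section \<open>Counting the possible sets of hooks\<close>

lemma perfect_matching_exists:
  assumes "finite S" "card S = 2 * k"
  shows "\<exists>M. perfect_matching S M"
  using assms
proof (induction k arbitrary: S)
  case (Suc k)
  then obtain a b T where S: "S = insert a (insert b T)" "a \<noteq> b" "a \<notin> T" "b \<notin> T" "card T = 2 * k"
    by (auto simp: card_Suc_eq numeral_2_eq_2)
  then have "finite T" using Suc.prems by simp
  then obtain M where M: "perfect_matching T M" using Suc.IH S(5) by blast
  have "perfect_matching ({a, b} \<union> T) ({{a, b}} \<union> M)" by (rule pm_Un[OF pm_pair M]) (use S in auto)
  then show ?case using S(1) by auto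
qed auto

text \<open>Gluing with a fixed matching \<open>N\<close> of \<open>S\<close> sends every matching
  of \<open>S\<close> to the empty one, so all of them form a single fibre.\<close>

lemma card_perfect_matchings:
  assumes S: "finite S" "card S = 2 * k"
  shows "card {M. perfect_matching S M} = (\<Prod>j<k. 2 * k - 2 * j - 1)"
proof -
  obtain N where N: "perfect_matching S N" using perfect_matching_exists[OF S] by blast
  have sub: "B \<subseteq> S" if "B \<in> N" for B using pm_Union[OF N] that by blast
  have "msum N u = {}" if "perfect_matching S u" for u
    using perfect_matching_msum[OF that N S(1)] by simp
  then have "{M. perfect_matching S M} = {u. perfect_matching S u \<and> msum N u = {}}" by auto
  also have "card \<dots> = (\<Prod>j<card {B \<in> N. B \<subseteq> S}. card S - 2 * j - 1)"
  proof (rule card_msum_fiber[OF pm_finite[OF N S(1)] N S(1)])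
    show "B \<inter> S \<noteq> {}" if "B \<in> N" for B
      using sub[OF that] pm_nonempty[OF N] that by (metis inf.absorb1)
  qed simp
  also have "{B \<in> N. B \<subseteq> S} = N" using sub by auto
  also have "card N = k" using pm_card[OF N S(1)] S(2) by simp
  finally show ?thesis by (simp only: S(2))
qed

text \<open>Here \<open>Q\<close> is the set of the \<open>q\<close> transversal points; the hooks
  can be any perfect matching of the remaining points.\<close>

lemma hooks_full_image:
  "hooks ` {x \<in> brauer r q. full x} =
    (\<Union>Q\<in>{Q. Q \<subseteq> {1..r} \<and> card Q = q}. {H. perfect_matching (Plain ` ({1..r} - Q)) H})"
proof (intro equalityI subsetI)
  fix H assume "H \<in> hooks ` {x \<in> brauer r q. full x}"
  then obtain x where x: "x \<in> brauer r q" "full x" "H = hooks x" by blast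
  have pm: "perfect_matching (verts r q) x" using x by (simp add: brauer_iff)
  obtain h where h: "inj_on h {1..q}" "h ` {1..q} \<subseteq> {1..r}" "\<And>i. i \<in> {1..q} \<Longrightarrow> {Plain (h i), Prime i} \<in> x"
    using full_inj[OF x(1,2)] by metis
  let ?Q = "h ` {1..q}"
  have "card ?Q = q" using h(1) by (simp add: card_image)
  moreover have "\<Union> (hooks x) = Plain ` ({1..r} - ?Q)"
  proof (intro equalityI subsetI)
    fix v assume "v \<in> \<Union> (hooks x)"
    then obtain B where B: "B \<in> x" "B \<subseteq> range Plain" "v \<in> B" by (auto simp: hooks_def)
    then obtain a where a: "v = Plain a" by blast
    have "v \<in> verts r q" using pm_Union[OF pm] B by blast
    moreover have "a \<notin> ?Q"
    proof
      assume "a \<in> ?Q"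
      then obtain i where "i \<in> {1..q}" "a = h i" by blast
      then have "B = {Plain a, Prime i}" using pm_disj[OF pm B(1) h(3), of i v] B(3) a by auto
      then show False using B(2) by auto
    qed
    ultimately show "v \<in> Plain ` ({1..r} - ?Q)" using a by auto
  next
    fix v assume "v \<in> Plain ` ({1..r} - ?Q)"
    then obtain a where a: "a \<in> {1..r}" "a \<notin> ?Q" "v = Plain a" by auto
    show "v \<in> \<Union> (hooks x)"
    proof (rule brauer_Plain_cases[OF x(1) a(1)])
      fix j assume "{Plain a, Plain j} \<in> x"
      then have "{Plain a, Plain j} \<in> hooks x" by simp
      then show ?thesis using a(3) by blast
    next
      fix i assume i: "i \<in> {1..q}" "{Plain a, Prime i} \<in> x"
      then have "{Prime i, Plain a} \<in> x" "{Prime i, Plain (h i)} \<in> x"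
        using h(3)[of i] by (simp_all add: insert_commute)
      then have "a = h i" using brauer_unique[OF x(1)] by blast
      then show ?thesis using a(2) i(1) by blast
    qed
  qed
  ultimately show "H \<in> (\<Union>Q\<in>{Q. Q \<subseteq> {1..r} \<and> card Q = q}. {H. perfect_matching (Plain ` ({1..r} - Q)) H})"
    using h(2) pm_subset[OF pm hooks_subset] x(3) by (intro UN_I[of ?Q]) auto
next
  fix H assume "H \<in> (\<Union>Q\<in>{Q. Q \<subseteq> {1..r} \<and> card Q = q}. {H. perfect_matching (Plain ` ({1..r} - Q)) H})"
  then obtain Q where Q: "Q \<subseteq> {1..r}" "card Q = q" "perfect_matching (Plain ` ({1..r} - Q)) H" by blast
  have "finite Q" using Q(1) finite_subset by blast
  then obtain h where h: "bij_betw h {1..q} Q" using ex_bij_betw_nat_finite_1 Q(2) by blast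
  let ?f = "\<lambda>i. Plain (h i)"
  have injf: "inj_on ?f {1..q}" using inj_onD[OF bij_betw_imp_inj_on[OF h]] by (intro inj_onI) blast
  have injP: "inj_on Prime {1..q}" by (rule inj_onI) simp
  let ?x = "H \<union> (\<lambda>i. {?f i, Prime i}) ` {1..q}"
  have hQ: "?f ` {1..q} = Plain ` Q" using bij_betw_imp_surj_on[OF h] by (metis image_image)
  have "perfect_matching (?f ` {1..q} \<union> Prime ` {1..q}) ((\<lambda>i. {?f i, Prime i}) ` {1..q})"
    by (rule pm_pairs[OF injf injP]) blast
  then have "perfect_matching (Plain ` ({1..r} - Q) \<union> (?f ` {1..q} \<union> Prime ` {1..q})) ?x"
    by (rule pm_Un[OF Q(3)]) (use hQ in auto)
  moreover have "Plain ` ({1..r} - Q) \<union> (?f ` {1..q} \<union> Prime ` {1..q}) = verts r q"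
    unfolding hQ verts_def using Q(1) by blast
  ultimately have x: "?x \<in> brauer r q" by (simp add: brauer_iff)
  have HP: "B \<subseteq> range Plain" if "B \<in> H" for B using pm_Union[OF Q(3)] that by blast
  have "{Prime i, Prime j} \<notin> H" for i j using HP by blast
  then have "full ?x" by (auto simp: full_def doubleton_eq_iff)
  moreover have "hooks ?x = H" using HP by (auto simp: hooks_def)
  ultimately show "H \<in> hooks ` {x \<in> brauer r q. full x}" using x by (metis (mono_tags, lifting) imageI mem_Collect_eq)
qed

lemma card_hooks_full:
  assumes "r = q + 2 * k"
  shows "card (hooks ` {x \<in> brauer r q. full x}) = (r choose q) * (\<Prod>j<k. 2 * k - 2 * j - 1)"
proof -
  let ?Q = "{Q. Q \<subseteq> {1..r} \<and> card Q = q}"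
  let ?P = "\<lambda>Q. {H. perfect_matching (Plain ` ({1..r} - Q)) H}"
  have inj: "inj_on Plain A" for A by (rule inj_onI) simp
  have finQ: "finite ?Q" by simp
  have "card (\<Union>Q\<in>?Q. ?P Q) = (\<Sum>Q\<in>?Q. card (?P Q))"
  proof (rule card_UN_disjoint[OF finQ])
    show "\<forall>Q\<in>?Q. finite (?P Q)" by (auto intro: finite_pms)
    show "\<forall>Q\<in>?Q. \<forall>Q'\<in>?Q. Q \<noteq> Q' \<longrightarrow> ?P Q \<inter> ?P Q' = {}"
    proof (intro ballI impI)
      fix Q Q' assume Q: "Q \<in> ?Q" "Q' \<in> ?Q" "Q \<noteq> Q'"
      have False if "perfect_matching (Plain ` ({1..r} - Q)) H" "perfect_matching (Plain ` ({1..r} - Q')) H" for H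
      proof -
        have "Plain ` ({1..r} - Q) = Plain ` ({1..r} - Q')" using that pm_Union by metis
        then have "{1..r} - Q = {1..r} - Q'" using inj_image_eq_iff[OF inj[of UNIV]] by blast
        then show False using Q by blast
      qed
      then show "?P Q \<inter> ?P Q' = {}" by blast
    qed
  qed
  also have "\<dots> = (\<Sum>Q\<in>?Q. \<Prod>j<k. 2 * k - 2 * j - 1)"
  proof (rule sum.cong[OF refl])
    fix Q assume "Q \<in> ?Q"
    then have "card ({1..r} - Q) = 2 * k" using assms by (subst card_Diff_subset) (auto intro: finite_subset)
    then have "card (Plain ` ({1..r} - Q)) = 2 * k" by (simp add: card_image[OF inj])
    then show "card (?P Q) = (\<Prod>j<k. 2 * k - 2 * j - 1)" by (intro card_perfect_matchings) auto
  qed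
  also have "\<dots> = (r choose q) * (\<Prod>j<k. 2 * k - 2 * j - 1)" using n_subsets[of "{1..r}" q] by simp
  finally show ?thesis unfolding hooks_full_image .
qed

section \<open>The semigroup of Brauer morphisms\<close>

text \<open>\<open>Zero\<close> is the product of morphisms that cannot be composed; with it, composition is
  associative without side conditions.\<close>

datatype brauer_morphism = Zero | Mor nat nat "vertex set set"

instantiation brauer_morphism :: semigroup_mult
begin

fun times_brauer_morphism :: "brauer_morphism \<Rightarrow> brauer_morphism \<Rightarrow> brauer_morphism" where
  "times_brauer_morphism (Mor m n \<alpha>) (Mor n' k \<beta>) =
    (if n = n' \<and> \<alpha> \<in> brauer m n \<and> \<beta> \<in> brauer n k then Mor m k (brauer_mult m k \<alpha> \<beta>) else Zero)"
| "times_brauer_morphism Zero _ = Zero"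
| "times_brauer_morphism _ Zero = Zero"

instance
proof
  fix a b c :: brauer_morphism
  have Z: "x * Zero = Zero" for x :: brauer_morphism by (cases x) auto
  show "a * b * c = a * (b * c)"
    by (cases a; cases b; cases c) (auto simp: Z brauer_mult_closed brauer_mult_assoc)
qed

end

section \<open>Adjoints and isometries\<close>

fun adj :: "brauer_morphism \<Rightarrow> brauer_morphism" where
  "adj (Mor m n \<alpha>) = Mor n m (dag \<alpha>)"
| "adj Zero = Zero"

definition hom :: "nat \<Rightarrow> nat \<Rightarrow> brauer_morphism set" where
  "hom m n = Mor m n ` brauer m n"

definition one :: "nat \<Rightarrow> brauer_morphism" where
  "one k = Mor k k (idb k)"

definition isom :: "nat \<Rightarrow> nat \<Rightarrow> brauer_morphism set" where
  "isom m n = {a \<in> hom m n. adj a * a = one n}"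

lemma Mor_hom [simp]: "Mor m n \<alpha> \<in> hom m n \<longleftrightarrow> \<alpha> \<in> brauer m n"
  by (auto simp: hom_def)

lemma homE: "a \<in> hom m n \<Longrightarrow> (\<And>\<alpha>. a = Mor m n \<alpha> \<Longrightarrow> \<alpha> \<in> brauer m n \<Longrightarrow> thesis) \<Longrightarrow> thesis"
  by (auto simp: hom_def)

lemma finite_hom: "finite (hom m n)"
  by (simp add: hom_def finite_brauer)

lemma mult_hom: "a \<in> hom m n \<Longrightarrow> b \<in> hom n k \<Longrightarrow> a * b \<in> hom m k"
  by (auto simp: hom_def brauer_mult_closed)

lemma adj_hom: "a \<in> hom m n \<Longrightarrow> adj a \<in> hom n m"
  by (auto simp: hom_def dag_brauer)

lemma one_hom: "one k \<in> hom k k"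
  by (simp add: one_def idb_brauer)

lemma adj_adj [simp]: "adj (adj a) = a"
  by (cases a) auto

lemma adj_mult: "adj (a * b) = adj b * adj a"
  by (cases a; cases b) (auto simp: dag_brauer_iff dag_brauer_mult)

lemma adj_one [simp]: "adj (one k) = one k"
  by (simp add: one_def dag_idb)

lemma one_left: "a \<in> hom m n \<Longrightarrow> one m * a = a"
  and one_right: "a \<in> hom m n \<Longrightarrow> a * one n = a"
  by (auto simp: hom_def one_def idb_brauer idb_left idb_right)

lemma mult_eq_assoc: "a * b = c \<Longrightarrow> a * (b * d) = c * d" for a b c d :: brauer_morphism
  by (simp flip: mult.assoc)

lemma isom_hom: "a \<in> isom m n \<Longrightarrow> a \<in> hom m n"
  and isom_adj: "a \<in> isom m n \<Longrightarrow> adj a * a = one n"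
  by (simp_all add: isom_def)

lemma isom_cancel: "a \<in> isom m n \<Longrightarrow> b \<in> hom n k \<Longrightarrow> adj a * (a * b) = b"
  using mult_eq_assoc[OF isom_adj] one_left by metis

lemma isom_mult:
  assumes "a \<in> isom m n" "b \<in> isom n k"
  shows "a * b \<in> isom m k"
proof -
  have "adj (a * b) * (a * b) = one k"
    using isom_cancel[OF assms(1) isom_hom[OF assms(2)]] isom_adj[OF assms(2)]
    by (simp add: adj_mult mult.assoc)
  then show ?thesis using mult_hom[OF isom_hom[OF assms(1)] isom_hom[OF assms(2)]] by (simp add: isom_def)
qed

lemma full_if_isom: "Mor r q x \<in> isom r q \<Longrightarrow> full x"
  using full_mult_right[of "dag x" q r x q] full_idb
  by (auto simp: isom_def dag_brauer one_def split: if_splits)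

lemma isom_iff: "Mor r q x \<in> isom r q \<longleftrightarrow> x \<in> brauer r q \<and> full x"
proof
  assume x: "x \<in> brauer r q \<and> full x"
  then show "Mor r q x \<in> isom r q"
    using full_dag_mult[of x r q] by (simp add: isom_def one_def dag_brauer)
qed (auto simp: full_if_isom isom_def)

text \<open>A property of this category rather than of adjoints: lower hooks of \<open>b\<close>
  would survive in \<open>a * b\<close>. In particular every left invertible morphism is an
  isometry.\<close>

lemma isom_right_factor:
  assumes "a \<in> hom m n" "b \<in> hom n k" "a * b \<in> isom m k"
  shows "b \<in> isom n k"
  using assms by (auto simp: hom_def isom_iff dest: full_mult_right[rotated 2])

lemma one_isom: "one k \<in> isom k k"
  using one_hom one_left[OF one_hom] by (simp add: isom_def)

lemma left_invertible_isom:
  assumes "a \<in> hom k n" "b \<in> hom n k" "a * b = one k"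
  shows "b \<in> isom n k"
  using isom_right_factor[OF assms(1,2)] one_isom assms(3) by simp

lemma isom_le: "a \<in> isom m n \<Longrightarrow> n \<le> m"
  by (metis full_le isom_iff homE isom_hom)

lemma isom_square:
  assumes "a \<in> isom n n"
  shows "adj a \<in> isom n n" "a * adj a = one n"
proof -
  obtain \<alpha> where a: "a = Mor n n \<alpha>" "\<alpha> \<in> brauer n n" using isom_hom[OF assms] by (rule homE)
  then show "adj a \<in> isom n n" using assms by (simp add: isom_iff dag_brauer full_square_dag)
  then show "a * adj a = one n" using isom_adj by fastforce
qed

lemma hom_parity:
  assumes "a \<in> hom m n"
  shows "even (m + n)"
proof -
  obtain \<alpha> where "perfect_matching (verts m n) \<alpha>" using assms by (auto simp: hom_def brauer_iff)
  from pm_card[OF this] show ?thesis by (simp add: card_verts)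
qed

section \<open>Rank, walks and cuts for morphisms\<close>

fun mor_rank :: "brauer_morphism \<Rightarrow> nat" where
  "mor_rank (Mor m n \<alpha>) = brauer_rank \<alpha>"
| "mor_rank Zero = 0"

lemma isom_factorization:
  assumes "a \<in> hom m n"
  obtains u v where "u \<in> isom m (mor_rank a)" "adj v \<in> isom n (mor_rank a)" "a = u * v"
proof -
  obtain \<alpha> where a: "a = Mor m n \<alpha>" "\<alpha> \<in> brauer m n" using assms by (rule homE)
  let ?k = "brauer_rank \<alpha>"
  obtain u v where uv: "u \<in> brauer m ?k" "full u" "v \<in> brauer ?k n" "full (dag v)" "brauer_mult m n u v = \<alpha>"
    by (rule brauer_factorization[OF a(2)])
  show ?thesis
    by (rule that[of "Mor m ?k u" "Mor ?k n v"]) (use uv a in \<open>simp_all add: isom_iff dag_brauer\<close>)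
qed

lemma adj_isom_hom: "adj v \<in> isom n q \<Longrightarrow> v \<in> hom q n"
  using adj_hom[OF isom_hom, of "adj v"] by simp

lemma adj_isom_mult: "adj v \<in> isom n q \<Longrightarrow> v * adj v = one q"
  using isom_adj[of "adj v"] by simp

text \<open>Two factorizations of one element, through \<open>k\<close> and through \<open>l\<close>
  points, yield an isometry from \<open>l\<close> to \<open>k\<close> points and thus
  \<open>l \<le> k\<close>. This is applied in both directions to \<open>u * v\<close> and the
  factorization through its rank.\<close>

lemma mor_rank_mult_isom:
  assumes u: "u \<in> isom m q" and v: "adj v \<in> isom n q"
  shows "mor_rank (u * v) = q"
proof -
  have le: "l \<le> k" if "u \<in> isom m k" "adj v \<in> isom n k" "u' \<in> isom m l" "adj v' \<in> isom n l" "u * v = u' * v'"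
    for k l u v u' v'
  proof -
    note h = isom_hom[OF that(1)] adj_isom_hom[OF that(2)] isom_hom[OF that(3)] adj_isom_hom[OF that(4)]
    have "(adj u' * u) * (v * adj v') = (adj u' * u') * (v' * adj v')"
      using that(5) by (metis mult.assoc)
    also have "\<dots> = one l" using isom_adj[OF that(3)] adj_isom_mult[OF that(4)] one_left[OF one_hom] by simp
    finally have "v * adj v' \<in> isom k l"
      using h by (intro left_invertible_isom[of "adj u' * u" l k]) (auto intro: mult_hom adj_hom)
    then show ?thesis by (rule isom_le)
  qed
  have "u * v \<in> hom m n" using isom_hom[OF u] adj_isom_hom[OF v] by (rule mult_hom)
  then obtain u' v' where "u' \<in> isom m (mor_rank (u * v))" "adj v' \<in> isom n (mor_rank (u * v))" "u * v = u' * v'"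
    by (rule isom_factorization)
  then show ?thesis using le[OF u v] le[OF _ _ u v] by (metis order_antisym)
qed

lemma isom_walk:
  assumes "q < r" "x \<in> isom r q" "y \<in> isom r q"
  shows "(x, y) \<in> {(x, y). x \<in> isom r q \<and> y \<in> isom r q \<and> adj x * y = one q}\<^sup>*" (is "_ \<in> ?R\<^sup>*")
proof -
  obtain \<xi> where x: "x = Mor r q \<xi>" "\<xi> \<in> brauer r q" using isom_hom[OF assms(2)] by (rule homE)
  obtain \<eta> where y: "y = Mor r q \<eta>" "\<eta> \<in> brauer r q" using isom_hom[OF assms(3)] by (rule homE)
  have "full \<xi>" "full \<eta>" using assms x y by (simp_all add: isom_iff)
  then have "(\<xi>, \<eta>) \<in> (walk_step r q)\<^sup>*" using walk_connected[OF assms(1)] x y by blast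
  then have "(Mor r q \<xi>, Mor r q \<eta>) \<in> ?R\<^sup>*"
  proof induction
    case (step \<beta> \<gamma>)
    then have "(Mor r q \<beta>, Mor r q \<gamma>) \<in> ?R"
      by (auto simp: walk_step_def isom_iff one_def dag_brauer)
    with step.IH show ?case by (rule rtrancl_into_rtrancl)
  qed simp
  then show ?thesis using x y by simp
qed

definition cap_mor :: "nat \<Rightarrow> brauer_morphism" where
  "cap_mor p = Mor p (p + 2) (cap p)"

lemma adj_cap_mor_isom: "adj (cap_mor p) \<in> isom (p + 2) p"
  unfolding cap_mor_def adj.simps isom_iff using dag_brauer[OF cap_brauer] full_dag_cap by blast

lemma mor_cut_exists:
  assumes t: "t \<in> hom r m" "adj t \<in> isom m r" and u: "u \<in> hom m p" "t * u \<in> isom r p" and "p < r"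
  obtains u1 where "u1 \<in> hom m (p + 2)" "u1 * adj (cap_mor p) = u" "t * u1 \<in> isom r (p + 2)"
proof -
  obtain \<tau> where \<tau>: "t = Mor r m \<tau>" "\<tau> \<in> brauer r m" using t(1) by (rule homE)
  obtain \<upsilon> where \<upsilon>: "u = Mor m p \<upsilon>" "\<upsilon> \<in> brauer m p" using u(1) by (rule homE)
  have "full (dag \<tau>)" using t(2) \<tau> by (simp add: isom_iff)
  moreover have "full (brauer_mult r p \<tau> \<upsilon>)" using u(2) \<tau> \<upsilon> by (simp add: isom_iff)
  ultimately obtain \<omega> where \<omega>: "\<omega> \<in> brauer m (p + 2)" "brauer_mult m p \<omega> (dag (cap p)) = \<upsilon>"
      "full (brauer_mult r (p + 2) \<tau> \<omega>)"
    using cut_exists[OF \<tau>(2) _ \<upsilon>(2) _ assms(5)] by metis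
  show ?thesis
  proof (rule that)
    show "Mor m (p + 2) \<omega> \<in> hom m (p + 2)" unfolding Mor_hom by (rule \<omega>)
    show "Mor m (p + 2) \<omega> * adj (cap_mor p) = u"
      unfolding cap_mor_def adj.simps \<upsilon>(1) times_brauer_morphism.simps
      using \<omega> dag_brauer[OF cap_brauer] by simp
    show "t * Mor m (p + 2) \<omega> \<in> isom r (p + 2)"
      unfolding \<tau>(1) times_brauer_morphism.simps using \<omega> \<tau>(2) brauer_mult_closed[OF \<tau>(2) \<omega>(1)]
      by (simp only: isom_iff simp_thms if_True)
  qed
qed

lemma isom_nonempty: "isom (k + 2 * j) k \<noteq> {}"
proof (induction j)
  case 0
  then show ?case using one_isom[of k] by auto
next
  case (Suc j)
  then obtain x where "x \<in> isom (k + 2 * j) k" by blast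
  from isom_mult[OF adj_cap_mor_isom this] have "adj (cap_mor (k + 2 * j)) * x \<in> isom (k + 2 * Suc j) k"
    by (simp add: numeral_2_eq_2)
  then show ?case by blast
qed

text \<open>The factors of \<open>cap_product\<close> have \<open>p + 4\<close> upper points; an
  isometry \<open>w\<close> moves these into the \<open>r\<close> points and cancels in
  \<open>adj x * y\<close>.\<close>

lemma isom_cap_product:
  assumes "p + 4 \<le> r" "even (r + p)"
  obtains x y where "x \<in> isom r (p + 2)" "y \<in> isom r (p + 2)" "adj x * y = adj (cap_mor p) * cap_mor p"
proof -
  obtain \<xi> \<eta> where z: "\<xi> \<in> brauer (p + 4) (p + 2)" "full \<xi>" "\<eta> \<in> brauer (p + 4) (p + 2)" "full \<eta>"
    "brauer_mult (p + 2) (p + 2) (dag \<xi>) \<eta> = brauer_mult (p + 2) (p + 2) (dag (cap p)) (cap p)"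
    by (rule cap_product)
  let ?x = "Mor (p + 4) (p + 2) \<xi>" and ?y = "Mor (p + 4) (p + 2) \<eta>"
  have xy: "?x \<in> isom (p + 4) (p + 2)" "?y \<in> isom (p + 4) (p + 2)" using z unfolding isom_iff by blast+
  have eq: "adj ?x * ?y = adj (cap_mor p) * cap_mor p"
    unfolding cap_mor_def adj.simps times_brauer_morphism.simps
    using z dag_brauer[OF z(1)] dag_brauer[OF cap_brauer] cap_brauer by (simp only: simp_thms if_True)
  have "even (r - (p + 4))" using assms by simp
  then obtain j where "r = p + 4 + 2 * j" using assms(1) by (metis dvdE le_add_diff_inverse)
  then obtain w where w: "w \<in> isom r (p + 4)" using isom_nonempty by blast
  have "adj (w * ?x) * (w * ?y) = adj ?x * ?y"
    using isom_cancel[OF w isom_hom[OF xy(2)]] by (simp only: adj_mult mult.assoc)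
  then show ?thesis using that[OF isom_mult[OF w xy(1)] isom_mult[OF w xy(2)]] eq by simp
qed

lemma card_mor_fiber:
  assumes t: "t \<in> hom r m" "adj t \<in> isom m r" and x: "x \<in> hom r q"
  shows "\<exists>k. m = r + 2 * k \<and> card {u \<in> hom m q. t * u = x} = (\<Prod>j<k. m + q - 2 * j - 1)"
proof -
  obtain \<tau> where \<tau>: "t = Mor r m \<tau>" "\<tau> \<in> brauer r m" using t(1) by (rule homE)
  obtain \<xi> where \<xi>: "x = Mor r q \<xi>" "\<xi> \<in> brauer r q" using x by (rule homE)
  have "full (dag \<tau>)" using t(2) \<tau> by (simp add: isom_iff)
  from card_fiber[OF \<tau>(2) this \<xi>(2)] obtain k where k: "m = r + 2 * k"
    "card {u \<in> brauer m q. brauer_mult r q \<tau> u = \<xi>} = (\<Prod>j<k. m + q - 2 * j - 1)" by blast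
  have "{u \<in> hom m q. t * u = x} = Mor m q ` {u \<in> brauer m q. brauer_mult r q \<tau> u = \<xi>}"
    using \<tau> \<xi> by (auto simp: hom_def)
  moreover have "inj_on (Mor m q) A" for A by (rule inj_onI) simp
  ultimately have "card {u \<in> hom m q. t * u = x} = card {u \<in> brauer m q. brauer_mult r q \<tau> u = \<xi>}"
    by (simp add: card_image)
  then show ?thesis using k by auto
qed

text \<open>One isometry is chosen for every possible set of hooks. Isometries with equal hooks lie
  in one orbit by \<open>hooks_eq_mult\<close>, and an orbit has constant hooks by
  \<open>hooks_mult\<close>, applied to \<open>\<rho>\<close> and to its inverse.\<close>

lemma isom_representatives:
  assumes r: "r = q + 2 * k"
  shows "\<exists>X\<subseteq>isom r q. card X = (r choose q) * (\<Prod>j<k. 2 * k - 2 * j - 1) \<and>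
    (\<forall>x\<in>isom r q. \<exists>y\<in>X. \<exists>\<rho>\<in>isom q q. x = y * \<rho>) \<and>
    (\<forall>x\<in>X. \<forall>y\<in>X. \<forall>\<rho>\<in>isom q q. y = x * \<rho> \<longrightarrow> x = y)"
proof -
  let ?A = "{x \<in> brauer r q. full x}"
  let ?f = "\<lambda>H. Mor r q (inv_into ?A hooks H)"
  let ?X = "?f ` hooks ` ?A"
  have rep: "inv_into ?A hooks H \<in> ?A" "hooks (inv_into ?A hooks H) = H" if "H \<in> hooks ` ?A" for H
    using inv_into_into[OF that] f_inv_into_f[OF that] by auto
  have "inj_on ?f (hooks ` ?A)"
  proof (rule inj_onI)
    fix H K assume H: "H \<in> hooks ` ?A" and K: "K \<in> hooks ` ?A" and "?f H = ?f K"
    then have e: "inv_into ?A hooks H = inv_into ?A hooks K" by simp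
    show "H = K" by (rule trans[OF rep(2)[OF H, symmetric]]) (simp only: e rep(2)[OF K])
  qed
  then have card: "card ?X = (r choose q) * (\<Prod>j<k. 2 * k - 2 * j - 1)"
    using card_hooks_full[OF r] by (simp add: card_image)
  have sub: "?X \<subseteq> isom r q" using rep by (auto simp: isom_iff)
  have surj: "\<exists>y\<in>?X. \<exists>\<rho>\<in>isom q q. x = y * \<rho>" if x: "x \<in> isom r q" for x
  proof -
    obtain \<xi> where \<xi>: "x = Mor r q \<xi>" "\<xi> \<in> brauer r q" using isom_hom[OF x] by (rule homE)
    have "full \<xi>" using x \<xi> by (simp add: isom_iff)
    then have H: "hooks \<xi> \<in> hooks ` ?A" using \<xi> by blast
    let ?y = "inv_into ?A hooks (hooks \<xi>)"
    have y: "?y \<in> brauer r q" "full ?y" "hooks ?y = hooks \<xi>" using rep[OF H] by auto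
    let ?\<rho> = "adj (Mor r q ?y) * x"
    have "Mor r q ?y * ?\<rho> = x"
      using hooks_eq_mult[OF y(1,2) \<xi>(2) \<open>full \<xi>\<close> y(3)] \<xi> y(1)
        brauer_mult_closed[OF dag_brauer[OF y(1)] \<xi>(2)] dag_brauer[OF y(1)] by simp
    moreover have "?\<rho> \<in> hom q q" using y(1) \<xi> by (intro mult_hom[of _ _ r] adj_hom) auto
    moreover have "Mor r q ?y \<in> hom r q" using y(1) by simp
    ultimately have "?\<rho> \<in> isom q q" using isom_right_factor[of "Mor r q ?y" r q ?\<rho> q] x by simp
    moreover have "Mor r q ?y \<in> ?X" using H by blast
    ultimately show ?thesis using \<open>Mor r q ?y * ?\<rho> = x\<close> by (metis (no_types))
  qed
  have hk: "hooks \<xi> \<subseteq> hooks \<eta>" if e: "Mor r q \<eta> = Mor r q \<xi> * \<rho>" and \<xi>: "\<xi> \<in> brauer r q" and \<rho>: "\<rho> \<in> isom q q" for \<xi> \<eta> \<rho>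
  proof -
    obtain \<rho>' where "\<rho> = Mor q q \<rho>'" "\<rho>' \<in> brauer q q" using isom_hom[OF \<rho>] by (rule homE)
    then show ?thesis using e \<xi> hooks_mult[OF \<xi>, of \<rho>' q] by simp
  qed
  have uniq: "x = y" if x: "x \<in> ?X" and y: "y \<in> ?X" and \<rho>: "\<rho> \<in> isom q q" and e: "y = x * \<rho>" for x y \<rho>
  proof -
    obtain H where H: "H \<in> hooks ` ?A" "x = ?f H" using x by blast
    obtain K where K: "K \<in> hooks ` ?A" "y = ?f K" using y by blast
    let ?\<xi> = "inv_into ?A hooks H" and ?\<eta> = "inv_into ?A hooks K"
    have B: "?\<xi> \<in> brauer r q" "?\<eta> \<in> brauer r q" using rep(1)[OF H(1)] rep(1)[OF K(1)] by simp_all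
    have "x \<in> hom r q" using x sub isom_hom by blast
    then have "x = y * adj \<rho>" unfolding e mult.assoc isom_square(2)[OF \<rho>] by (rule one_right[symmetric])
    then have "hooks ?\<eta> \<subseteq> hooks ?\<xi>" unfolding H(2) K(2) by (rule hk[OF _ B(2) isom_square(1)[OF \<rho>]])
    moreover have "hooks ?\<xi> \<subseteq> hooks ?\<eta>" using e unfolding H(2) K(2) by (rule hk[OF _ B(1) \<rho>])
    ultimately have "H = K" unfolding rep(2)[OF H(1)] rep(2)[OF K(1)] by blast
    then show ?thesis using H K by simp
  qed
  show ?thesis using sub card surj uniq by (intro exI[of _ ?X] conjI ballI impI)
qed

section \<open>Sandwich semigroups with a split sandwich element\<close>

locale split_sandwich =
  fixes m n r :: nat and s t :: brauer_morphism
  assumes s_isom: "s \<in> isom n r" and adj_t_isom: "adj t \<in> isom m r"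
begin

definition smult :: "brauer_morphism \<Rightarrow> brauer_morphism \<Rightarrow> brauer_morphism" where
  "smult a b = a * (s * t) * b"

definition lifts :: "nat \<Rightarrow> brauer_morphism \<Rightarrow> brauer_morphism set" where
  "lifts k x = {u \<in> hom m k. t * u = x}"

definition colifts :: "nat \<Rightarrow> brauer_morphism \<Rightarrow> brauer_morphism set" where
  "colifts k x = {v \<in> hom k n. v * s = adj x}"

text \<open>For an element \<open>u * v\<close> the witnesses are \<open>x = t * u\<close> and
  \<open>y = adj (v * s)\<close>. By \<open>regular_iff\<close> and \<open>D_class_rank\<close>
  these are the regular elements of rank \<open>k\<close>.\<close>

definition D_class :: "nat \<Rightarrow> brauer_morphism set" where
  "D_class k = {u * v | u v x y. x \<in> isom r k \<and> y \<in> isom r k \<and> u \<in> lifts k x \<and> v \<in> colifts k y}"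

definition I_ideal :: "nat \<Rightarrow> brauer_morphism set" where
  "I_ideal q = (\<Union>k\<in>{..q}. D_class k)"

lemma t_hom: "t \<in> hom r m" and s_hom: "s \<in> hom n r"
  using adj_isom_hom[OF adj_t_isom] isom_hom[OF s_isom] by blast+

lemma t_adj_t: "t * adj t = one r" and adj_s_s: "adj s * s = one r"
  using adj_isom_mult[OF adj_t_isom] isom_adj[OF s_isom] by blast+

lemma lifts_isom:
  assumes "u \<in> lifts k x" "x \<in> isom r k"
  shows "u \<in> isom m k"
  using assms isom_right_factor[OF t_hom] by (auto simp: lifts_def)

lemma colifts_adj:
  assumes "v \<in> colifts k x"
  shows "adj v \<in> hom n k" "adj s * adj v = x"
  using assms by (auto simp: colifts_def adj_hom simp flip: adj_mult)

lemma colifts_isom: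
  assumes "v \<in> colifts k x" "x \<in> isom r k"
  shows "adj v \<in> isom n k"
  using isom_right_factor[OF adj_hom[OF s_hom] colifts_adj(1)[OF assms(1)]] colifts_adj(2)[OF assms(1)] assms(2)
  by simp

text \<open>The canonical lift; with \<open>adj_s_colifts\<close> it is the witness wherever one
  half of an element can be chosen freely.\<close>

lemma adj_t_lifts: "x \<in> hom r k \<Longrightarrow> adj t * x \<in> lifts k x"
  unfolding lifts_def
  using mult_hom[OF adj_hom[OF t_hom]] one_left mult_eq_assoc[OF t_adj_t] by auto

lemma adj_s_colifts: "x \<in> hom r k \<Longrightarrow> adj x * adj s \<in> colifts k x"
  unfolding colifts_def
  using mult_hom[OF adj_hom adj_hom[OF s_hom]] one_right[OF adj_hom] adj_s_s by (auto simp: mult.assoc)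

lemma D_classI:
  "x \<in> isom r k \<Longrightarrow> y \<in> isom r k \<Longrightarrow> u \<in> lifts k x \<Longrightarrow> v \<in> colifts k y \<Longrightarrow> u * v \<in> D_class k"
  unfolding D_class_def by blast

lemma D_classE:
  assumes "a \<in> D_class k"
  obtains x y u v where "a = u * v" "x \<in> isom r k" "y \<in> isom r k" "u \<in> lifts k x" "v \<in> colifts k y"
  using assms unfolding D_class_def by blast

lemma smult_lifts:
  assumes "v \<in> colifts k x" "u' \<in> lifts l y"
  shows "smult (u * v) (u' * v') = u * (adj x * y) * v'"
proof -
  have "smult (u * v) (u' * v') = u * ((v * s) * (t * u')) * v'" by (simp add: smult_def mult.assoc)
  then show ?thesis using assms by (simp add: lifts_def colifts_def)
qed

lemma D_class_hom: "a \<in> D_class k \<Longrightarrow> a \<in> hom m n"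
  by (auto simp: D_class_def lifts_def colifts_def intro: mult_hom)

lemma D_class_rank:
  assumes "a \<in> D_class k"
  shows "mor_rank a = k"
proof -
  obtain x y u v where a: "a = u * v" "x \<in> isom r k" "y \<in> isom r k" "u \<in> lifts k x" "v \<in> colifts k y"
    using assms by (rule D_classE)
  show ?thesis unfolding a(1)
    by (rule mor_rank_mult_isom[OF lifts_isom[OF a(4,2)] colifts_isom[OF a(5,3)]])
qed

text \<open>Cancelling \<open>u\<close> on the left and \<open>v\<close> on the right of the
  regularity equation leaves \<open>(v * s) * (t * b * s) * (t * u) = one k\<close>, which makes
  \<open>t * u\<close> and, by taking adjoints, \<open>adj (v * s)\<close> left invertible.
  Conversely, an inverse is made of canonical lifts with \<open>x\<close> and \<open>y\<close>
  exchanged.\<close>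

lemma regular_iff:
  assumes a: "a \<in> hom m n"
  shows "(\<exists>b\<in>hom m n. smult (smult a b) a = a) \<longleftrightarrow> (\<exists>k. a \<in> D_class k)"
proof
  assume "\<exists>b\<in>hom m n. smult (smult a b) a = a"
  then obtain b where b: "b \<in> hom m n" "smult (smult a b) a = a" by blast
  obtain u v where uv: "u \<in> isom m (mor_rank a)" "adj v \<in> isom n (mor_rank a)" "a = u * v"
    using a by (rule isom_factorization)
  let ?k = "mor_rank a"
  note h = isom_hom[OF uv(1)] adj_isom_hom[OF uv(2)]
  have vv: "w * (v * adj v) = w" if "w \<in> hom l ?k" for w l
    unfolding adj_isom_mult[OF uv(2)] by (rule one_right[OF that])
  let ?w = "t * b * s"
  have w: "?w \<in> hom r r" by (rule mult_hom[OF mult_hom[OF t_hom b(1)] s_hom])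
  have "(adj u * u) * (v * adj v) = adj u * a * adj v" by (simp add: uv(3) mult.assoc)
  also have "\<dots> = adj u * smult (smult a b) a * adj v" by (simp only: b(2))
  also have "\<dots> = (adj u * u) * (v * s * ?w * (t * u)) * (v * adj v)" by (simp add: uv(3) smult_def mult.assoc)
  finally have eq: "v * s * ?w * (t * u) = one ?k"
    using isom_adj[OF uv(1)] adj_isom_mult[OF uv(2)] vv one_left one_hom
      mult_hom[OF mult_hom[OF mult_hom[OF h(2) s_hom] w] mult_hom[OF t_hom h(1)]] by metis
  have "t * u \<in> isom r ?k"
    by (rule left_invertible_isom[OF mult_hom[OF mult_hom[OF h(2) s_hom] w] mult_hom[OF t_hom h(1)] eq])
  moreover have "adj (v * s) \<in> isom r ?k"
  proof (rule left_invertible_isom)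
    show "adj (?w * (t * u)) \<in> hom ?k r" by (rule adj_hom[OF mult_hom[OF w mult_hom[OF t_hom h(1)]]])
    show "adj (v * s) \<in> hom r ?k" by (rule adj_hom[OF mult_hom[OF h(2) s_hom]])
    have "adj (?w * (t * u)) * adj (v * s) = adj (v * s * ?w * (t * u))" by (simp only: adj_mult mult.assoc)
    then show "adj (?w * (t * u)) * adj (v * s) = one ?k" unfolding eq by simp
  qed
  moreover have "u \<in> lifts ?k (t * u)" using h by (simp add: lifts_def)
  moreover have "v \<in> colifts ?k (adj (v * s))" using h by (simp add: colifts_def)
  ultimately have "a \<in> D_class ?k" unfolding uv(3) by (rule D_classI)
  then show "\<exists>k. a \<in> D_class k" ..
next
  assume "\<exists>k. a \<in> D_class k"
  then obtain k where "a \<in> D_class k" ..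
  then obtain x y u v where a: "a = u * v" "x \<in> isom r k" "y \<in> isom r k" "u \<in> lifts k x" "v \<in> colifts k y"
    by (rule D_classE)
  note l = adj_t_lifts[OF isom_hom[OF a(3)]] and cl = adj_s_colifts[OF isom_hom[OF a(2)]]
  have u: "u * one k = u" using a(4) one_right by (auto simp: lifts_def)
  let ?b = "(adj t * y) * (adj x * adj s)"
  have "smult (smult a ?b) a = a"
    unfolding a(1) smult_lifts[OF a(5) l] isom_adj[OF a(3)] u smult_lifts[OF cl a(4)] isom_adj[OF a(2)] ..
  moreover have "?b \<in> hom m n" using D_class_hom[OF D_classI[OF a(3,2) l cl]] .
  ultimately show "\<exists>b\<in>hom m n. smult (smult a b) a = a" by blast
qed

text \<open>The middle factor \<open>adj y * x'\<close> is split as \<open>c * d\<close> through its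
  rank, and the halves are absorbed: \<open>u * c\<close> lies over \<open>x * c\<close>, and
  \<open>d * v'\<close> over \<open>y' * adj d\<close>.\<close>

lemma smult_D_class:
  assumes "a \<in> D_class p" "b \<in> D_class p'"
  obtains k where "k \<le> p" "smult a b \<in> D_class k"
proof -
  obtain x y u v where a: "a = u * v" "x \<in> isom r p" "y \<in> isom r p" "u \<in> lifts p x" "v \<in> colifts p y"
    using assms(1) by (rule D_classE)
  obtain x' y' u' v' where b: "b = u' * v'" "x' \<in> isom r p'" "y' \<in> isom r p'" "u' \<in> lifts p' x'" "v' \<in> colifts p' y'"
    using assms(2) by (rule D_classE)
  have "adj y * x' \<in> hom p p'" using a b by (intro mult_hom adj_hom isom_hom)
  then obtain k c d where cd: "c \<in> isom p k" "adj d \<in> isom p' k" "adj y * x' = c * d"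
    by (rule isom_factorization)
  have "smult a b = (u * c) * (d * v')"
    unfolding a(1) b(1) smult_lifts[OF a(5) b(4)] cd(3) by (simp add: mult.assoc)
  moreover have "u * c \<in> lifts k (x * c)"
    using a(4) mult_hom[OF _ isom_hom[OF cd(1)]] by (auto simp: lifts_def simp flip: mult.assoc)
  moreover have "d * v' \<in> colifts k (y' * adj d)"
    using b(5) mult_hom[OF adj_isom_hom[OF cd(2)]] by (auto simp: colifts_def adj_mult mult.assoc)
  ultimately have "smult a b \<in> D_class k"
    using D_classI[OF isom_mult[OF a(2) cd(1)] isom_mult[OF b(3) cd(2)]] by simp
  then show ?thesis using that isom_le[OF cd(1)] by blast
qed

lemma smult_I_ideal:
  assumes "a \<in> I_ideal q" "b \<in> I_ideal q"
  shows "smult a b \<in> I_ideal q"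
proof -
  obtain p p' where p: "p \<le> q" "a \<in> D_class p" and p': "b \<in> D_class p'"
    using assms unfolding I_ideal_def by blast
  obtain k where "k \<le> p" "smult a b \<in> D_class k" by (rule smult_D_class[OF p(2) p'])
  then show ?thesis using p(1) unfolding I_ideal_def by (intro UN_I[of k]) auto
qed

lemma sgen_I_ideal:
  assumes A: "A \<subseteq> I_ideal q"
  shows "sgen smult A \<subseteq> I_ideal q"
proof
  fix a assume "a \<in> sgen smult A"
  then show "a \<in> I_ideal q"
  proof induction
    case (base a)
    then show ?case using A by blast
  next
    case (mult a b)
    show ?case by (rule smult_I_ideal[OF mult.IH])
  qed
qed

text \<open>Along a walk \<open>x = z\<^sub>0, \<dots>, z\<^sub>l = y\<close> with \<open>adj z\<^sub>i * z\<^sub>i\<^sub>+\<^sub>1 = one q\<close> the middle factors of the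
  product of the generators over the \<open>z\<^sub>i\<close> cancel.\<close>

lemma D_class_generated:
  assumes q: "q < r"
    and A1: "\<And>x u. x \<in> isom r q \<Longrightarrow> u \<in> lifts q x \<Longrightarrow> \<exists>v\<in>colifts q x. u * v \<in> A"
    and A2: "\<And>x v. x \<in> isom r q \<Longrightarrow> v \<in> colifts q x \<Longrightarrow> \<exists>u\<in>lifts q x. u * v \<in> A"
  shows "D_class q \<subseteq> sgen smult A"
proof
  fix a assume "a \<in> D_class q"
  then obtain x y u v where a: "a = u * v" "x \<in> isom r q" "y \<in> isom r q" "u \<in> lifts q x" "v \<in> colifts q y"
    by (rule D_classE)
  have u: "u * one q = u" using a(4) one_right by (auto simp: lifts_def)
  have "(x, y) \<in> {(x, y). x \<in> isom r q \<and> y \<in> isom r q \<and> adj x * y = one q}\<^sup>*"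
    using isom_walk[OF q a(2,3)] .
  \<comment> \<open>The right half is kept arbitrary over the current end of the walk, so that the
    next step can use the canonical one.\<close>
  then have "y \<in> isom r q \<and> (\<forall>v\<in>colifts q y. u * v \<in> sgen smult A)"
  proof induction
    case base
    show ?case
    proof (intro conjI ballI)
      fix v assume v: "v \<in> colifts q x"
      obtain v1 where v1: "v1 \<in> colifts q x" "u * v1 \<in> A" using A1[OF a(2,4)] by blast
      obtain u1 where u1: "u1 \<in> lifts q x" "u1 * v \<in> A" using A2[OF a(2) v] by blast
      have "smult (u * v1) (u1 * v) \<in> sgen smult A" using v1(2) u1(2) by (intro sgen.intros)
      then show "u * v \<in> sgen smult A" unfolding smult_lifts[OF v1(1) u1(1)] isom_adj[OF a(2)] u .
    qed (fact a)
  next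
    case (step z y)
    then have z: "z \<in> isom r q" and y: "y \<in> isom r q" and zy: "adj z * y = one q" by auto
    show ?case
    proof (intro conjI ballI)
      fix v assume v: "v \<in> colifts q y"
      note v1 = adj_s_colifts[OF isom_hom[OF z]]
      obtain u1 where u1: "u1 \<in> lifts q y" "u1 * v \<in> A" using A2[OF y v] by blast
      have "u * (adj z * adj s) \<in> sgen smult A" using step.IH v1 by blast
      then have "smult (u * (adj z * adj s)) (u1 * v) \<in> sgen smult A"
        using sgen.base[OF u1(2)] by (rule sgen.mult)
      then show "u * v \<in> sgen smult A" unfolding smult_lifts[OF v1 u1(1)] zy u .
    qed (fact y)
  qed
  then show "a \<in> sgen smult A" using a by blast
qed

text \<open>Both \<open>u\<close> and \<open>adj v\<close> are cut. The middle factor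
  \<open>adj (cap_mor p) * cap_mor p\<close> undoes both cuts, and as it equals
  \<open>adj z1 * z2\<close>, it arises in a sandwich product of two elements of
  \<open>D_class (p + 2)\<close>.\<close>

lemma D_class_descend:
  assumes A: "D_class (p + 2) \<subseteq> sgen smult A" and p: "p + 4 \<le> r" "even (r + p)"
  shows "D_class p \<subseteq> sgen smult A"
proof
  fix a assume "a \<in> D_class p"
  then obtain x y u v where a: "a = u * v" "x \<in> isom r p" "y \<in> isom r p" "u \<in> lifts p x" "v \<in> colifts p y"
    by (rule D_classE)
  let ?c = "cap_mor p"
  have pr: "p < r" using p by simp
  have u: "u \<in> hom m p" "t * u \<in> isom r p" using a by (auto simp: lifts_def)
  obtain u1 where u1: "u1 \<in> hom m (p + 2)" "u1 * adj ?c = u" "t * u1 \<in> isom r (p + 2)"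
    by (rule mor_cut_exists[OF t_hom adj_t_isom u pr])
  have s': "adj (adj s) \<in> isom n r" using s_isom by simp
  have v: "adj v \<in> hom n p" "adj s * adj v \<in> isom r p" using colifts_adj[OF a(5)] a(3) by auto
  obtain w where w: "w \<in> hom n (p + 2)" "w * adj ?c = adj v" "adj s * w \<in> isom r (p + 2)"
    by (rule mor_cut_exists[OF adj_hom[OF s_hom] s' v pr])
  obtain z1 z2 where z: "z1 \<in> isom r (p + 2)" "z2 \<in> isom r (p + 2)" "adj z1 * z2 = adj ?c * ?c"
    by (rule isom_cap_product[OF p])
  note l = adj_t_lifts[OF isom_hom[OF z(2)]] and cl = adj_s_colifts[OF isom_hom[OF z(1)]]
  have "u1 \<in> lifts (p + 2) (t * u1)" using u1 by (simp add: lifts_def)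
  then have 1: "u1 * (adj z1 * adj s) \<in> sgen smult A" using A D_classI[OF u1(3) z(1) _ cl] by blast
  have "adj w \<in> colifts (p + 2) (adj s * w)" using adj_hom[OF w(1)] by (simp add: colifts_def adj_mult)
  then have 2: "(adj t * z2) * adj w \<in> sgen smult A" using A D_classI[OF z(2) w(3) l] by blast
  have "v = ?c * adj w" using w(2) by (metis adj_adj adj_mult)
  then have "a = u1 * (adj z1 * z2) * adj w" unfolding a(1) z(3) u1(2)[symmetric] by (simp add: mult.assoc)
  also have "\<dots> = smult (u1 * (adj z1 * adj s)) ((adj t * z2) * adj w)" by (rule smult_lifts[OF cl l, symmetric])
  also have "\<dots> \<in> sgen smult A" using 1 2 by (rule sgen.mult)
  finally show "a \<in> sgen smult A" .
qed

lemma I_ideal_generated: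
  assumes A: "D_class q \<subseteq> sgen smult A" and q: "q < r" "even (r + q)"
  shows "I_ideal q \<subseteq> sgen smult A"
proof
  fix a assume "a \<in> I_ideal q"
  then obtain k where k: "k \<le> q" "a \<in> D_class k" by (auto simp: I_ideal_def)
  have "even (r + k)"
  proof -
    obtain x where "x \<in> isom r k" using k(2) by (rule D_classE)
    then show ?thesis using hom_parity isom_hom by blast
  qed
  then have "even (q - k)" using q k(1) by simp
  then obtain j where j: "q = k + 2 * j" using k(1) by (metis dvdE le_add_diff_inverse)
  have "D_class (q - 2 * i) \<subseteq> sgen smult A" if "i \<le> j" for i
    using that
  proof (induction i)
    case (Suc i)
    define p where "p = q - 2 * Suc i"
    have e: "q - 2 * i = p + 2" using Suc.prems j by (simp add: p_def)
    have p: "even (r + p)" using q(2) Suc.prems j by (simp add: p_def)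
    have "p + 2 \<le> q" using Suc.prems j by (simp add: p_def)
    \<comment> \<open>From \<open>p + 2 \<le> q < r\<close> and equal parity of \<open>p\<close> and
      \<open>r\<close>; this is where a rank strictly below \<open>r\<close> is needed for the
      descent.\<close>
    then have "p + 4 \<le> r" using q(1) p by presburger
    moreover have "D_class (p + 2) \<subseteq> sgen smult A" using Suc.IH Suc.prems unfolding e by simp
    ultimately show ?case using D_class_descend p unfolding p_def by blast
  qed (use A in simp)
  from this[of j] show "a \<in> sgen smult A" using k j by auto
qed

section \<open>Sizes of the families of lifts\<close>

lemma card_lifts:
  assumes x: "x \<in> isom r k"
  shows "\<exists>l. m = r + 2 * l \<and> card (lifts k x) = (\<Prod>j<l. m + k - 2 * j - 1)"
  unfolding lifts_def using card_mor_fiber[OF t_hom adj_t_isom isom_hom[OF x]] .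

lemma card_colifts:
  assumes x: "x \<in> isom r k"
  shows "\<exists>l. n = r + 2 * l \<and> card (colifts k x) = (\<Prod>j<l. n + k - 2 * j - 1)"
proof -
  have "colifts k x = adj ` {w \<in> hom n k. adj s * w = x}"
  proof (intro equalityI subsetI)
    fix v assume "v \<in> colifts k x"
    from colifts_adj[OF this] have "adj v \<in> {w \<in> hom n k. adj s * w = x}" by simp
    then have "adj (adj v) \<in> adj ` {w \<in> hom n k. adj s * w = x}" by (rule imageI)
    then show "v \<in> adj ` {w \<in> hom n k. adj s * w = x}" by simp
  next
    fix v assume "v \<in> adj ` {w \<in> hom n k. adj s * w = x}"
    then obtain w where "w \<in> hom n k" "adj s * w = x" "v = adj w" by blast
    then show "v \<in> colifts k x" using adj_hom by (auto simp: colifts_def adj_mult)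
  qed
  moreover have "inj_on adj B" for B by (rule inj_on_inverseI[where g = adj]) simp
  ultimately have "card (colifts k x) = card {w \<in> hom n k. adj s * w = x}" by (simp add: card_image)
  then show ?thesis using card_mor_fiber[of "adj s" r n x k] adj_hom[OF s_hom] s_isom isom_hom[OF x] by simp
qed

lemma finite_lifts: "finite (lifts k x)" and finite_colifts: "finite (colifts k x)"
  unfolding lifts_def colifts_def using finite_hom by simp_all

text \<open>Read from the smallest factor on, both products run through \<open>r + k + 1\<close>,
  \<open>r + k + 3\<close> and so on, so for \<open>n \<le> m\<close> the one for \<open>n\<close>
  is an initial part of the one for \<open>m\<close>.\<close>

lemma card_colifts_le:
  assumes "n \<le> m" and x: "x \<in> isom r k"
  shows "card (colifts k x) \<le> card (lifts k x)"
proof -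
  have rev: "(\<Prod>j<l. r + 2 * l + k - 2 * j - 1) = (\<Prod>j<l. r + k + 2 * j + 1)" for l
    by (subst prod.nat_diff_reindex[symmetric]) (intro prod.cong, auto)
  obtain l where l: "m = r + 2 * l" "card (lifts k x) = (\<Prod>j<l. m + k - 2 * j - 1)"
    using card_lifts[OF x] by blast
  obtain l' where l': "n = r + 2 * l'" "card (colifts k x) = (\<Prod>j<l'. n + k - 2 * j - 1)"
    using card_colifts[OF x] by blast
  have "(\<Prod>j<l'. r + k + 2 * j + 1) dvd (\<Prod>j<l. r + k + 2 * j + 1)"
    using assms(1) l(1) l'(1) by (intro prod_dvd_prod_subset) auto
  then have "(\<Prod>j<l'. r + k + 2 * j + 1) \<le> (\<Prod>j<l. r + k + 2 * j + 1)"
    by (rule dvd_imp_le) (simp add: prod_pos)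
  then show ?thesis using l(2) l'(2) unfolding l(1) l'(1) rev by simp
qed

text \<open>Every product starts with a generator. The remaining factor is taken in the category, so
  that a generator itself is covered by \<open>z = one n\<close>.\<close>

lemma sgen_factor:
  assumes A: "A \<subseteq> hom m n" and a: "a \<in> sgen smult A"
  shows "\<exists>b\<in>A. \<exists>z\<in>hom n n. a = b * z"
proof -
  have sg: "a \<in> hom m n" if "a \<in> sgen smult A" for a
    using that by induction
      (use A in \<open>auto simp: smult_def intro!: mult_hom[OF _ mult_hom] mult_hom[OF mult_hom[OF _ mult_hom[OF s_hom t_hom]]]\<close>)
  from a show ?thesis
  proof induction
    case (base a)
    then show ?case using A one_hom one_right by (metis subsetD)
  next
    case (mult a b)
    then obtain c z where c: "c \<in> A" "z \<in> hom n n" "a = c * z" by blast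
    have "smult a b = c * (z * (s * t) * b)" by (simp add: smult_def c(3) mult.assoc)
    moreover have "z * (s * t) * b \<in> hom n n"
      by (rule mult_hom[OF mult_hom[OF c(2) mult_hom[OF s_hom t_hom]] sg[OF mult.hyps(2)]])
    ultimately show ?case using c(1) by blast
  qed
qed

text \<open>Each lift \<open>u\<close> over a representative is assigned a generator of which it is
  a right multiple. If two lifts share a generator, they differ by a permutation
  \<open>\<rho>\<close>; applying \<open>t\<close> shows that their representatives do too, hence
  these coincide, and cancelling the representative gives \<open>\<rho> = one q\<close>.\<close>

lemma generating_set_card_ge:
  assumes A: "A \<subseteq> I_ideal q" "finite A" "D_class q \<subseteq> sgen smult A"
    and X: "X \<subseteq> isom r q" "\<And>x y \<rho>. x \<in> X \<Longrightarrow> y \<in> X \<Longrightarrow> \<rho> \<in> isom q q \<Longrightarrow> y = x * \<rho> \<Longrightarrow> x = y"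
  shows "card (SIGMA x:X. lifts q x) \<le> card A"
proof -
  let ?S = "SIGMA x:X. lifts q x"
  have Ah: "A \<subseteq> hom m n" using A(1) D_class_hom by (auto simp: I_ideal_def)
  have ex: "\<exists>b\<in>A. \<exists>w\<in>hom n q. u = b * w" if "x \<in> X" "u \<in> lifts q x" for x u
  proof -
    have x: "x \<in> isom r q" using that X by blast
    let ?v = "adj x * adj s"
    have v: "?v \<in> colifts q x" by (rule adj_s_colifts[OF isom_hom[OF x]])
    have "u * ?v \<in> sgen smult A" using D_classI[OF x x that(2) v] A(3) by blast
    then obtain b z where bz: "b \<in> A" "z \<in> hom n n" "u * ?v = b * z" using sgen_factor[OF Ah] by blast
    have vv: "?v * adj ?v = one q" by (rule adj_isom_mult[OF colifts_isom[OF v x]])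
    have "u \<in> hom m q" using that(2) by (simp add: lifts_def)
    then have "u = u * (?v * adj ?v)" unfolding vv by (rule one_right[symmetric])
    also have "\<dots> = b * (z * adj ?v)" using bz(3) by (metis mult.assoc)
    finally show ?thesis using bz colifts_adj(1)[OF v] mult_hom by blast
  qed
  define f where "f p = (SOME b. b \<in> A \<and> (\<exists>w\<in>hom n q. snd p = b * w))" for p :: "brauer_morphism \<times> brauer_morphism"
  have f: "f p \<in> A \<and> (\<exists>w\<in>hom n q. snd p = f p * w)" if "p \<in> ?S" for p
  proof -
    have "fst p \<in> X" "snd p \<in> lifts q (fst p)" using that by auto
    then have "\<exists>b. b \<in> A \<and> (\<exists>w\<in>hom n q. snd p = b * w)" using ex by blast
    then show ?thesis unfolding f_def by (rule someI_ex)
  qed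
  have "inj_on f ?S"
  proof (rule inj_onI, clarify)
    fix x1 u1 x2 u2 assume 1: "x1 \<in> X" "u1 \<in> lifts q x1" and 2: "x2 \<in> X" "u2 \<in> lifts q x2"
      and eq: "f (x1, u1) = f (x2, u2)"
    let ?b = "f (x1, u1)"
    obtain w1 where w1: "?b \<in> A" "w1 \<in> hom n q" "u1 = ?b * w1" using f[of "(x1, u1)"] 1 by auto
    obtain w2 where w2: "w2 \<in> hom n q" "u2 = ?b * w2" using f[of "(x2, u2)"] 2 eq by auto
    obtain k where k: "k \<le> q" "?b \<in> D_class k" using w1(1) A(1) by (auto simp: I_ideal_def)
    obtain x y u v where b: "?b = u * v" "x \<in> isom r k" "y \<in> isom r k" "u \<in> lifts k x" "v \<in> colifts k y"
      using k(2) by (rule D_classE)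
    have uh: "u \<in> hom m k" and vh: "v \<in> hom k n" using b by (auto simp: lifts_def colifts_def)
    have u1: "u1 = u * (v * w1)" and u2: "u2 = u * (v * w2)" using w1(3) w2(2) b(1) by (simp_all add: mult.assoc)
    have "v * w1 \<in> isom k q" using isom_right_factor[OF uh mult_hom[OF vh w1(2)]] lifts_isom[OF 1(2)] 1(1) X(1) u1 by auto
    moreover have "v * w2 \<in> isom k q" using isom_right_factor[OF uh mult_hom[OF vh w2(1)]] lifts_isom[OF 2(2)] 2(1) X(1) u2 by auto
    \<comment> \<open>A generator of rank below \<open>q\<close> cannot be a left factor of a lift,
      which has \<open>q\<close> transversals; at equal rank \<open>v * w1\<close> and
      \<open>v * w2\<close> are permutations.\<close>
    moreover have "k = q" using isom_le[OF calculation(1)] k(1) by simp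
    ultimately have w: "v * w1 \<in> isom q q" "v * w2 \<in> isom q q" and uq: "u \<in> hom m q" using uh by simp_all
    define \<rho> where "\<rho> = adj (v * w1) * (v * w2)"
    have \<rho>: "\<rho> \<in> isom q q" unfolding \<rho>_def by (rule isom_mult[OF isom_square(1)[OF w(1)] w(2)])
    have "u1 * \<rho> = u * ((v * w1) * adj (v * w1)) * (v * w2)" unfolding u1 \<rho>_def by (simp only: mult.assoc)
    also have "\<dots> = u2" unfolding isom_square(2)[OF w(1)] one_right[OF uq] u2 by (rule refl)
    finally have u12: "u2 = u1 * \<rho>" ..
    have "x2 = x1 * \<rho>" using 1(2) 2(2) u12 by (simp add: lifts_def mult.assoc[symmetric])
    then have x12: "x1 = x2" using X(2)[OF 1(1) 2(1) \<rho>] by simp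
    have x1: "x1 \<in> isom r q" using 1(1) X(1) by blast
    have "\<rho> = adj x1 * (x1 * \<rho>)" by (rule isom_cancel[OF x1 isom_hom[OF \<rho>], symmetric])
    also have "\<dots> = one q" using \<open>x2 = x1 * \<rho>\<close> x12 isom_adj[OF x1] by simp
    finally have "u2 = u1" using u12 one_right 1(2) by (auto simp: lifts_def)
    then show "x1 = x2 \<and> u1 = u2" using x12 by simp
  qed
  moreover have "f ` ?S \<subseteq> A" using f by blast
  ultimately show ?thesis using A(2) by (rule card_inj_on_le)
qed

lemma idempotent_generating_set:
  assumes mn: "n \<le> m" and q: "q < r"
    and X: "X \<subseteq> isom r q" "finite X" "\<And>x. x \<in> isom r q \<Longrightarrow> \<exists>y\<in>X. \<exists>\<rho>\<in>isom q q. x = y * \<rho>"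
  obtains A where "A \<subseteq> D_class q" "\<And>a. a \<in> A \<Longrightarrow> smult a a = a" "finite A" "D_class q \<subseteq> sgen smult A"
    "card A \<le> card (SIGMA x:X. lifts q x)"
proof -
  let ?S = "SIGMA x:X. lifts q x"
  have "\<exists>g. g ` lifts q x = colifts q x" if x: "x \<in> isom r q" for x
  proof -
    obtain h where h: "h ` colifts q x \<subseteq> lifts q x" "inj_on h (colifts q x)"
      using card_le_inj[OF finite_colifts finite_lifts card_colifts_le[OF mn x]] by blast
    \<comment> \<open>An injection of \<open>colifts\<close> into \<open>lifts\<close> turns into a
      surjection the other way because its domain is nonempty.\<close>
    moreover have "colifts q x \<noteq> {}" using adj_s_colifts[OF isom_hom[OF x]] by blast
    ultimately show ?thesis using inj_on_iff_surj by metis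
  qed
  then obtain g where g: "\<And>x. x \<in> isom r q \<Longrightarrow> g x ` lifts q x = colifts q x" by metis
  define A where "A = (\<lambda>(x, u). u * g x u) ` ?S"
  have AI: "u * g x u \<in> A" if "x \<in> X" "u \<in> lifts q x" for x u using that by (auto simp: A_def)
  have AE: "\<exists>x u. x \<in> isom r q \<and> u \<in> lifts q x \<and> g x u \<in> colifts q x \<and> a = u * g x u" if a: "a \<in> A" for a
  proof -
    obtain x u where "x \<in> X" "u \<in> lifts q x" "a = u * g x u" using a by (auto simp: A_def)
    moreover have "g x u \<in> colifts q x" using g calculation X(1) by blast
    ultimately show ?thesis using X(1) by blast
  qed
  have lifts_mult: "u * \<rho> \<in> lifts q (x * \<rho>)" if "u \<in> lifts q x" "\<rho> \<in> hom q q" for u x \<rho>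
    using that mult_hom by (auto simp: lifts_def simp flip: mult.assoc)
  have colifts_mult: "adj \<rho> * v \<in> colifts q (x * \<rho>)" if "v \<in> colifts q x" "\<rho> \<in> hom q q" for v x \<rho>
    using that mult_hom[OF adj_hom] by (auto simp: colifts_def adj_mult mult.assoc)
  have cancel: "y * \<rho> * adj \<rho> = y" "adj \<rho> * (\<rho> * v) = v"
    if "y \<in> hom k q" "\<rho> \<in> isom q q" "v \<in> hom q l" for y v \<rho> k l
  proof -
    show "y * \<rho> * adj \<rho> = y" unfolding mult.assoc isom_square(2)[OF that(2)] by (rule one_right[OF that(1)])
    show "adj \<rho> * (\<rho> * v) = v" by (rule isom_cancel[OF that(2,3)])
  qed
  have "D_class q \<subseteq> sgen smult A"
  proof (rule D_class_generated[OF q])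
    fix x u assume x: "x \<in> isom r q" and u: "u \<in> lifts q x"
    obtain y \<rho> where y: "y \<in> X" "\<rho> \<in> isom q q" "x = y * \<rho>" using X(3)[OF x] by blast
    have yi: "y \<in> isom r q" using y(1) X(1) by blast
    \<comment> \<open>Back to the representative \<open>y\<close>, over which the generators were
      defined: \<open>u * (adj \<rho> * ?v)\<close> is the generator belonging to the lift
      \<open>u * adj \<rho>\<close> of \<open>y\<close>.\<close>
    have "x * adj \<rho> = y" unfolding y(3) by (rule cancel(1)[OF isom_hom[OF yi] y(2) one_hom])
    then have u': "u * adj \<rho> \<in> lifts q y" using lifts_mult[OF u isom_hom[OF isom_square(1)[OF y(2)]]] by simp
    let ?v = "g y (u * adj \<rho>)"
    have v: "?v \<in> colifts q y" using g[OF yi] u' by blast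
    have "u * (adj \<rho> * ?v) \<in> A" using AI[OF y(1) u'] by (simp add: mult.assoc)
    then show "\<exists>v\<in>colifts q x. u * v \<in> A" using colifts_mult[OF v isom_hom[OF y(2)]] y(3) by auto
  next
    fix x v assume x: "x \<in> isom r q" and v: "v \<in> colifts q x"
    obtain y \<rho> where y: "y \<in> X" "\<rho> \<in> isom q q" "x = y * \<rho>" using X(3)[OF x] by blast
    have yi: "y \<in> isom r q" using y(1) X(1) by blast
    have "x * adj \<rho> = y" unfolding y(3) by (rule cancel(1)[OF isom_hom[OF yi] y(2) one_hom])
    then have v': "\<rho> * v \<in> colifts q y" using colifts_mult[OF v isom_hom[OF isom_square(1)[OF y(2)]]] by simp
    then have "\<rho> * v \<in> g y ` lifts q y" unfolding g[OF yi] .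
    then obtain u where u: "u \<in> lifts q y" "g y u = \<rho> * v" by (metis imageE)
    have "(u * \<rho>) * v \<in> A" using AI[OF y(1) u(1)] u(2) by (simp add: mult.assoc)
    then show "\<exists>u\<in>lifts q x. u * v \<in> A" using lifts_mult[OF u(1) isom_hom[OF y(2)]] y(3) by auto
  qed
  moreover have "A \<subseteq> D_class q" using AE D_classI by blast
  moreover have "smult a a = a" if a: "a \<in> A" for a
  proof -
    obtain x u where x: "x \<in> isom r q" "u \<in> lifts q x" "g x u \<in> colifts q x" "a = u * g x u" using AE[OF a] by blast
    have "u \<in> hom m q" using x(2) by (simp add: lifts_def)
    then show ?thesis unfolding x(4) smult_lifts[OF x(3,2)] isom_adj[OF x(1)] by (simp add: one_right)
  qed
  moreover have fin: "finite ?S" using X(2) finite_lifts by auto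
  then have "finite A" by (simp add: A_def)
  moreover have "card A \<le> card ?S" unfolding A_def using fin by (rule card_image_le)
  ultimately show ?thesis using that by blast
qed

text \<open>In \<open>N\<close> the first two factors count the sets of hooks, the last one the
  lifts over one representative. The set found has at most \<open>N\<close> elements, and the lower
  bound makes this an equality.\<close>

lemma I_ideal_ranks:
  assumes mn: "n \<le> m" and q: "q < r" and k: "r = q + 2 * k" and l: "m = r + 2 * l"
  defines "N \<equiv> (r choose q) * (\<Prod>j<k. 2 * k - 2 * j - 1) * (\<Prod>j<l. m + q - 2 * j - 1)"
  shows "\<exists>A\<subseteq>D_class q. (\<forall>a\<in>A. smult a a = a) \<and> finite A \<and> sgen smult A = I_ideal q \<and> card A = N"
    and "\<And>A. A \<subseteq> I_ideal q \<Longrightarrow> finite A \<Longrightarrow> sgen smult A = I_ideal q \<Longrightarrow> N \<le> card A"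
proof -
  obtain X where X: "X \<subseteq> isom r q" "card X = (r choose q) * (\<Prod>j<k. 2 * k - 2 * j - 1)"
    "\<And>x. x \<in> isom r q \<Longrightarrow> \<exists>y\<in>X. \<exists>\<rho>\<in>isom q q. x = y * \<rho>"
    "\<And>x y \<rho>. x \<in> X \<Longrightarrow> y \<in> X \<Longrightarrow> \<rho> \<in> isom q q \<Longrightarrow> y = x * \<rho> \<Longrightarrow> x = y"
    using isom_representatives[OF k] by metis
  have "finite (isom r q)" using finite_hom by (simp add: isom_def)
  then have finX: "finite X" using X(1) by (rule rev_finite_subset)
  have "card (lifts q x) = (\<Prod>j<l. m + q - 2 * j - 1)" if "x \<in> X" for x
    using card_lifts[of x q] that X(1) l by auto
  then have "card (SIGMA x:X. lifts q x) = card X * (\<Prod>j<l. m + q - 2 * j - 1)"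
    using finX finite_lifts by (simp add: card_SigmaI)
  then have N: "card (SIGMA x:X. lifts q x) = N" unfolding N_def X(2) .
  have DI: "D_class q \<subseteq> I_ideal q" by (auto simp: I_ideal_def)
  show lower: "N \<le> card A" if "A \<subseteq> I_ideal q" "finite A" "sgen smult A = I_ideal q" for A
    using generating_set_card_ge[OF that(1,2) _ X(1,4)] DI that(3) N by simp
  obtain A where A: "A \<subseteq> D_class q" "\<And>a. a \<in> A \<Longrightarrow> smult a a = a" "finite A" "D_class q \<subseteq> sgen smult A"
    "card A \<le> card (SIGMA x:X. lifts q x)"
    using idempotent_generating_set[OF mn q X(1) finX X(3)] by metis
  have AI: "A \<subseteq> I_ideal q" using A(1) DI by blast
  have "even (r + q)" using k by simp
  then have "sgen smult A = I_ideal q"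
    using I_ideal_generated[OF A(4) q] sgen_I_ideal[OF AI] by blast
  then show "\<exists>A\<subseteq>D_class q. (\<forall>a\<in>A. smult a a = a) \<and> finite A \<and> sgen smult A = I_ideal q \<and> card A = N"
    using A lower[OF AI A(3)] N by (intro exI[of _ A]) auto
qed

end

section \<open>Generating sets in the sandwich semigroup\<close>

lemma sgen_mono: "A \<subseteq> B \<Longrightarrow> sgen f A \<subseteq> sgen f B"
proof
  fix a assume "A \<subseteq> B" "a \<in> sgen f A"
  from this(2,1) show "a \<in> sgen f B" by induction (auto intro: sgen.intros)
qed

lemma sgen_image:
  assumes closed: "\<And>a b. a \<in> T \<Longrightarrow> b \<in> T \<Longrightarrow> f a b \<in> T \<and> h (f a b) = g (h a) (h b)" and A: "A \<subseteq> T"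
  shows "sgen g (h ` A) = h ` sgen f A" "sgen f A \<subseteq> T"
proof -
  have T: "a \<in> T" if "a \<in> sgen f A" for a
    using that by induction (use A closed in auto)
  then show "sgen f A \<subseteq> T" by blast
  show "sgen g (h ` A) = h ` sgen f A"
  proof (intro equalityI subsetI)
    fix x assume "x \<in> sgen g (h ` A)"
    then show "x \<in> h ` sgen f A"
    proof induction
      case (base a)
      then show ?case by (auto intro: sgen.base)
    next
      case (mult a b)
      then obtain c d where c: "c \<in> sgen f A" "a = h c" and d: "d \<in> sgen f A" "b = h d" by blast
      then have "g a b = h (f c d)" using closed[of c d] T by simp
      then show ?case using sgen.mult[OF c(1) d(1)] by blast
    qed
  next
    fix x assume "x \<in> h ` sgen f A"
    then obtain a where "a \<in> sgen f A" "x = h a" by blast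
    then have "h a \<in> sgen g (h ` A)"
    proof (induction arbitrary: x)
      case (mult a b)
      then have "g (h a) (h b) \<in> sgen g (h ` A)" by (blast intro: sgen.mult)
      then show ?case using closed[of a b] mult.hyps T by simp
    qed (blast intro: sgen.base)
    then show "x \<in> sgen g (h ` A)" using \<open>x = h a\<close> by simp
  qed
qed

theorem theorem6p37:
  fixes m n q r :: nat and \<sigma> :: "vertex set set"
  assumes "[m = n] (mod 2)"
    and "\<sigma> \<in> brauer n m"
    and "r = brauer_rank \<sigma>"
    and "m \<ge> n"
    and "q < r" and "[q = r] (mod 2)"
  shows "sgen (sandwich m n \<sigma>) (idempotents (sandwich m n \<sigma>) (D_set m n \<sigma> q)) = I_set m n \<sigma> q
    \<and> sg_rank (sandwich m n \<sigma>) (I_set m n \<sigma> q) = sg_idrank (sandwich m n \<sigma>) (I_set m n \<sigma> q)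
    \<and> real (sg_idrank (sandwich m n \<sigma>) (I_set m n \<sigma> q)) =
        real (r choose q) *
        (real_of_int (dfact (int r - int q - 1)) * real_of_int (dfact (int m + int q - 1)))
        / real_of_int (dfact (int r + int q - 1))"
proof -
  have \<sigma>: "Mor n m \<sigma> \<in> hom n m" using assms(2) by simp
  obtain s t where st: "s \<in> isom n r" "adj t \<in> isom m r" "Mor n m \<sigma> = s * t"
    using isom_factorization[OF \<sigma>] assms(3) by (metis mor_rank.simps(1))
  interpret split_sandwich m n r s t
    using st by unfold_locales
  let ?T = "brauer m n" and ?f = "sandwich m n \<sigma>" and ?M = "Mor m n"
  let ?D = "D_set m n \<sigma> q" and ?I = "I_set m n \<sigma> q"
  have inj: "?M \<alpha> = ?M \<beta> \<longleftrightarrow> \<alpha> = \<beta>" for \<alpha> \<beta> by simp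
  \<comment> \<open>The map \<open>?M\<close> is an injective homomorphism into the morphisms under
    \<open>smult\<close>; regularity, rank classes and generation are transferred along it.\<close>
  have f: "?f \<alpha> \<beta> \<in> ?T \<and> ?M (?f \<alpha> \<beta>) = smult (?M \<alpha>) (?M \<beta>)" if "\<alpha> \<in> ?T" "\<beta> \<in> ?T" for \<alpha> \<beta>
  proof -
    note c = brauer_mult_closed[OF that(1) assms(2)]
    show ?thesis
      using that assms(2) c brauer_mult_closed[OF c that(2)]
      by (simp add: smult_def sandwich_def flip: st(3) mult.assoc)
  qed
  have P: "\<alpha> \<in> P_reg m n \<sigma> \<longleftrightarrow> \<alpha> \<in> ?T \<and> (\<exists>k. ?M \<alpha> \<in> D_class k)" for \<alpha>
  proof (cases "\<alpha> \<in> ?T")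
    case True
    have "?f (?f \<alpha> \<beta>) \<alpha> = \<alpha> \<longleftrightarrow> smult (smult (?M \<alpha>) (?M \<beta>)) (?M \<alpha>) = ?M \<alpha>" if "\<beta> \<in> ?T" for \<beta>
      using f[OF True that] f[of "?f \<alpha> \<beta>" \<alpha>] True inj by metis
    then have "\<alpha> \<in> P_reg m n \<sigma> \<longleftrightarrow> (\<exists>\<beta>\<in>?T. smult (smult (?M \<alpha>) (?M \<beta>)) (?M \<alpha>) = ?M \<alpha>)"
      using True by (simp add: P_reg_def regular_elements_def)
    also have "\<dots> \<longleftrightarrow> (\<exists>b\<in>hom m n. smult (smult (?M \<alpha>) b) (?M \<alpha>) = ?M \<alpha>)" by (simp add: hom_def)
    finally show ?thesis using regular_iff[of "?M \<alpha>"] True by simp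
  qed (simp add: P_reg_def regular_elements_def)
  have D: "\<alpha> \<in> ?D \<longleftrightarrow> \<alpha> \<in> ?T \<and> ?M \<alpha> \<in> D_class q" for \<alpha>
    using P[of \<alpha>] D_class_rank[of "?M \<alpha>"] by (auto simp: D_set_def)
  have I: "\<alpha> \<in> ?I \<longleftrightarrow> \<alpha> \<in> ?T \<and> ?M \<alpha> \<in> I_ideal q" for \<alpha>
    using P[of \<alpha>] D_class_rank[of "?M \<alpha>"] by (auto simp: I_set_def I_ideal_def)
  have IT: "?I \<subseteq> ?T" using I by blast
  have MI: "?M ` ?I = I_ideal q"
  proof (intro equalityI subsetI)
    fix a assume a: "a \<in> I_ideal q"
    then have "a \<in> hom m n" using D_class_hom by (auto simp: I_ideal_def)
    then obtain \<alpha> where "a = ?M \<alpha>" "\<alpha> \<in> ?T" by (rule homE)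
    then show "a \<in> ?M ` ?I" using I a by blast
  qed (use I in blast)
  have sg: "sgen smult (?M ` A) = ?M ` sgen ?f A" "sgen ?f A \<subseteq> ?T" if A: "A \<subseteq> ?T" for A
    by (rule sgen_image[where T = ?T and f = ?f and g = smult and h = ?M, OF _ A], rule f, assumption+)+
  have inj_M: "inj_on ?M S" for S by (rule inj_onI) simp
  have gen: "sgen ?f A = ?I \<longleftrightarrow> sgen smult (?M ` A) = I_ideal q" if A: "A \<subseteq> ?T" for A
  proof -
    have "sgen smult (?M ` A) = ?M ` sgen ?f A" by (rule sg(1)[OF A])
    then show ?thesis unfolding MI[symmetric] by (simp add: inj_image_eq_iff[OF inj_M])
  qed

  have "even (r - q)" using assms(5,6) unfolding cong_def by presburger
  then obtain k where k: "r = q + 2 * k" using assms(5) by (metis dvdE le_add_diff_inverse less_imp_le)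
  have "r \<le> m" "even (r + m)" using isom_le[OF st(2)] hom_parity[OF t_hom] by simp_all
  then have "even (m - r)" by simp
  then obtain l where l: "m = r + 2 * l" using \<open>r \<le> m\<close> by (metis dvdE le_add_diff_inverse)
  define N where "N = (r choose q) * (\<Prod>j<k. 2 * k - 2 * j - 1) * (\<Prod>j<l. m + q - 2 * j - 1)"
  note ranks = I_ideal_ranks[OF assms(4,5) k l, folded N_def]

  obtain A' where A': "A' \<subseteq> D_class q" "\<forall>a\<in>A'. smult a a = a" "finite A'" "sgen smult A' = I_ideal q" "card A' = N"
    using ranks(1) by blast
  define A where "A = {\<alpha> \<in> ?T. ?M \<alpha> \<in> A'}"
  have MA: "?M ` A = A'"
  proof (intro equalityI subsetI)
    fix a assume a: "a \<in> A'"
    then have "a \<in> hom m n" using D_class_hom A'(1) by blast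
    then obtain \<alpha> where "a = ?M \<alpha>" "\<alpha> \<in> ?T" by (rule homE)
    then show "a \<in> ?M ` A" using a by (auto simp: A_def)
  qed (auto simp: A_def)
  have finA: "finite A" using MA A'(3) finite_imageD[OF _ inj_M] by metis
  have cardA: "card A = N" using MA A'(5) card_image[OF inj_M] by metis
  have A_sub: "A \<subseteq> ?T" by (auto simp: A_def)
  have genA: "sgen ?f A = ?I" using gen[OF A_sub] MA A'(4) by simp
  have idem: "A \<subseteq> idempotents ?f ?D"
  proof
    fix \<alpha> assume "\<alpha> \<in> A"
    then have \<alpha>: "\<alpha> \<in> ?T" "?M \<alpha> \<in> A'" by (auto simp: A_def)
    then have "?M (?f \<alpha> \<alpha>) = ?M \<alpha>" using f A'(2) by simp
    then show "\<alpha> \<in> idempotents ?f ?D" using \<alpha> A'(1) D by (auto simp: idempotents_def)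
  qed
  have DI: "?D \<subseteq> ?I" by (auto simp: D_set_def I_set_def)
  have EI: "idempotents ?f ?D \<subseteq> idempotents ?f ?I" using DI by (auto simp: idempotents_def)
  have E: "idempotents ?f ?D \<subseteq> ?I" "idempotents ?f ?I \<subseteq> ?I" using DI by (auto simp: idempotents_def)
  have first: "sgen ?f (idempotents ?f ?D) = ?I"
  proof
    show "?I \<subseteq> sgen ?f (idempotents ?f ?D)" using sgen_mono[OF idem] genA by metis
    show "sgen ?f (idempotents ?f ?D) \<subseteq> ?I"
    proof
      fix \<alpha> assume \<alpha>: "\<alpha> \<in> sgen ?f (idempotents ?f ?D)"
      have ET: "idempotents ?f ?D \<subseteq> ?T" using E(1) IT by (rule subset_trans)
      have "?M ` idempotents ?f ?D \<subseteq> I_ideal q" using E(1) MI by blast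
      then have "?M ` sgen ?f (idempotents ?f ?D) \<subseteq> I_ideal q"
        using sgen_I_ideal sg(1)[OF ET] by metis
      then show "\<alpha> \<in> ?I" using \<alpha> I sg(2)[OF ET] by blast
    qed
  qed
  have lower: "N \<le> card B" if B: "B \<subseteq> ?I" "finite B" "sgen ?f B = ?I" for B
  proof -
    have "?M ` B \<subseteq> I_ideal q" using B(1) MI by blast
    moreover have "sgen smult (?M ` B) = I_ideal q" using gen B IT by blast
    ultimately have "N \<le> card (?M ` B)" using ranks(2) B(2) by blast
    then show ?thesis using card_image[OF inj_M, of B] by simp
  qed
  \<comment> \<open>The same \<open>A\<close> attains both minima, and the lower bound for arbitrary
    generating sets covers those consisting of idempotents.\<close>
  have rank: "sg_rank ?f ?I = N"
    unfolding sg_rank_def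
  proof (rule Least_equality)
    show "\<exists>A\<subseteq>?I. finite A \<and> card A = N \<and> sgen ?f A = ?I"
      using idem E(1) finA cardA genA by (intro exI[of _ A]) auto
  qed (use lower in blast)
  have idrank: "sg_idrank ?f ?I = N"
    unfolding sg_idrank_def
  proof (rule Least_equality)
    show "\<exists>A\<subseteq>idempotents ?f ?I. finite A \<and> card A = N \<and> sgen ?f A = ?I"
      using idem EI finA cardA genA by (intro exI[of _ A]) auto
  qed (use lower E(2) in blast)

  \<comment> \<open>All factors of the double factorial are present here, the denominator being
    \<open>(-1)!! = 1\<close>.\<close>
  have 1: "int (\<Prod>j<k. 2 * k - 2 * j - 1) = dfact (int r - int q - 1)"
    using prod_eq_dfact[of k "2 * k"] dfact_minus_one by (simp add: k)
  have "int (\<Prod>j<l. m + q - 2 * j - 1) * dfact (int (m + q) - 2 * int l - 1) = dfact (int (m + q) - 1)"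
    by (rule prod_eq_dfact) (simp add: l)
  moreover have "int (m + q) - 2 * int l - 1 = int r + int q - 1" "int (m + q) - 1 = int m + int q - 1"
    by (simp_all add: l)
  ultimately have 2: "int (\<Prod>j<l. m + q - 2 * j - 1) * dfact (int r + int q - 1) = dfact (int m + int q - 1)"
    by (simp only:)
  have "real N = real (r choose q) * (real_of_int (int (\<Prod>j<k. 2 * k - 2 * j - 1)) *
      real_of_int (int (\<Prod>j<l. m + q - 2 * j - 1)))"
    unfolding N_def by simp
  \<comment> \<open>Expansion by the positive number \<open>(r+q-1)!!\<close>, which completes the
    product over \<open>l\<close> to \<open>(m+q-1)!!\<close>.\<close>
  also have "\<dots> = real (r choose q) * (real_of_int (dfact (int r - int q - 1)) *
      real_of_int (int (\<Prod>j<l. m + q - 2 * j - 1) * dfact (int r + int q - 1))) /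
      real_of_int (dfact (int r + int q - 1))"
    unfolding 1 using dfact_pos[of "int r + int q - 1"] by (simp add: field_simps)
  finally show ?thesis unfolding 2 using first rank idrank by simp
qed

end
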